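(* Let $0<x_{0}<x_{1}<\infty$ and assume: $g\in C^{1}[x_{0},x_{1}]$ with $g(x)>0$ for all $x\in[x_{0},x_{1}]$; $\beta\in L^{\infty}([x_{0},x_{1}]\times[x_{0},x_{1}])$ with $\beta(x,y)=\beta(y,x)$ and $\beta(x,y)=0$ whenever $x+y>x_{1}$; $w\in C[x_{0},x_{1}]$ with $w\ge0$ a.e.; $q\in L^{\infty}[x_{0},x_{1}]$ with $q\ge0$ a.e. Consider the nonlinear evolution equation on $H=L^{1}[x_{0},x_{1}]$ $$\partial_{t}p(t,x)=-\partial_{x}(g(x)p(t,x))+\mathcal{F}[p](t,x),\qquad g(x_{0})p(t,x_{0})=\int_{x_{0}}^{x_{1}}q(x)p(t,x)\,dx,\qquad p(0,x)=p_{0}(x)\in L^{1}[x_{0},x_{1}],$$ where $$\mathcal{F}[p](t,x)=\frac{1}{2}\int_{x_{0}}^{x-x_{0}}\beta(x-y,y)p(t,x-y)p(t,y)\,dy-p(t,x)\int_{x_{0}}^{x_{1}}\beta(x,y)p(t,y)\,dy-w(x)p(t,x).$$ Then the zero solution is locally asymptotically stable if $$\int_{x_{0}}^{x_{1}}\frac{q(x)}{g(x)}\exp\left(-\int_{x_{0}}^{x}\frac{w(s)}{g(s)}\,ds\right)dx<1,$$ and the zero solution is unstable if $$\int_{x_{0}}^{x_{1}}\frac{q(x)}{g(x)}\exp\left(-\int_{x_{0}}^{x}\frac{w(s)}{g(s)}\,ds\right)dx>1.$$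
   Context: The equation is viewed as the semilinear abstract Cauchy problem $p_t=\mathcal{L}[p]+\mathcal{N}[p]$ on $H=L^{1}[x_{0},x_{1}]$ with the $L^1$ norm, where $\mathcal{L}[p]=-(gp)'-wp$ with domain $\mathcal{D}(\mathcal{L})=\{\phi\in H: (g\phi)'\in H,\ (g\phi)(x_{0})=\int_{x_0}^{x_1}q\phi\,dx\}$, generating a $C_0$ semigroup $(T(t))_{t\ge0}$, and $\mathcal{N}[p](x)=\frac12\int_{x_0}^{x-x_0}\beta(x-y,y)p(x-y)p(y)\,dy-p(x)\int_{x_0}^{x_1}\beta(x,y)p(y)\,dy$; solutions are mild solutions $u(t)=T(t)f+\int_0^tT(t-s)\mathcal{N}[u(s)]ds$. "Locally asymptotically stable" means: there exist $\eta>0$, $C\ge1$, $\alpha>0$ such that if $\|f\|<\eta$ then a unique mild solution $u$ with $u(0)=f$ exists for all $t\ge0$ and $\|u(t)\|\le Ce^{-\alpha t}\|f\|$. "Unstable" means: there exist $\varepsilon>0$ and a sequence $f_n\to0$ in $H$ such that the solutions starting from $f_n$ have norm at least $\varepsilon$ at time $n$, for all $n=1,2,\dots$. *)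

theory Defs
  imports "HOL-Analysis.Analysis"
begin

text \<open>The space H = L^1[x0,x1]: elements are represented by real functions,
  integrable on [x0,x1]; values outside [x0,x1] are irrelevant and equality in H
  is equality almost everywhere on [x0,x1], i.e. distance zero.\<close>

definition inH :: "real \<Rightarrow> real \<Rightarrow> (real \<Rightarrow> real) \<Rightarrow> bool" where
  "inH x0 x1 f \<longleftrightarrow> set_integrable lborel {x0..x1} f"

definition L1norm :: "real \<Rightarrow> real \<Rightarrow> (real \<Rightarrow> real) \<Rightarrow> real" where
  "L1norm x0 x1 f = (LINT x:{x0..x1}|lborel. \<bar>f x\<bar>)"

definition C0_semigroup ::
  "real \<Rightarrow> real \<Rightarrow> (real \<Rightarrow> (real \<Rightarrow> real) \<Rightarrow> (real \<Rightarrow> real)) \<Rightarrow> bool" where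
  "C0_semigroup x0 x1 T \<longleftrightarrow>
     (\<forall>t\<ge>0. \<forall>f. inH x0 x1 f \<longrightarrow> inH x0 x1 (T t f)) \<and>
     (\<forall>t\<ge>0. \<forall>f h a b. inH x0 x1 f \<and> inH x0 x1 h \<longrightarrow>
        L1norm x0 x1 (\<lambda>x. T t (\<lambda>y. a * f y + b * h y) x - (a * T t f x + b * T t h x)) = 0) \<and>
     (\<forall>t\<ge>0. \<exists>M. \<forall>f. inH x0 x1 f \<longrightarrow> L1norm x0 x1 (T t f) \<le> M * L1norm x0 x1 f) \<and>
     (\<forall>f. inH x0 x1 f \<longrightarrow> L1norm x0 x1 (\<lambda>x. T 0 f x - f x) = 0) \<and>
     (\<forall>t s f. t \<ge> 0 \<and> s \<ge> 0 \<and> inH x0 x1 f \<longrightarrow>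
        L1norm x0 x1 (\<lambda>x. T (t + s) f x - T t (T s f) x) = 0) \<and>
     (\<forall>f. inH x0 x1 f \<longrightarrow> ((\<lambda>h. L1norm x0 x1 (\<lambda>x. T h f x - f x)) \<longlongrightarrow> 0) (at_right 0))"

text \<open>Graph of the operator L[p] = -(g p)' - w p with domain
  D(L) = {phi in H : (g phi)' in H, (g phi)(x0) = int q phi}.
  "(g phi)' in H" means that g phi coincides a.e. with an absolutely continuous
  function c + int_{x0}^x rho with rho in L^1; its value at x0 is c.\<close>

definition gen_L ::
  "real \<Rightarrow> real \<Rightarrow> (real \<Rightarrow> real) \<Rightarrow> (real \<Rightarrow> real) \<Rightarrow> (real \<Rightarrow> real)
    \<Rightarrow> (real \<Rightarrow> real) \<Rightarrow> (real \<Rightarrow> real) \<Rightarrow> bool" where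
  "gen_L x0 x1 g q w \<phi> \<psi> \<longleftrightarrow> inH x0 x1 \<phi> \<and> inH x0 x1 \<psi> \<and>
     (\<exists>c \<rho>. set_integrable lborel {x0..x1} \<rho> \<and>
        (AE x in lborel. x \<in> {x0..x1} \<longrightarrow> g x * \<phi> x = c + (LINT y:{x0..x}|lborel. \<rho> y)) \<and>
        c = (LINT x:{x0..x1}|lborel. q x * \<phi> x) \<and>
        (AE x in lborel. x \<in> {x0..x1} \<longrightarrow> \<psi> x = - \<rho> x - w x * \<phi> x))"

definition generated_by_L ::
  "real \<Rightarrow> real \<Rightarrow> (real \<Rightarrow> real) \<Rightarrow> (real \<Rightarrow> real) \<Rightarrow> (real \<Rightarrow> real)
    \<Rightarrow> (real \<Rightarrow> (real \<Rightarrow> real) \<Rightarrow> (real \<Rightarrow> real)) \<Rightarrow> bool" where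
  "generated_by_L x0 x1 g q w T \<longleftrightarrow> C0_semigroup x0 x1 T \<and>
     (\<forall>\<phi> \<psi>. inH x0 x1 \<phi> \<and> inH x0 x1 \<psi> \<longrightarrow>
        (((\<lambda>h. L1norm x0 x1 (\<lambda>x. (T h \<phi> x - \<phi> x) / h - \<psi> x)) \<longlongrightarrow> 0) (at_right 0)
         \<longleftrightarrow> gen_L x0 x1 g q w \<phi> \<psi>))"

definition Nop :: "real \<Rightarrow> real \<Rightarrow> (real \<Rightarrow> real \<Rightarrow> real) \<Rightarrow> (real \<Rightarrow> real) \<Rightarrow> (real \<Rightarrow> real)" where
  "Nop x0 x1 \<beta> p = (\<lambda>x. (1/2) * (LINT y:{x0..x - x0}|lborel. \<beta> (x - y) y * p (x - y) * p y)
                         - p x * (LINT y:{x0..x1}|lborel. \<beta> x y * p y))"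

definition H_integral ::
  "real \<Rightarrow> real \<Rightarrow> (real \<Rightarrow> (real \<Rightarrow> real)) \<Rightarrow> real \<Rightarrow> real \<Rightarrow> (real \<Rightarrow> real) \<Rightarrow> bool" where
  "H_integral x0 x1 v a b I \<longleftrightarrow> inH x0 x1 I \<and>
     (\<forall>\<epsilon>>0. \<exists>\<delta>>0. \<forall>(n::nat) (s::nat \<Rightarrow> real) (\<tau>::nat \<Rightarrow> real).
        (s 0 = a \<and> s n = b \<and>
         (\<forall>i<n. s i \<le> s (Suc i) \<and> s (Suc i) - s i < \<delta> \<and> s i \<le> \<tau> i \<and> \<tau> i \<le> s (Suc i)))
        \<longrightarrow> L1norm x0 x1 (\<lambda>x. (\<Sum>i<n. (s (Suc i) - s i) * v (\<tau> i) x) - I x) < \<epsilon>)"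

definition mild_on ::
  "real \<Rightarrow> real \<Rightarrow> (real \<Rightarrow> real \<Rightarrow> real) \<Rightarrow> (real \<Rightarrow> (real \<Rightarrow> real) \<Rightarrow> (real \<Rightarrow> real))
    \<Rightarrow> real \<Rightarrow> (real \<Rightarrow> (real \<Rightarrow> real)) \<Rightarrow> (real \<Rightarrow> real) \<Rightarrow> bool" where
  "mild_on x0 x1 \<beta> T \<tau> u f \<longleftrightarrow>
     (\<forall>t\<in>{0..\<tau>}. inH x0 x1 (u t)) \<and>
     (\<forall>t\<in>{0..\<tau>}. ((\<lambda>s. L1norm x0 x1 (\<lambda>x. u s x - u t x)) \<longlongrightarrow> 0) (at t within {0..\<tau>})) \<and>
     (\<forall>t\<in>{0..\<tau>}. \<exists>I. H_integral x0 x1 (\<lambda>s. T (t - s) (Nop x0 x1 \<beta> (u s))) 0 t I \<and>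
        L1norm x0 x1 (\<lambda>x. u t x - (T t f x + I x)) = 0)"

definition mild_global ::
  "real \<Rightarrow> real \<Rightarrow> (real \<Rightarrow> real \<Rightarrow> real) \<Rightarrow> (real \<Rightarrow> (real \<Rightarrow> real) \<Rightarrow> (real \<Rightarrow> real))
    \<Rightarrow> (real \<Rightarrow> (real \<Rightarrow> real)) \<Rightarrow> (real \<Rightarrow> real) \<Rightarrow> bool" where
  "mild_global x0 x1 \<beta> T u f \<longleftrightarrow> (\<forall>\<tau>\<ge>0. mild_on x0 x1 \<beta> T \<tau> u f)"

definition loc_asym_stable ::
  "real \<Rightarrow> real \<Rightarrow> (real \<Rightarrow> real \<Rightarrow> real) \<Rightarrow> (real \<Rightarrow> (real \<Rightarrow> real) \<Rightarrow> (real \<Rightarrow> real)) \<Rightarrow> bool" where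
  "loc_asym_stable x0 x1 \<beta> T \<longleftrightarrow>
     (\<exists>\<eta>>0. \<exists>C\<ge>1. \<exists>\<alpha>>0. \<forall>f. inH x0 x1 f \<and> L1norm x0 x1 f < \<eta> \<longrightarrow>
        (\<exists>u. mild_global x0 x1 \<beta> T u f \<and>
             (\<forall>v. mild_global x0 x1 \<beta> T v f \<longrightarrow> (\<forall>t\<ge>0. L1norm x0 x1 (\<lambda>x. u t x - v t x) = 0)) \<and>
             (\<forall>t\<ge>0. L1norm x0 x1 (u t) \<le> C * exp (- \<alpha> * t) * L1norm x0 x1 f)))"

definition unstable ::
  "real \<Rightarrow> real \<Rightarrow> (real \<Rightarrow> real \<Rightarrow> real) \<Rightarrow> (real \<Rightarrow> (real \<Rightarrow> real) \<Rightarrow> (real \<Rightarrow> real)) \<Rightarrow> bool" where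
  "unstable x0 x1 \<beta> T \<longleftrightarrow>
     (\<exists>\<epsilon>>0. \<exists>fs::nat \<Rightarrow> (real \<Rightarrow> real).
        (\<forall>n. inH x0 x1 (fs n)) \<and> (\<lambda>n. L1norm x0 x1 (fs n)) \<longlonglongrightarrow> 0 \<and>
        (\<forall>n\<ge>1. (\<exists>u. mild_on x0 x1 \<beta> T (real n) u (fs n)) \<and>
                (\<forall>u. mild_on x0 x1 \<beta> T (real n) u (fs n) \<longrightarrow> L1norm x0 x1 (u (real n)) \<ge> \<epsilon>)))"

end

theory Submission
  imports Defs
begin

text \<open>Characteristics reduce both claims to the function
  \<open>\<chi>(m) = \<integral> (q/g) exp (-\<integral> (w + m)/g)\<close>, which is decreasing in \<open>m\<close>. Whenever \<open>\<chi>(\<omega>) < 1\<close> there is a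
  positive weight \<open>V\<close> for which the explicit solution of the resolvent equation gives
  \<open>(\<mu> - \<omega>) \<parallel>\<phi>\<parallel>\<^sub>V \<le> \<parallel>(\<mu> - L) \<phi>\<parallel>\<^sub>V\<close> in the \<open>V\<close>-weighted \<open>L\<^sup>1\<close> norm; hence
  \<open>\<parallel>T(t)\<parallel> \<le> M exp (\<omega> t)\<close>. The nonlinearity is quadratic, so a contraction argument in
  exponentially weighted norms yields mild solutions close to the linear ones.
  If \<open>\<chi>(0) < 1\<close>, some \<open>\<omega> < 0\<close> is admissible and small solutions decay. If \<open>\<chi>(0) > 1\<close>, let \<open>\<lambda> > 0\<close>
  be the largest root of \<open>\<chi>(\<lambda>) = 1\<close>; it is an eigenvalue with eigenfunction \<open>\<phi>\<close>, and the growth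
  rate \<open>\<omega> = 3\<lambda>/2 < 2\<lambda>\<close> is admissible, so the quadratic correction to the
  solution starting from \<open>\<delta> exp (-\<lambda> n) \<phi>\<close> is still of order \<open>\<delta>\<^sup>2\<close> at time \<open>n\<close>.\<close>

section \<open>The Banach space of integrable functions\<close>

definition l1_rel :: "(real \<Rightarrow> real) \<Rightarrow> (real \<Rightarrow> real) \<Rightarrow> bool" where
  "l1_rel f g \<longleftrightarrow> integrable lborel f \<and> integrable lborel g \<and> (AE x in lborel. f x = g x)"

lemma part_equivp_l1_rel: "part_equivp l1_rel"
proof (rule part_equivpI)
  show "\<exists>f. l1_rel f f"
    by (rule exI[of _ "\<lambda>_. 0"]) (simp add: l1_rel_def)
  show "symp l1_rel"
    by (auto simp: symp_def l1_rel_def)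
  show "transp l1_rel"
    unfolding transp_def l1_rel_def by (auto elim: eventually_elim2)
qed

quotient_type l1 = "real \<Rightarrow> real" / partial: l1_rel
  by (rule part_equivp_l1_rel)

instantiation l1 :: real_vector
begin

lift_definition zero_l1 :: l1 is "\<lambda>_. 0"
  by (simp add: l1_rel_def)

lift_definition plus_l1 :: "l1 \<Rightarrow> l1 \<Rightarrow> l1" is "\<lambda>f g x. f x + g x"
  by (auto simp: l1_rel_def elim: eventually_elim2)

lift_definition minus_l1 :: "l1 \<Rightarrow> l1 \<Rightarrow> l1" is "\<lambda>f g x. f x - g x"
  by (auto simp: l1_rel_def elim: eventually_elim2)

lift_definition uminus_l1 :: "l1 \<Rightarrow> l1" is "\<lambda>f x. - f x"
  by (auto simp: l1_rel_def elim: eventually_mono)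

lift_definition scaleR_l1 :: "real \<Rightarrow> l1 \<Rightarrow> l1" is "\<lambda>c f x. c * f x"
  by (auto simp: l1_rel_def elim: eventually_mono)

instance
  by standard (transfer; auto simp: l1_rel_def algebra_simps)+

end

instantiation l1 :: real_normed_vector
begin

lift_definition norm_l1 :: "l1 \<Rightarrow> real" is "\<lambda>f. \<integral>x. \<bar>f x\<bar> \<partial>lborel"
  by (auto simp: l1_rel_def intro!: integral_cong_AE elim: eventually_mono)

definition dist_l1 :: "l1 \<Rightarrow> l1 \<Rightarrow> real" where
  "dist_l1 F G = norm (F - G)"

definition sgn_l1 :: "l1 \<Rightarrow> l1" where
  "sgn_l1 F = inverse (norm F) *\<^sub>R F"

definition uniformity_l1 :: "(l1 \<times> l1) filter" where
  "uniformity_l1 = (INF e\<in>{0<..}. principal {(F, G). dist F G < e})"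

definition open_l1 :: "l1 set \<Rightarrow> bool" where
  "open_l1 U \<longleftrightarrow> (\<forall>F\<in>U. eventually (\<lambda>(F', G). F' = F \<longrightarrow> G \<in> U) uniformity)"

instance
proof
  fix F G :: l1 and a :: real
  show "norm F = 0 \<longleftrightarrow> F = 0"
  proof transfer
    fix f assume "l1_rel f f"
    then have f: "integrable lborel f" by (simp add: l1_rel_def)
    have "(\<integral>x. \<bar>f x\<bar> \<partial>lborel) = 0 \<longleftrightarrow> (AE x in lborel. \<bar>f x\<bar> = 0)"
      using f by (intro integral_nonneg_eq_0_iff_AE) auto
    then show "(\<integral>x. \<bar>f x\<bar> \<partial>lborel) = 0 \<longleftrightarrow> l1_rel f (\<lambda>_. 0)"
      using f by (simp add: l1_rel_def)
  qed
  show "norm (F + G) \<le> norm F + norm G"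
  proof transfer
    fix f g assume "l1_rel f f" "l1_rel g g"
    then have fg: "integrable lborel f" "integrable lborel g" by (simp_all add: l1_rel_def)
    then have "(\<integral>x. \<bar>f x + g x\<bar> \<partial>lborel) \<le> (\<integral>x. \<bar>f x\<bar> + \<bar>g x\<bar> \<partial>lborel)"
      by (intro integral_mono) auto
    then show "(\<integral>x. \<bar>f x + g x\<bar> \<partial>lborel) \<le> (\<integral>x. \<bar>f x\<bar> \<partial>lborel) + (\<integral>x. \<bar>g x\<bar> \<partial>lborel)"
      using fg by simp
  qed
  show "norm (a *\<^sub>R F) = \<bar>a\<bar> * norm F"
    by transfer (simp add: abs_mult)
qed (simp_all add: dist_l1_def sgn_l1_def uniformity_l1_def open_l1_def)

end

lemma l1_summable:
  fixes F :: "nat \<Rightarrow> l1"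
  assumes "summable (\<lambda>n. norm (F n))"
  shows "summable F"
proof -
  define f where "f n = rep_l1 (F n)" for n
  have f: "integrable lborel (f n)" and F: "abs_l1 (f n) = F n" for n
    using Quotient3_rel_rep[OF Quotient3_l1] Quotient3_abs_rep[OF Quotient3_l1]
    unfolding f_def by (auto simp: l1_rel_def)
  have nf: "norm (F n) = (\<integral>x. norm (f n x) \<partial>lborel)" for n
    using f by (simp flip: F add: norm_l1.abs_eq l1_rel_def)
  have sn: "summable (\<lambda>n. \<integral>x. norm (f n x) \<partial>lborel)"
    using assms by (simp add: nf)
  have "(\<integral>\<^sup>+x. (\<Sum>n. ennreal (norm (f n x))) \<partial>lborel) = (\<Sum>n. \<integral>\<^sup>+x. ennreal (norm (f n x)) \<partial>lborel)"
    using f by (intro nn_integral_suminf) auto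
  also have "\<dots> = (\<Sum>n. ennreal (\<integral>x. norm (f n x) \<partial>lborel))"
    using f by (intro arg_cong[where f=suminf] ext nn_integral_eq_integral) auto
  also have "\<dots> < \<infinity>"
    using sn by (simp add: ennreal_suminf_neq_top less_top[symmetric] integral_nonneg_AE del: real_norm_def)
  finally have "AE x in lborel. (\<Sum>n. ennreal (norm (f n x))) \<noteq> \<infinity>"
    using f by (intro nn_integral_PInf_AE) auto
  then have as: "AE x in lborel. summable (\<lambda>n. norm (f n x))"
    by eventually_elim (auto intro: summable_suminf_not_top)
  define s where "s x = (\<Sum>n. f n x)" for x
  have s: "integrable lborel s"
    unfolding s_def by (rule integrable_suminf[OF f as sn])
  have "(\<lambda>m. norm ((\<Sum>n<m. F n) - abs_l1 s)) \<longlonglongrightarrow> 0"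
  proof (rule tendsto_sandwich[where f="\<lambda>_. 0" and h="\<lambda>m. \<Sum>n. norm (F (n + m))"])
    have tail: "norm ((\<Sum>n<m. F n) - abs_l1 s) \<le> (\<Sum>n. norm (F (n + m)))" for m
    proof -
      have asm: "AE x in lborel. summable (\<lambda>n. norm (norm (f (n + m) x)))"
        using as by eventually_elim (simp add: summable_iff_shift[where f="\<lambda>n. \<bar>f n _\<bar>"])
      have snm: "summable (\<lambda>n. \<integral>x. norm (norm (f (n + m) x)) \<partial>lborel)"
        using summable_ignore_initial_segment[OF sn, of m] by simp
      have sm: "(\<Sum>n<m. F n) = abs_l1 (\<lambda>x. \<Sum>n<m. f n x)"
      proof (induction m)
        case 0
        show ?case by (simp add: zero_l1.abs_eq zero_l1_def)
      next
        case (Suc m)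
        have "abs_l1 (\<lambda>x. \<Sum>n<m. f n x) + F m = abs_l1 (\<lambda>x. (\<Sum>n<m. f n x) + f m x)"
          using f by (simp flip: F add: plus_l1.abs_eq l1_rel_def)
        with Suc show ?case by simp
      qed
      have "norm ((\<Sum>n<m. F n) - abs_l1 s) = (\<integral>x. \<bar>(\<Sum>n<m. f n x) - s x\<bar> \<partial>lborel)"
        using f s by (simp add: sm minus_l1.abs_eq norm_l1.abs_eq l1_rel_def)
      also have "\<dots> \<le> (\<integral>x. (\<Sum>n. norm (f (n + m) x)) \<partial>lborel)"
      proof (rule integral_mono_AE)
        show "integrable lborel (\<lambda>x. \<bar>(\<Sum>n<m. f n x) - s x\<bar>)"
          using f s by auto
        show "integrable lborel (\<lambda>x. \<Sum>n. norm (f (n + m) x))"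
          using f asm snm by (intro integrable_suminf) (simp_all del: real_norm_def)
        show "AE x in lborel. \<bar>(\<Sum>n<m. f n x) - s x\<bar> \<le> (\<Sum>n. norm (f (n + m) x))"
          using as
        proof eventually_elim
          case (elim x)
          have "s x - (\<Sum>n<m. f n x) = (\<Sum>n. f (n + m) x)"
            unfolding s_def using suminf_minus_initial_segment[OF summable_norm_cancel[OF elim], of m]
            by simp
          moreover have "norm (\<Sum>n. f (n + m) x) \<le> (\<Sum>n. norm (f (n + m) x))"
            by (rule summable_norm) (rule summable_ignore_initial_segment[OF elim])
          ultimately show ?case by (simp add: abs_minus_commute)
        qed
      qed
      also have "\<dots> = (\<Sum>n. norm (F (n + m)))"
        unfolding nf using f asm snm by (intro integral_suminf) (simp_all del: real_norm_def)
      finally show ?thesis .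
    qed
    show "\<forall>\<^sub>F m in sequentially. norm ((\<Sum>n<m. F n) - abs_l1 s) \<le> (\<Sum>n. norm (F (n + m)))"
      by (simp add: tail)
    show "(\<lambda>m. \<Sum>n. norm (F (n + m))) \<longlonglongrightarrow> 0"
      by (rule suminf_exist_split2[OF assms])
  qed auto
  then show ?thesis
    using Lim_null[of "\<lambda>m. \<Sum>n<m. F n" "abs_l1 s" sequentially] tendsto_norm_zero_iff
    by (auto simp: summable_def sums_def)
qed

instance l1 :: banach
proof
  fix X :: "nat \<Rightarrow> l1"
  assume X: "Cauchy X"
  have "\<exists>N. \<forall>m\<ge>N. \<forall>n\<ge>N. dist (X m) (X n) < (1/2)^k" for k
    using X unfolding Cauchy_def by simp
  then obtain N where N: "\<And>k m n. m \<ge> N k \<Longrightarrow> n \<ge> N k \<Longrightarrow> dist (X m) (X n) < (1/2)^k"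
    by metis
  define r where "r = rec_nat (N 0) (\<lambda>k i. max (Suc i) (N (Suc k)))"
  have r_Suc: "r (Suc k) = max (Suc (r k)) (N (Suc k))" and r_0: "r 0 = N 0" for k
    by (simp_all add: r_def)
  have r: "strict_mono r"
    by (auto simp: strict_mono_Suc_iff r_Suc)
  have rN: "r k \<ge> N k" for k
    by (cases k) (auto simp: r_Suc r_0)
  have "norm (X (r (Suc k)) - X (r k)) \<le> (1/2)^k" for k
  proof -
    have "r (Suc k) \<ge> N k"
      using rN[of k] by (simp add: r_Suc)
    then show ?thesis
      using N[of k "r (Suc k)" "r k"] rN[of k] by (simp add: dist_norm)
  qed
  then have "summable (\<lambda>k. norm (X (r (Suc k)) - X (r k)))"
    by (intro summable_comparison_test'[of "\<lambda>k. (1/2)^k" 0, OF summable_geometric]) auto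
  then have "summable (\<lambda>k. X (r (Suc k)) - X (r k))"
    by (rule l1_summable)
  then have "convergent (\<lambda>k. X (r k) - X (r 0))"
    unfolding summable_iff_convergent by (simp add: sum_lessThan_telescope[of "\<lambda>k. X (r k)"])
  then obtain L where "(\<lambda>k. X (r k) - X (r 0)) \<longlonglongrightarrow> L"
    by (auto simp: convergent_def)
  then have "(X \<circ> r) \<longlonglongrightarrow> L + X (r 0)"
    by (drule_tac tendsto_add[OF _ tendsto_const[of "X (r 0)"]]) (simp add: o_def)
  then show "convergent X"
    using Cauchy_converges_subseq[OF X r] by (auto simp: convergent_def)
qed

section \<open>Strongly continuous semigroups\<close>

lemma linear_bound_of_ball_bound:
  fixes A :: "'a::real_normed_vector \<Rightarrow> 'b::real_normed_vector"
  assumes A: "linear A" and r: "r > 0" and M: "\<And>y. norm (y - x) \<le> r \<Longrightarrow> norm (A y) \<le> M"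
  shows "norm (A z) \<le> M / r * norm z"
proof (cases "z = 0")
  case True
  then show ?thesis using linear_0[OF A] by simp
next
  case False
  define y where "y = (r / norm z) *\<^sub>R z"
  have ny: "norm y = r" using False r by (simp add: y_def)
  have "2 *\<^sub>R A y = A (x + y) - A (x - y)"
    by (simp add: linear_add[OF A] linear_diff[OF A] scaleR_2)
  then have "2 * norm (A y) = norm (A (x + y) - A (x - y))"
    by (metis norm_scaleR abs_numeral)
  also have "\<dots> \<le> norm (A (x + y)) + norm (A (x - y))" by (rule norm_triangle_ineq4)
  also have "\<dots> \<le> M + M"
    using ny by (intro add_mono M) auto
  finally have "norm (A y) \<le> M" by simp
  moreover have "norm (A y) = (r / norm z) * norm (A z)"
    using r by (simp add: y_def linear_scale[OF A])
  ultimately show ?thesis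
    using r False by (simp add: field_simps)
qed

lemma uniform_boundedness:
  fixes A :: "nat \<Rightarrow> 'a::banach \<Rightarrow> 'b::real_normed_vector"
  assumes A: "\<And>n. bounded_linear (A n)" and ptw: "\<And>x. bounded (range (\<lambda>n. A n x))"
  shows "\<exists>M. \<forall>n x. norm (A n x) \<le> M * norm x"
proof (rule ccontr)
  assume nb: "\<not> ?thesis"
  have hump: "\<exists>n y. norm (y - x) \<le> r \<and> norm (A n y) > M" if "r > 0" for x r and M :: real
  proof (rule ccontr)
    assume "\<not> ?thesis"
    then have "norm (A n z) \<le> M / r * norm z" for n z
      using that by (intro linear_bound_of_ball_bound[where x=x] bounded_linear.linear[OF A])
        (auto simp: not_less)
    with nb show False by blast
  qed
  define P where "P = (\<lambda>(k::nat) (c::'a \<times> real). 0 < snd c \<and> snd c \<le> (1/2)^k)"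
  define Q where "Q = (\<lambda>(k::nat) (c::'a \<times> real) (d::'a \<times> real).
     cball (fst d) (snd d) \<subseteq> cball (fst c) (snd c) \<and>
     (\<exists>n. \<forall>z\<in>cball (fst d) (snd d). norm (A n z) > real k))"
  have "\<exists>c. \<forall>k. P k (c k) \<and> Q k (c k) (c (Suc k))"
  proof (rule dependent_nat_choice)
    show "\<exists>c. P 0 c" by (rule exI[of _ "(0, 1)"]) (simp add: P_def)
  next
    fix c k assume c: "P k c"
    obtain x r where [simp]: "c = (x, r)" by (cases c)
    have r: "0 < r" "r \<le> (1/2)^k" using c by (auto simp: P_def)
    obtain n y where y: "norm (y - x) \<le> r / 2" "norm (A n y) > real k"
      using hump[of "r/2" x "real k"] r(1) by auto
    have "\<forall>\<^sub>F z in nhds y. norm (A n z) > real k"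
      using tendsto_norm[OF bounded_linear.tendsto[OF A filterlim_ident]] y(2)
      by (rule order_tendstoD(1))
    then obtain e where e: "e > 0" "\<And>z. dist z y < e \<Longrightarrow> norm (A n z) > real k"
      by (auto simp: eventually_nhds_metric)
    define s where "s = min (r/2) (e/2)"
    have "P (Suc k) (y, s)"
      using r e by (auto simp: P_def s_def)
    moreover have "cball y s \<subseteq> cball x r"
    proof
      fix z assume "z \<in> cball y s"
      then have "norm (z - y) \<le> r / 2" by (simp add: dist_norm norm_minus_commute s_def)
      with y(1) have "norm (z - x) \<le> r"
        using norm_triangle_ineq[of "z - y" "y - x"] by simp
      then show "z \<in> cball x r" by (simp add: dist_norm norm_minus_commute)
    qed
    moreover have "norm (A n z) > real k" if "z \<in> cball y s" for z
      using that e(1) by (intro e(2)) (auto simp: s_def dist_commute)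
    ultimately show "\<exists>d. P (Suc k) d \<and> Q k c d"
      unfolding Q_def by (intro exI[of _ "(y, s)"] conjI exI[of _ n]) simp_all
  qed
  then obtain c where c: "\<And>k. P k (c k)" "\<And>k. Q k (c k) (c (Suc k))" by blast
  define S where "S k = cball (fst (c k)) (snd (c k))" for k
  obtain a where a: "\<And>k. a \<in> S k"
  proof (rule decreasing_closed_nest[of S])
    show "closed (S n)" "S n \<noteq> {}" for n
      using c(1)[of n] by (auto simp: S_def P_def)
    show "S n \<subseteq> S m" if "m \<le> n" for m n
      using that by (rule lift_Suc_antimono_le[rotated]) (use c(2) in \<open>auto simp: S_def Q_def\<close>)
    show "\<exists>n. \<forall>x\<in>S n. \<forall>y\<in>S n. dist x y < e" if "e > 0" for e
    proof -
      obtain n where n: "(1/2)^n < e / 2"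
        using real_arch_pow_inv[of "e/2" "1/2"] \<open>e > 0\<close> by auto
      have "dist x y < e" if "x \<in> S n" "y \<in> S n" for x y
      proof -
        have "dist x y \<le> dist (fst (c n)) x + dist (fst (c n)) y"
          by (rule dist_triangle3)
        also have "\<dots> \<le> (1/2)^n + (1/2)^n"
          using that c(1)[of n] by (intro add_mono) (auto simp: S_def P_def)
        finally show ?thesis using n by simp
      qed
      then show ?thesis by blast
    qed
  qed blast
  obtain B where B: "\<And>n. norm (A n a) \<le> B"
    using ptw[of a] by (auto simp: bounded_iff)
  obtain k :: nat where k: "real k \<ge> B" using real_arch_simple by blast
  obtain n where "norm (A n a) > real k"
    using c(2)[of k] a[of "Suc k"] unfolding Q_def S_def by blast
  with B[of n] k show False by simp
qed

lemma has_vector_derivative_iff_ratio: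
  "(f has_vector_derivative D) (at x within S) \<longleftrightarrow>
     ((\<lambda>y. (1 / (y - x)) *\<^sub>R (f y - f x)) \<longlongrightarrow> D) (at x within S)"
proof -
  have "(f has_vector_derivative D) (at x within S) \<longleftrightarrow>
     ((\<lambda>y. norm (f y - f x - (y - x) *\<^sub>R D) / norm (y - x)) \<longlongrightarrow> 0) (at x within S)"
    by (simp add: has_vector_derivative_def has_derivative_iff_norm bounded_linear_scaleR_left)
  also have "\<dots> \<longleftrightarrow> ((\<lambda>y. norm ((1 / (y - x)) *\<^sub>R (f y - f x) - D)) \<longlongrightarrow> 0) (at x within S)"
  proof (rule Lim_cong_within)
    fix y assume "y \<noteq> x"
    then have "(1 / (y - x)) *\<^sub>R (f y - f x) - D = (1 / (y - x)) *\<^sub>R (f y - f x - (y - x) *\<^sub>R D)"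
      by (simp add: scaleR_diff_right)
    then show "norm (f y - f x - (y - x) *\<^sub>R D) / norm (y - x) = norm ((1 / (y - x)) *\<^sub>R (f y - f x) - D)"
      by (simp add: divide_inverse)
  qed auto
  also have "\<dots> \<longleftrightarrow> ((\<lambda>y. (1 / (y - x)) *\<^sub>R (f y - f x)) \<longlongrightarrow> D) (at x within S)"
    by (simp add: tendsto_norm_zero_iff flip: Lim_null)
  finally show ?thesis .
qed

lemma filterlim_abs_diff_at_right:
  fixes t :: real
  shows "filterlim (\<lambda>s. \<bar>s - t\<bar>) (at_right 0) (at t within S)"
proof -
  have "((\<lambda>s. \<bar>s - t\<bar>) \<longlongrightarrow> \<bar>t - t\<bar>) (at t within S)"
    by (intro tendsto_intros)
  moreover have "\<forall>\<^sub>F s in at t within S. \<bar>s - t\<bar> > 0"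
    by (auto simp: eventually_at_filter)
  ultimately show ?thesis
    by (auto simp: filterlim_at elim: eventually_mono)
qed

text \<open>The operator \<^term>\<open>T 0\<close> is only required to be a projection, because functions on
  \<open>[x0, x1]\<close> will be represented by elements of the larger space \<open>L\<^sup>1(\<real>)\<close>.\<close>

locale semigroup_c0 =
  fixes T :: "real \<Rightarrow> 'a::banach \<Rightarrow> 'a"
  assumes bounded_linear_T: "t \<ge> 0 \<Longrightarrow> bounded_linear (T t)"
    and T_add: "t \<ge> 0 \<Longrightarrow> s \<ge> 0 \<Longrightarrow> T (t + s) x = T t (T s x)"
    and T_tendsto_0: "((\<lambda>h. T h x) \<longlongrightarrow> T 0 x) (at_right 0)"
begin

lemma T_T0: "t \<ge> 0 \<Longrightarrow> T t (T 0 x) = T t x"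
  using T_add[of t 0 x] by simp

lemma T0_T: "t \<ge> 0 \<Longrightarrow> T 0 (T t x) = T t x"
  using T_add[of 0 t x] by simp

lemma T_diff: "t \<ge> 0 \<Longrightarrow> T t (x - y) = T t x - T t y"
  using bounded_linear_T[of t] by (simp add: bounded_linear.linear linear_diff)

lemma T_scaleR: "t \<ge> 0 \<Longrightarrow> T t (c *\<^sub>R x) = c *\<^sub>R T t x"
  using bounded_linear_T[of t] by (simp add: bounded_linear.linear linear_scale)

lemma bounded_near_0: "\<exists>d>0. \<exists>M. \<forall>t\<in>{0..d}. \<forall>x. norm (T t x) \<le> M * norm x"
proof (rule ccontr)
  assume neg: "\<not> ?thesis"
  have "\<exists>t. 0 \<le> t \<and> t \<le> 1 / real (Suc n) \<and> (\<exists>x. norm (T t x) > real n * norm x)" for n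
    using neg[simplified, rule_format, of "1 / real (Suc n)"] by (force simp: not_le)
  then obtain t where t: "\<And>n. 0 \<le> t n" "\<And>n. t n \<le> 1 / real (Suc n)"
      "\<And>n. \<exists>x. norm (T (t n) x) > real n * norm x"
    by metis
  have t0: "t \<longlonglongrightarrow> 0"
    by (rule tendsto_sandwich[OF _ _ tendsto_const LIMSEQ_Suc[OF lim_1_over_n]])
      (use t in \<open>auto simp: always_eventually\<close>)
  have "bounded (range (\<lambda>n. T (t n) x))" for x
  proof -
    have "continuous (at 0 within {0..}) (\<lambda>h. T h x)"
      using T_tendsto_0[of x] at_within_Ici_at_right[of "0::real"] by (simp add: continuous_within)
    then have "((\<lambda>h. T h x) \<circ> t) \<longlonglongrightarrow> T 0 x"
      using t0 t(1) by (auto simp: continuous_within_sequentially)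
    then show ?thesis
      using convergent_imp_bounded by (force simp: o_def)
  qed
  then obtain M where M: "\<And>n x. norm (T (t n) x) \<le> M * norm x"
    using uniform_boundedness[of "\<lambda>n. T (t n)"] bounded_linear_T t(1) by blast
  obtain n :: nat where n: "real n \<ge> M" using real_arch_simple by blast
  obtain x where "norm (T (t n) x) > real n * norm x" using t(3) by blast
  with M[of n x] mult_right_mono[OF n norm_ge_zero[of x]] show False by simp
qed

lemma locally_bounded: "\<exists>M\<ge>0. \<forall>t\<in>{0..\<tau>}. \<forall>x. norm (T t x) \<le> M * norm x"
proof -
  obtain d M where d: "d > 0" and M0: "\<And>t x. t \<in> {0..d} \<Longrightarrow> norm (T t x) \<le> M * norm x"
    using bounded_near_0 by blast
  define M' where "M' = max 1 M"
  have M: "norm (T t x) \<le> M' * norm x" if "t \<in> {0..d}" for t x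
    using M0[OF that, of x] mult_right_mono[of M M' "norm x"] by (simp add: M'_def)
  have M1: "M' \<ge> 1" by (simp add: M'_def)
  have "norm (T t x) \<le> M' ^ Suc n * norm x" if "0 \<le> t" "t \<le> real (Suc n) * d" for t x n
    using that
  proof (induction n arbitrary: t)
    case 0
    then show ?case using M[of t] by simp
  next
    case (Suc n)
    show ?case
    proof (cases "t \<le> d")
      case True
      then have "norm (T t x) \<le> M' * norm x" using M Suc by simp
      also have "\<dots> \<le> M' ^ Suc (Suc n) * norm x"
        using M1 power_increasing[of 1 "Suc (Suc n)" M'] by (intro mult_right_mono) auto
      finally show ?thesis .
    next
      case False
      have "T t x = T d (T (t - d) x)" using T_add[of d "t - d" x] d False by simp
      then have "norm (T t x) \<le> M' * norm (T (t - d) x)" using M[of d] d by simp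
      also have "\<dots> \<le> M' * (M' ^ Suc n * norm x)"
        using M1 Suc.prems False by (intro mult_left_mono Suc.IH) (auto simp: algebra_simps)
      finally show ?thesis by simp
    qed
  qed
  moreover obtain n :: nat where n: "real n \<ge> \<tau> / d" using real_arch_simple by blast
  ultimately have "norm (T t x) \<le> M' ^ Suc n * norm x" if "t \<in> {0..\<tau>}" for t x
    using that d by (auto simp: field_simps intro: order_trans)
  moreover have "M' ^ Suc n \<ge> 0" using M1 by simp
  ultimately show ?thesis by blast
qed

lemma continuous_T: "continuous_on {0..} (\<lambda>t. T t x)"
  unfolding continuous_on
proof
  fix t :: real assume "t \<in> {0..}"
  then have t: "t \<ge> 0" by simp
  obtain M where M: "\<And>s y. s \<in> {0..t} \<Longrightarrow> norm (T s y) \<le> M * norm y"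
    using locally_bounded[of t] by blast
  have "((\<lambda>s. M * norm (T \<bar>s - t\<bar> x - T 0 x)) \<longlongrightarrow> M * norm (T 0 x - T 0 x)) (at t within {0..})"
    by (intro tendsto_intros filterlim_compose[OF T_tendsto_0 filterlim_abs_diff_at_right])
  then have "((\<lambda>s. M * norm (T \<bar>s - t\<bar> x - T 0 x)) \<longlongrightarrow> 0) (at t within {0..})" by simp
  moreover have "\<forall>\<^sub>F s in at t within {0..}. norm (T s x - T t x) \<le> M * norm (T \<bar>s - t\<bar> x - T 0 x)"
    unfolding eventually_at_filter
  proof (intro always_eventually allI impI)
    fix s :: real assume "s \<in> {0..}"
    then have s: "s \<ge> 0" by simp
    define m where "m = min s t"
    have eq: "norm (T s x - T t x) = norm (T m (T \<bar>s - t\<bar> x - T 0 x))"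
    proof (cases "s \<le> t")
      case True
      then have "T m (T \<bar>s - t\<bar> x - T 0 x) = T t x - T s x"
        using T_add[of s "t - s" x] s by (simp add: m_def T_diff T_T0 min_def)
      then show ?thesis by (simp add: norm_minus_commute)
    next
      case False
      then have "T m (T \<bar>s - t\<bar> x - T 0 x) = T s x - T t x"
        using T_add[of t "s - t" x] t by (simp add: m_def T_diff T_T0 min_def)
      then show ?thesis by simp
    qed
    show "norm (T s x - T t x) \<le> M * norm (T \<bar>s - t\<bar> x - T 0 x)"
      unfolding eq using s t by (intro M) (auto simp: m_def)
  qed
  ultimately have "((\<lambda>s. T s x - T t x) \<longlongrightarrow> 0) (at t within {0..})"
    by (rule Lim_null_comparison[rotated])
  then show "((\<lambda>s. T s x) \<longlongrightarrow> T t x) (at t within {0..})"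
    by (simp flip: Lim_null)
qed

definition gen :: "'a \<Rightarrow> 'a \<Rightarrow> bool" where
  "gen x y \<longleftrightarrow> ((\<lambda>h. (1 / h) *\<^sub>R (T h x - x)) \<longlongrightarrow> y) (at_right 0)"

lemma gen_T0:
  assumes "gen x y"
  shows "T 0 x = x"
proof -
  have "((\<lambda>h. h *\<^sub>R ((1 / h) *\<^sub>R (T h x - x))) \<longlongrightarrow> 0 *\<^sub>R y) (at_right 0)"
    using assms unfolding gen_def by (intro tendsto_intros)
  moreover have "((\<lambda>h. T h x - x) \<longlongrightarrow> T 0 x - x) (at_right 0)"
    by (intro tendsto_intros T_tendsto_0)
  then have "((\<lambda>h. h *\<^sub>R ((1 / h) *\<^sub>R (T h x - x))) \<longlongrightarrow> T 0 x - x) (at_right 0)"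
    by (rule Lim_transform_eventually) (auto simp: eventually_at_filter)
  ultimately have "T 0 x - x = 0 *\<^sub>R y"
    by (intro tendsto_unique[rotated]) auto
  then show ?thesis by simp
qed

lemma gen_T:
  assumes "gen x y" "t \<ge> 0"
  shows "gen (T t x) (T t y)"
proof -
  have "((\<lambda>h. T t ((1 / h) *\<^sub>R (T h x - x))) \<longlongrightarrow> T t y) (at_right 0)"
    using assms unfolding gen_def by (intro bounded_linear.tendsto[OF bounded_linear_T])
  then show ?thesis
    unfolding gen_def
    by (rule Lim_transform_eventually)
      (auto simp: eventually_at_filter T_scaleR T_diff assms T_add[symmetric] add.commute)
qed

lemma has_vector_derivative_T:
  assumes xy: "gen x y" and t: "t \<ge> 0"
  shows "((\<lambda>s. T s x) has_vector_derivative T t y) (at t within {0..})"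
  unfolding has_vector_derivative_iff_ratio
proof -
  obtain M where M: "\<And>s y. s \<in> {0..t} \<Longrightarrow> norm (T s y) \<le> M * norm y"
    using locally_bounded[of t] by blast
  define q where "q h = (1 / h) *\<^sub>R (T h x - x)" for h
  define b where "b s = M * norm (q \<bar>s - t\<bar> - y) + norm (T (min s t) y - T t y)" for s
  have ct: "((\<lambda>s. T s y) \<longlongrightarrow> T t y) (at t within {0..})"
    using continuous_T[of y] t by (auto simp: continuous_on)
  have "((\<lambda>s. T (min s t) y) \<longlongrightarrow> T t y) (at t within {0..})"
    unfolding tendsto_def
  proof (intro allI impI)
    fix S assume "open S" "T t y \<in> S"
    then have "\<forall>\<^sub>F s in at t within {0..}. T s y \<in> S" using ct by (auto simp: tendsto_def)
    then show "\<forall>\<^sub>F s in at t within {0..}. T (min s t) y \<in> S"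
      by eventually_elim (use \<open>T t y \<in> S\<close> in \<open>auto simp: min_def\<close>)
  qed
  moreover have "((\<lambda>s. q \<bar>s - t\<bar>) \<longlongrightarrow> y) (at t within {0..})"
    using xy unfolding gen_def q_def[symmetric]
    by (rule filterlim_compose[OF _ filterlim_abs_diff_at_right])
  ultimately have "(b \<longlongrightarrow> M * norm (y - y) + norm (T t y - T t y)) (at t within {0..})"
    unfolding b_def by (intro tendsto_intros)
  then have "(b \<longlongrightarrow> 0) (at t within {0..})" by simp
  moreover have "\<forall>\<^sub>F s in at t within {0..}. norm ((1 / (s - t)) *\<^sub>R (T s x - T t x) - T t y) \<le> b s"
    unfolding eventually_at_filter
  proof (intro always_eventually allI impI)
    fix s :: real assume "s \<noteq> t" "s \<in> {0..}"
    then have s: "s \<ge> 0" by simp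
    define m where "m = min s t"
    have m: "0 \<le> m" "m \<le> t" using s t by (auto simp: m_def)
    have x0: "T m x = T m (T 0 x)" using m by (simp add: T_T0)
    have eq: "(1 / (s - t)) *\<^sub>R (T s x - T t x) = T m (q \<bar>s - t\<bar>)"
    proof (cases "s \<le> t")
      case True
      then have "T m (q \<bar>s - t\<bar>) = (1 / (t - s)) *\<^sub>R (T t x - T s x)"
        using T_add[of s "t - s" x] s
        by (simp add: m_def T_diff T_scaleR q_def min_def abs_if)
      also have "\<dots> = (1 / (s - t)) *\<^sub>R (T s x - T t x)"
        using minus_divide_right[of 1 "t - s"]
        by (metis (no_types, lifting) minus_diff_eq scaleR_minus_left scaleR_minus_right)
      finally show ?thesis by simp
    next
      case False
      then show ?thesis
        using T_add[of t "s - t" x] t by (simp add: m_def T_diff T_scaleR q_def min_def)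
    qed
    have "norm (T m (q \<bar>s - t\<bar>) - T t y) \<le> norm (T m (q \<bar>s - t\<bar> - y)) + norm (T m y - T t y)"
      using norm_triangle_ineq[of "T m (q \<bar>s - t\<bar> - y)" "T m y - T t y"] m by (simp add: T_diff)
    also have "\<dots> \<le> b s"
      using M[of m] m by (simp add: b_def m_def)
    finally show "norm ((1 / (s - t)) *\<^sub>R (T s x - T t x) - T t y) \<le> b s"
      by (simp add: eq)
  qed
  ultimately have "((\<lambda>s. (1 / (s - t)) *\<^sub>R (T s x - T t x) - T t y) \<longlongrightarrow> 0) (at t within {0..})"
    by (rule Lim_null_comparison[rotated])
  then show "((\<lambda>s. (1 / (s - t)) *\<^sub>R (T s x - T t x)) \<longlongrightarrow> T t y) (at t within {0..})"
    by (simp flip: Lim_null)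
qed

lemma T_eigenvector:
  assumes "gen x (l *\<^sub>R x)" "t \<ge> 0"
  shows "T t x = exp (l * t) *\<^sub>R x"
proof -
  have "\<exists>c. \<forall>s\<in>{0..}. exp (- l * s) *\<^sub>R T s x = c"
  proof (rule has_vector_derivative_zero_constant)
    show "convex {0::real..}" by simp
    fix s :: real assume s: "s \<in> {0..}"
    have "((\<lambda>s. exp (- l * s) *\<^sub>R T s x) has_vector_derivative
        exp (- l * s) *\<^sub>R T s (l *\<^sub>R x) + (exp (- l * s) * - l) *\<^sub>R T s x) (at s within {0..})"
      using s assms
      by (intro has_vector_derivative_scaleR has_vector_derivative_T)
         (auto intro!: derivative_eq_intros)
    then show "((\<lambda>s. exp (- l * s) *\<^sub>R T s x) has_vector_derivative 0) (at s within {0..})"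
      using s by (simp add: T_scaleR)
  qed blast
  then have "exp (- l * t) *\<^sub>R T t x = exp (- l * 0) *\<^sub>R T 0 x"
    using assms(2) by (metis atLeast_iff order_refl)
  then have "exp (- l * t) *\<^sub>R T t x = x"
    using gen_T0[OF assms(1)] by simp
  then have "exp (l * t) *\<^sub>R (exp (- l * t) *\<^sub>R T t x) = exp (l * t) *\<^sub>R x" by simp
  then show ?thesis by (simp flip: exp_add)
qed

lemma gen_integral:
  assumes x: "T 0 x = x" and h: "h > 0"
  shows "gen (integral {0..h} (\<lambda>s. T s x)) (T h x - x)"
proof -
  define J where "J t = integral {0..t} (\<lambda>s. T s x)" for t
  have ci: "(\<lambda>s. T s x) integrable_on {a..b}" if "a \<ge> 0" for a b
    using that by (intro integrable_continuous_real continuous_on_subset[OF continuous_T]) auto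
  have dJ: "(J has_vector_derivative T t x) (at_right t)" if "t \<ge> 0" for t
  proof -
    have "(J has_vector_derivative T t x) (at t within {0..t + 1})"
      unfolding J_def using that
      by (intro integral_has_vector_derivative continuous_on_subset[OF continuous_T]) auto
    then have "(J has_vector_derivative T t x) (at t within {t..t + 1})"
      by (rule has_vector_derivative_within_subset) (use that in auto)
    then show ?thesis
      by (simp add: has_vector_derivative_def at_within_Icc_at_right)
  qed
  have dJ': "((\<lambda>k. (1 / k) *\<^sub>R (J (t + k) - J t)) \<longlongrightarrow> T t x) (at_right 0)" if "t \<ge> 0" for t
    using dJ[OF that] unfolding has_vector_derivative_iff_ratio
    by (simp add: filterlim_at_right_to_0[of _ _ t] add.commute)
  have "((\<lambda>k. (1 / k) *\<^sub>R (J (h + k) - J h) - (1 / k) *\<^sub>R (J (0 + k) - J 0)) \<longlongrightarrow> T h x - T 0 x) (at_right 0)"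
    using h by (intro tendsto_diff dJ') auto
  moreover have "(1 / k) *\<^sub>R (J (h + k) - J h) - (1 / k) *\<^sub>R (J (0 + k) - J 0)
      = (1 / k) *\<^sub>R (T k (J h) - J h)" if k: "k > 0" for k
  proof -
    have "T k (J h) = integral {0..h} (T k \<circ> (\<lambda>s. T s x))"
      unfolding J_def using k by (intro integral_linear[symmetric] ci bounded_linear_T) auto
    also have "\<dots> = integral {0..h} ((\<lambda>s. T s x) \<circ> (+) k)"
      by (rule integral_cong) (use k in \<open>simp add: T_add\<close>)
    also have "\<dots> = integral {k..h + k} (\<lambda>s. T s x)"
      by (simp add: integral_shift_Icc_real)
    also have "\<dots> = J (h + k) - J k"
      using Henstock_Kurzweil_Integration.integral_combine[of 0 k "h + k" "\<lambda>s. T s x"] k h ci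
      by (simp add: J_def algebra_simps)
    finally show ?thesis
      by (simp add: J_def flip: scaleR_diff_right)
  qed
  ultimately have "((\<lambda>k. (1 / k) *\<^sub>R (T k (J h) - J h)) \<longlongrightarrow> T h x - T 0 x) (at_right 0)"
    by (elim Lim_transform_eventually) (auto simp: eventually_at_filter)
  then show ?thesis
    by (simp add: gen_def J_def x)
qed

lemma gen_dense:
  assumes x: "T 0 x = x" and e: "e > 0"
  shows "\<exists>y z. gen y z \<and> norm (y - x) < e"
proof -
  define J where "J t = integral {0..t} (\<lambda>s. T s x)" for t
  have "(J has_vector_derivative T 0 x) (at 0 within {0..1})"
    unfolding J_def
    by (intro integral_has_vector_derivative continuous_on_subset[OF continuous_T]) auto
  then have "((\<lambda>h. (1 / h) *\<^sub>R J h) \<longlongrightarrow> x) (at_right 0)"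
    by (simp add: has_vector_derivative_iff_ratio at_within_Icc_at_right x J_def)
  then have "\<forall>\<^sub>F h in at_right 0. dist ((1 / h) *\<^sub>R J h) x < e"
    using e by (rule tendstoD)
  moreover have "\<forall>\<^sub>F h in at_right (0::real). h > 0"
    by (simp add: eventually_at_filter)
  ultimately have "\<forall>\<^sub>F h in at_right 0. h > 0 \<and> dist ((1 / h) *\<^sub>R J h) x < e"
    by eventually_elim simp
  then obtain h where h: "h > 0" "dist ((1 / h) *\<^sub>R J h) x < e"
    using eventually_happens'[OF trivial_limit_at_right_real] by blast
  have "gen ((1 / h) *\<^sub>R J h) ((1 / h) *\<^sub>R (T h x - x))"
  proof -
    have "((\<lambda>k. (1 / h) *\<^sub>R ((1 / k) *\<^sub>R (T k (J h) - J h))) \<longlongrightarrow> (1 / h) *\<^sub>R (T h x - x)) (at_right 0)"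
      using gen_integral[OF x h(1)] unfolding gen_def J_def by (intro tendsto_intros)
    then show ?thesis
      unfolding gen_def
      by (rule Lim_transform_eventually)
        (auto simp: eventually_at_filter T_scaleR algebra_simps)
  qed
  then show ?thesis using h(2) by (auto simp: dist_norm)
qed

text \<open>The inequality \<open>p (x - h y) \<ge> (1 - h \<omega>) p x\<close> controls backward differences of
  \<open>p (T t x)\<close>; it is what a resolvent estimate provides.\<close>

lemma growth_on_domain:
  assumes p_add: "\<And>x y. p (x + y) \<le> p x + p y"
    and p_bound: "\<And>x. 0 \<le> p x \<and> p x \<le> C * norm x"
    and diss: "\<And>x y h. gen x y \<Longrightarrow> h > 0 \<Longrightarrow> (1 - h * \<omega>) * p x \<le> p (x - h *\<^sub>R y)"
    and xy: "gen x y" and b: "b \<ge> 0"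
  shows "p (T b x) \<le> exp (\<omega> * b) * p x"
proof -
  have p_diff: "\<bar>p a - p c\<bar> \<le> C * norm (a - c)" for a c
    using p_add[of c "a - c"] p_add[of a "c - a"] p_bound[of "a - c"] p_bound[of "c - a"]
    by (auto simp: abs_le_iff norm_minus_commute)
  define G where "G t = exp (- \<omega> * t) * p (T t x)" for t
  have p_tendsto: "((\<lambda>s. p (f s)) \<longlongrightarrow> p a) F" if "(f \<longlongrightarrow> a) F" for f a and F :: "real filter"
  proof -
    have "((\<lambda>s. C * norm (f s - a)) \<longlongrightarrow> C * norm (a - a)) F"
      using that by (intro tendsto_intros)
    then have "((\<lambda>s. p (f s) - p a) \<longlongrightarrow> 0) F"
      by (rule_tac Lim_null_comparison[of _ "\<lambda>s. C * norm (f s - a)"]) (auto simp: p_diff)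
    then show ?thesis by (simp flip: Lim_null)
  qed
  have contG: "continuous_on {0..b} G"
    unfolding G_def using continuous_on_subset[OF continuous_T[of x], of "{0..b}"]
    by (intro continuous_intros) (auto simp: continuous_on intro!: p_tendsto)
  have backward: "\<forall>\<^sub>F h in at_right 0. G t - e * h \<le> G (t - h)" if t: "t > 0" and e: "e > 0" for t e
  proof -
    define v where "v = T t y"
    have gv: "gen (T t x) v" using gen_T[OF xy] t by (simp add: v_def)
    define r where "r h = (1 / h) *\<^sub>R (T t x - T (t - h) x)" for h
    have "((\<lambda>s. T s x) has_vector_derivative v) (at t within {0..t})"
      unfolding v_def using has_vector_derivative_T[OF xy, of t] t
      by (rule_tac has_vector_derivative_within_subset) auto
    then have "((\<lambda>s. T s x) has_vector_derivative v) (at_left t)"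
      using t by (simp add: has_vector_derivative_def at_within_Icc_at_left)
    then have "((\<lambda>s. (1 / (s - t)) *\<^sub>R (T s x - T t x)) \<longlongrightarrow> v) (at_left t)"
      by (simp add: has_vector_derivative_iff_ratio)
    moreover have "filterlim (\<lambda>h. t - h) (at_left t) (at_right 0)"
      by (auto simp: filterlim_at eventually_at_filter intro!: tendsto_eq_intros)
    ultimately have "((\<lambda>h. (1 / (t - h - t)) *\<^sub>R (T (t - h) x - T t x)) \<longlongrightarrow> v) (at_right 0)"
      by (rule filterlim_compose)
    then have rv: "(r \<longlongrightarrow> v) (at_right 0)"
      unfolding r_def
      by (rule Lim_transform_eventually)
        (auto simp: eventually_at_filter scaleR_diff_right)
    have "((\<lambda>h. exp (\<omega> * h) * (1 - h * \<omega>)) has_real_derivative 0) (at 0 within {0<..})"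
      by (auto intro!: derivative_eq_intros)
    then have "((\<lambda>h. (exp (\<omega> * h) * (1 - h * \<omega>) - 1) / h) \<longlongrightarrow> 0) (at_right 0)"
      by (simp add: has_field_derivative_iff)
    then have "((\<lambda>h. exp (- \<omega> * t) * (p (T t x) * ((exp (\<omega> * h) * (1 - h * \<omega>) - 1) / h)
          - exp (\<omega> * h) * (C * norm (r h - v)))) \<longlongrightarrow>
        exp (- \<omega> * t) * (p (T t x) * 0 - exp (\<omega> * 0) * (C * norm (v - v)))) (at_right 0)"
      by (intro tendsto_intros rv)
    then have "\<forall>\<^sub>F h in at_right 0. - e < exp (- \<omega> * t) * (p (T t x) * ((exp (\<omega> * h) * (1 - h * \<omega>) - 1) / h)
          - exp (\<omega> * h) * (C * norm (r h - v)))"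
      by (rule order_tendstoD(1)) (use e in simp)
    moreover have "\<forall>\<^sub>F h in at_right (0::real). h > 0" by (simp add: eventually_at_filter)
    ultimately show ?thesis
    proof eventually_elim
      case (elim h)
      have "(1 - h * \<omega>) * p (T t x) \<le> p (T t x - h *\<^sub>R v)"
        by (rule diss[OF gv elim(2)])
      also have "\<dots> \<le> p (T (t - h) x) + C * norm ((T t x - h *\<^sub>R v) - T (t - h) x)"
        using p_diff[of "T t x - h *\<^sub>R v" "T (t - h) x"] by simp
      also have "(T t x - h *\<^sub>R v) - T (t - h) x = h *\<^sub>R (r h - v)"
        using elim(2) by (simp add: r_def algebra_simps)
      finally have 1: "(1 - h * \<omega>) * p (T t x) - h * (C * norm (r h - v)) \<le> p (T (t - h) x)"
        using elim(2) by (simp add: mult.left_commute)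
      have "G t - e * h \<le> G t + h * (exp (- \<omega> * t) * (p (T t x) * ((exp (\<omega> * h) * (1 - h * \<omega>) - 1) / h)
          - exp (\<omega> * h) * (C * norm (r h - v))))"
        using mult_left_mono[OF less_imp_le[OF elim(1)], of h] elim(2) by (simp add: mult.commute)
      also have "\<dots> = exp (- \<omega> * t) * exp (\<omega> * h) * ((1 - h * \<omega>) * p (T t x) - h * (C * norm (r h - v)))"
        using elim(2) by (simp add: G_def field_simps)
      also have "\<dots> \<le> exp (- \<omega> * t) * exp (\<omega> * h) * p (T (t - h) x)"
        by (intro mult_left_mono 1) simp
      also have "\<dots> = G (t - h)"
        by (simp add: G_def algebra_simps flip: exp_add)
      finally show ?case .
    qed
  qed
  have "G b \<le> G 0 + e * b" if e: "e > 0" for e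
  proof (rule ccontr)
    assume neg: "\<not> ?thesis"
    define K where "K t = G t - G 0 - e * t" for t
    have contK: "continuous_on {0..b} K"
      unfolding K_def by (intro continuous_intros contG)
    define S where "S = {t \<in> {0..b}. K b \<le> K t}"
    have "S = {0..b} \<inter> K -` {K b..}" by (auto simp: S_def)
    then have "compact S"
      using continuous_closed_preimage[OF contK closed_atLeastAtMost closed_atLeast[of "K b"]]
      by (auto simp: compact_eq_bounded_closed intro: bounded_subset[of "{0..b}"])
    moreover have "b \<in> S" using b by (simp add: S_def)
    ultimately obtain s where s: "s \<in> S" "\<And>t. t \<in> S \<Longrightarrow> s \<le> t"
      using compact_attains_inf[of S] by blast
    have "s \<noteq> 0" using s(1) neg by (auto simp: S_def K_def)
    then have s0: "s > 0" using s(1) by (simp add: S_def)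
    have "\<forall>\<^sub>F h in at_right 0. G s - e * h \<le> G (s - h) \<and> 0 < h \<and> h < s"
      using backward[OF s0 e] eventually_at_right_less[of "0::real"] eventually_at_right_real[OF s0]
      by eventually_elim auto
    then obtain h where h: "G s - e * h \<le> G (s - h)" "0 < h" "h < s"
      using eventually_happens'[OF trivial_limit_at_right_real] by blast
    then have "s - h \<in> S" using s(1) by (auto simp: S_def K_def algebra_simps)
    with s(2) h(2) show False by fastforce
  qed
  note eps = this
  have "G b \<le> G 0"
  proof (rule field_le_epsilon)
    fix e :: real assume e: "e > 0"
    have "e / (b + 1) * b \<le> e" using b e by (simp add: field_simps)
    with eps[of "e / (b + 1)"] b e show "G b \<le> G 0 + e" by simp
  qed
  then have "exp (\<omega> * b) * (exp (- \<omega> * b) * p (T b x)) \<le> exp (\<omega> * b) * p (T 0 x)"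
    by (simp add: G_def)
  then show ?thesis
    using gen_T0[OF xy] by (simp flip: exp_add mult.assoc)
qed

lemma growth_bound:
  assumes p_add: "\<And>x y. p (x + y) \<le> p x + p y"
    and p_bound: "\<And>x. 0 \<le> p x \<and> p x \<le> C * norm x"
    and diss: "\<And>x y h. gen x y \<Longrightarrow> h > 0 \<Longrightarrow> (1 - h * \<omega>) * p x \<le> p (x - h *\<^sub>R y)"
    and p_lower: "\<And>x. c * norm (T 0 x) \<le> p (T 0 x)" and c: "c > 0"
    and t: "t \<ge> 0"
  shows "norm (T t x) \<le> C / c * exp (\<omega> * t) * norm (T 0 x)"
proof -
  define x' where "x' = T 0 x"
  have x': "T 0 x' = x'" and Tx: "T t x = T t x'"
    using t by (simp_all add: x'_def T0_T T_T0)
  obtain M where M: "M \<ge> 0" "\<And>y. norm (T t y) \<le> M * norm y"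
    using locally_bounded[of t] t by auto
  have p_diff: "p a \<le> p c + C * norm (a - c)" for a c
    using p_add[of c "a - c"] p_bound[of "a - c"] by simp
  have C: "C * norm z \<ge> 0" for z :: 'a using p_bound[of z] by linarith
  define D where "D = C * M + exp (\<omega> * t) * C"
  have "p (T t x') \<le> exp (\<omega> * t) * p x' + e" if "e > 0" for e
  proof -
    obtain y z where y: "gen y z" "norm (y - x') < e / (\<bar>D\<bar> + 1)"
      using gen_dense[OF x', of "e / (\<bar>D\<bar> + 1)"] \<open>e > 0\<close> by auto
    have "p (T t x') \<le> p (T t y) + C * norm (T t x' - T t y)" by (rule p_diff)
    also have "\<dots> \<le> p (T t y) + C * (M * norm (x' - y))"
    proof (cases "x' = y")
      case False
      then have "C \<ge> 0" using C[of "x' - y"] by (simp add: zero_le_mult_iff)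
      then show ?thesis
        using M(2)[of "x' - y"] t by (simp add: T_diff mult_left_mono)
    qed simp
    also have "p (T t y) \<le> exp (\<omega> * t) * p y"
      using growth_on_domain[OF p_add p_bound diss y(1) t] by blast
    also have "exp (\<omega> * t) * p y \<le> exp (\<omega> * t) * (p x' + C * norm (y - x'))"
      by (intro mult_left_mono p_diff) auto
    finally have "p (T t x') \<le> exp (\<omega> * t) * p x' + D * norm (y - x')"
      by (simp add: D_def algebra_simps norm_minus_commute)
    moreover have "D * norm (y - x') \<le> (\<bar>D\<bar> + 1) * norm (y - x')"
      by (intro mult_right_mono) auto
    moreover have "(\<bar>D\<bar> + 1) * norm (y - x') \<le> e"
      using y(2) by (simp add: field_simps)
    ultimately show ?thesis by linarith
  qed
  then have "p (T t x') \<le> exp (\<omega> * t) * p x'"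
    by (rule field_le_epsilon)
  also have "\<dots> \<le> exp (\<omega> * t) * (C * norm x')"
    using p_bound by (intro mult_left_mono) auto
  finally have "c * norm (T t x') \<le> exp (\<omega> * t) * (C * norm x')"
    using p_lower[of "T t x'"] t by (simp add: T0_T)
  then show ?thesis
    using c by (simp add: Tx x'_def[symmetric] field_simps)
qed

end

section \<open>Semilinear evolution equations\<close>

lemma riemann_sums_tend_to_integral:
  fixes v :: "real \<Rightarrow> 'a::banach"
  assumes v: "continuous_on {a..b} v" and e: "e > 0"
  shows "\<exists>\<delta>>0. \<forall>(n::nat) s \<tau>. s 0 = a \<and> s n = b \<and>
      (\<forall>i<n. s i \<le> s (Suc i) \<and> s (Suc i) - s i < \<delta> \<and> s i \<le> \<tau> i \<and> \<tau> i \<le> s (Suc i)) \<longrightarrow>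
      norm ((\<Sum>i<n. (s (Suc i) - s i) *\<^sub>R v (\<tau> i)) - integral {a..b} v) < e"
proof -
  define e' where "e' = e / (\<bar>b - a\<bar> + 1)"
  have e': "e' > 0" using e by (simp add: e'_def)
  have "uniformly_continuous_on {a..b} v"
    by (rule compact_uniformly_continuous[OF v]) simp
  then obtain \<delta> where \<delta>: "\<delta> > 0"
    "\<And>x y. x \<in> {a..b} \<Longrightarrow> y \<in> {a..b} \<Longrightarrow> dist y x < \<delta> \<Longrightarrow> dist (v y) (v x) < e'"
    using e' unfolding uniformly_continuous_on_def by metis
  have "norm ((\<Sum>i<n. (s (Suc i) - s i) *\<^sub>R v (\<tau> i)) - integral {a..b} v) < e"
    if s0: "s 0 = a" and sn: "s n = b" and
      s: "\<And>i. i < n \<Longrightarrow> s i \<le> s (Suc i) \<and> s (Suc i) - s i < \<delta> \<and> s i \<le> \<tau> i \<and> \<tau> i \<le> s (Suc i)"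
    for n :: nat and s \<tau>
  proof -
    have mono: "s i \<le> s j" if "i \<le> j" "j \<le> n" for i j
      using that
    proof (induction j)
      case (Suc j)
      then show ?case using s[of j] by (cases "i = Suc j") auto
    qed simp
    have "norm ((\<Sum>i<k. (s (Suc i) - s i) *\<^sub>R v (\<tau> i)) - integral {a..s k} v) \<le> e' * (s k - a)"
      if "k \<le> n" for k
      using that
    proof (induction k)
      case 0
      then show ?case by (simp add: s0)
    next
      case (Suc k)
      have sk: "a \<le> s k" "s k \<le> s (Suc k)" "s (Suc k) \<le> b"
        using mono[of 0 k] mono[of k "Suc k"] mono[of "Suc k" n] Suc.prems by (auto simp: s0 sn)
      have sk': "s (Suc k) - s k < \<delta>" "s k \<le> \<tau> k" "\<tau> k \<le> s (Suc k)"
        using s[of k] Suc.prems by auto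
      have int: "v integrable_on {s k..s (Suc k)}"
        by (intro integrable_continuous_real continuous_on_subset[OF v]) (use sk in auto)
      have comb: "integral {a..s (Suc k)} v = integral {a..s k} v + integral {s k..s (Suc k)} v"
        using sk by (intro Henstock_Kurzweil_Integration.integral_combine[symmetric]
            integrable_continuous_real continuous_on_subset[OF v]) auto
      have "(s (Suc k) - s k) *\<^sub>R v (\<tau> k) - integral {s k..s (Suc k)} v
          = integral {s k..s (Suc k)} (\<lambda>r. v (\<tau> k) - v r)"
        using sk int by (subst integral_diff) auto
      moreover have "norm (integral {s k..s (Suc k)} (\<lambda>r. v (\<tau> k) - v r)) \<le> e' * (s (Suc k) - s k)"
      proof (rule integral_bound)
        show "continuous_on {s k..s (Suc k)} (\<lambda>r. v (\<tau> k) - v r)"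
          by (intro continuous_intros continuous_on_subset[OF v]) (use sk in auto)
        fix r assume "r \<in> {s k..s (Suc k)}"
        then have "dist (\<tau> k) r < \<delta>" "r \<in> {a..b}" "\<tau> k \<in> {a..b}"
          using sk sk' by (auto simp: dist_norm abs_less_iff)
        then show "norm (v (\<tau> k) - v r) \<le> e'"
          using \<delta>(2)[of r "\<tau> k"] by (simp add: dist_norm)
      qed (use sk in auto)
      ultimately have step: "norm ((s (Suc k) - s k) *\<^sub>R v (\<tau> k) - integral {s k..s (Suc k)} v)
          \<le> e' * (s (Suc k) - s k)"
        by simp
      have "norm ((\<Sum>i<Suc k. (s (Suc i) - s i) *\<^sub>R v (\<tau> i)) - integral {a..s (Suc k)} v)
        \<le> norm ((\<Sum>i<k. (s (Suc i) - s i) *\<^sub>R v (\<tau> i)) - integral {a..s k} v)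
          + norm ((s (Suc k) - s k) *\<^sub>R v (\<tau> k) - integral {s k..s (Suc k)} v)"
        using norm_triangle_ineq[of "(\<Sum>i<k. (s (Suc i) - s i) *\<^sub>R v (\<tau> i)) - integral {a..s k} v"
            "(s (Suc k) - s k) *\<^sub>R v (\<tau> k) - integral {s k..s (Suc k)} v"]
        by (simp add: comb algebra_simps)
      also have "\<dots> \<le> e' * (s k - a) + e' * (s (Suc k) - s k)"
        using Suc step by (intro add_mono) auto
      finally show ?case by (simp add: algebra_simps)
    qed
    from this[of n] have "norm ((\<Sum>i<n. (s (Suc i) - s i) *\<^sub>R v (\<tau> i)) - integral {a..b} v) \<le> e' * (b - a)"
      by (simp add: sn)
    also have "\<dots> < e' * (\<bar>b - a\<bar> + 1)"
      using e' by (intro mult_strict_left_mono) auto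
    also have "\<dots> = e" by (simp add: e'_def)
    finally show ?thesis .
  qed
  then show ?thesis using \<delta>(1) by blast
qed

lemma fine_partition_exists:
  fixes a b \<delta> :: real
  assumes "a \<le> b" "\<delta> > 0"
  obtains n :: nat and s where "s 0 = a" "s n = b"
    "\<And>i. i < n \<Longrightarrow> s i \<le> s (Suc i) \<and> s (Suc i) - s i < \<delta>"
proof -
  obtain m :: nat where m: "real m > (b - a) / \<delta>" using reals_Archimedean2 by blast
  define n where "n = Suc m"
  define s where "s i = a + real i * (b - a) / real n" for i
  have n: "real n > 0" "(b - a) / real n < \<delta>"
    using m assms by (auto simp: n_def field_simps)
  have "s (Suc i) - s i = (b - a) / real n" for i
    by (simp add: s_def algebra_simps add_divide_distrib diff_divide_distrib)
  then have "s i \<le> s (Suc i) \<and> s (Suc i) - s i < \<delta>" for i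
    using n assms(1) by (smt (verit) divide_nonneg_nonneg)
  moreover have "s 0 = a" "s n = b" using n by (auto simp: s_def)
  ultimately show ?thesis using that by blast
qed

lemma integral_exp:
  fixes c t :: real
  assumes "c \<noteq> 0" "t \<ge> 0"
  shows "integral {0..t} (\<lambda>s. exp (c * s)) = (exp (c * t) - 1) / c"
proof -
  have "((\<lambda>s. exp (c * s)) has_integral (exp (c * t) / c - exp (c * 0) / c)) {0..t}"
    using assms by (intro fundamental_theorem_of_calculus)
      (auto intro!: derivative_eq_intros simp flip: has_real_derivative_iff_has_vector_derivative)
  then show ?thesis by (simp add: integral_unique diff_divide_distrib)
qed

locale semilinear_c0 = semigroup_c0 T for T :: "real \<Rightarrow> 'a::banach \<Rightarrow> 'a" +
  fixes N :: "'a \<Rightarrow> 'a" and K :: real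
  assumes N_0: "N 0 = 0" and K_nonneg: "K \<ge> 0"
    and N_lipschitz: "norm (N x - N y) \<le> K * (norm x + norm y) * norm (x - y)"
begin

lemma continuous_T_joint: "continuous_on ({0..} \<times> UNIV) (\<lambda>z. T (fst z) (snd z))"
  unfolding continuous_on
proof
  fix z :: "real \<times> 'a" assume z: "z \<in> {0..} \<times> UNIV"
  let ?F = "at z within {0..} \<times> UNIV"
  obtain M where M: "\<And>r x. r \<in> {0..fst z + 1} \<Longrightarrow> norm (T r x) \<le> M * norm x"
    using locally_bounded[of "fst z + 1"] by blast
  have fst: "(fst \<longlongrightarrow> fst z) ?F" and snd: "(snd \<longlongrightarrow> snd z) ?F"
    by (auto intro!: tendsto_intros)
  have in0: "\<forall>\<^sub>F y in ?F. fst y \<in> {0..}"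
    unfolding eventually_at_filter by (rule always_eventually) auto
  have "((\<lambda>y. T (fst y) (snd z)) \<longlongrightarrow> T (fst z) (snd z)) ?F"
    using continuous_T[of "snd z"] fst _ in0 by (rule continuous_on_tendsto_compose) (use z in auto)
  then have "((\<lambda>y. M * norm (snd y - snd z) + norm (T (fst y) (snd z) - T (fst z) (snd z))) \<longlongrightarrow>
      M * norm (snd z - snd z) + norm (T (fst z) (snd z) - T (fst z) (snd z))) ?F"
    by (intro tendsto_intros snd)
  then have lim: "((\<lambda>y. M * norm (snd y - snd z) + norm (T (fst y) (snd z) - T (fst z) (snd z))) \<longlongrightarrow> 0) ?F"
    by simp
  have "\<forall>\<^sub>F y in ?F. fst y < fst z + 1"
    using fst by (rule order_tendstoD(2)) simp
  then have "\<forall>\<^sub>F y in ?F. norm (T (fst y) (snd y) - T (fst z) (snd z))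
      \<le> M * norm (snd y - snd z) + norm (T (fst y) (snd z) - T (fst z) (snd z))"
    using in0
  proof eventually_elim
    case (elim y)
    have "norm (T (fst y) (snd y) - T (fst z) (snd z))
        \<le> norm (T (fst y) (snd y - snd z)) + norm (T (fst y) (snd z) - T (fst z) (snd z))"
      using norm_triangle_ineq[of "T (fst y) (snd y - snd z)" "T (fst y) (snd z) - T (fst z) (snd z)"] elim
      by (simp add: T_diff)
    also have "norm (T (fst y) (snd y - snd z)) \<le> M * norm (snd y - snd z)"
      using elim by (intro M) auto
    finally show ?case by simp
  qed
  from Lim_null_comparison[OF this lim]
  show "((\<lambda>y. T (fst y) (snd y)) \<longlongrightarrow> T (fst z) (snd z)) ?F"
    by (simp flip: Lim_null)
qed

lemma continuous_on_T_compose: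
  assumes "continuous_on S r" "continuous_on S v" "\<And>s. s \<in> S \<Longrightarrow> r s \<ge> 0"
  shows "continuous_on S (\<lambda>s. T (r s) (v s))"
  using continuous_on_compose2[OF continuous_T_joint continuous_on_Pair[OF assms(1,2)]] assms(3)
  by auto

lemma continuous_on_N:
  assumes "continuous_on S u"
  shows "continuous_on S (\<lambda>s. N (u s))"
  unfolding continuous_on
proof
  fix s assume s: "s \<in> S"
  have u: "(u \<longlongrightarrow> u s) (at s within S)" using assms s by (auto simp: continuous_on)
  then have "((\<lambda>r. K * (norm (u r) + norm (u s)) * norm (u r - u s)) \<longlongrightarrow>
      K * (norm (u s) + norm (u s)) * norm (u s - u s)) (at s within S)"
    by (intro tendsto_intros)
  then have "((\<lambda>r. K * (norm (u r) + norm (u s)) * norm (u r - u s)) \<longlongrightarrow> 0) (at s within S)" by simp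
  then have "((\<lambda>r. N (u r) - N (u s)) \<longlongrightarrow> 0) (at s within S)"
    by (rule Lim_null_comparison[rotated]) (auto simp: N_lipschitz)
  then show "((\<lambda>r. N (u r)) \<longlongrightarrow> N (u s)) (at s within S)"
    by (simp flip: Lim_null)
qed

definition duhamel :: "(real \<Rightarrow> 'a) \<Rightarrow> real \<Rightarrow> 'a" where
  "duhamel u t = integral {0..t} (\<lambda>s. T (t - s) (N (u s)))"

definition mild :: "real \<Rightarrow> (real \<Rightarrow> 'a) \<Rightarrow> 'a \<Rightarrow> bool" where
  "mild \<tau> u f \<longleftrightarrow> continuous_on {0..\<tau>} u \<and> (\<forall>t\<in>{0..\<tau>}. u t = T t f + duhamel u t)"

lemma continuous_duhamel_integrand:
  assumes "continuous_on {0..\<tau>} u" "t \<le> \<tau>"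
  shows "continuous_on {0..t} (\<lambda>s. T (t - s) (N (u s)))"
  using assms
  by (intro continuous_on_T_compose continuous_intros continuous_on_N continuous_on_subset[OF assms(1)]) auto

lemma integrable_duhamel_integrand:
  assumes "continuous_on {0..\<tau>} u" "t \<le> \<tau>"
  shows "(\<lambda>s. T (t - s) (N (u s))) integrable_on {0..t}"
  using continuous_duhamel_integrand[OF assms] by (rule integrable_continuous_real)

lemma duhamel_cong: "(\<And>s. s \<in> {0..t} \<Longrightarrow> u s = v s) \<Longrightarrow> duhamel u t = duhamel v t"
  unfolding duhamel_def by (intro integral_cong) simp

lemma mild_cong:
  assumes "\<And>s. s \<in> {0..\<tau>} \<Longrightarrow> u s = v s" "mild \<tau> u f"
  shows "mild \<tau> v f"
proof -
  have "duhamel u t = duhamel v t" if "t \<in> {0..\<tau>}" for t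
    using that assms(1) by (intro duhamel_cong) auto
  moreover have "continuous_on {0..\<tau>} v"
    using assms continuous_on_cong[of "{0..\<tau>}" "{0..\<tau>}" u v] by (auto simp: mild_def)
  ultimately show ?thesis using assms by (auto simp: mild_def)
qed

lemma mild_subinterval: "mild \<tau> u f \<Longrightarrow> \<tau>' \<le> \<tau> \<Longrightarrow> mild \<tau>' u f"
  unfolding mild_def by (auto intro: continuous_on_subset)

lemma T0_duhamel:
  assumes "continuous_on {0..\<tau>} u" "t \<le> \<tau>"
  shows "T 0 (duhamel u t) = duhamel u t"
proof -
  have "T 0 (duhamel u t) = integral {0..t} (T 0 \<circ> (\<lambda>s. T (t - s) (N (u s))))"
    unfolding duhamel_def
    by (intro integral_linear[symmetric] integrable_duhamel_integrand[OF assms] bounded_linear_T) simp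
  also have "\<dots> = duhamel u t"
    unfolding duhamel_def by (intro integral_cong) (simp add: T0_T)
  finally show ?thesis .
qed

lemma continuous_duhamel:
  assumes u: "continuous_on {0..\<tau>} u" and \<tau>: "\<tau> \<ge> 0"
  shows "continuous_on {0..\<tau>} (duhamel u)"
proof -
  define k where "k t s = T (max 0 (t - s)) (N (u s))" for t s
  have Nu: "continuous_on {0..\<tau>} (\<lambda>s. N (u s))"
    by (rule continuous_on_N[OF u])
  have Nu': "continuous_on ({0..\<tau>} \<times> {0..\<tau>}) (\<lambda>z. N (u (snd z)))"
    by (rule continuous_on_compose2[OF Nu]) (auto intro!: continuous_intros)
  have kc: "continuous_on ({0..\<tau>} \<times> {0..\<tau>}) (\<lambda>z. k (fst z) (snd z))"
    unfolding k_def by (intro continuous_on_T_compose continuous_intros Nu') auto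
  have "continuous_on {0..\<tau>} (\<lambda>t. integral (cbox 0 \<tau>) (k t))"
    using kc by (intro integral_continuous_on_param) (simp add: case_prod_beta')
  moreover have "continuous_on {0..\<tau>} (\<lambda>t. integral {0..t} (\<lambda>s. T 0 (N (u s))))"
    using Nu by (intro indefinite_integral_continuous_1 integrable_continuous_real
        continuous_on_T_compose continuous_intros) auto
  ultimately have "continuous_on {0..\<tau>} (\<lambda>t. integral (cbox 0 \<tau>) (k t) -
      (integral {0..\<tau>} (\<lambda>s. T 0 (N (u s))) - integral {0..t} (\<lambda>s. T 0 (N (u s)))))"
    by (intro continuous_intros)
  then show ?thesis
  proof (rule continuous_on_eq)
    fix t assume t: "t \<in> {0..\<tau>}"
    have "continuous_on {0..\<tau>} (k t)"
      unfolding k_def by (intro continuous_on_T_compose continuous_intros Nu) auto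
    then have "integral {0..\<tau>} (k t) = integral {0..t} (k t) + integral {t..\<tau>} (k t)"
      using t by (intro Henstock_Kurzweil_Integration.integral_combine[symmetric]
          integrable_continuous_real) auto
    also have "integral {0..t} (k t) = duhamel u t"
      unfolding duhamel_def by (intro integral_cong) (auto simp: k_def)
    also have "integral {t..\<tau>} (k t) = integral {t..\<tau>} (\<lambda>s. T 0 (N (u s)))"
      by (intro integral_cong) (auto simp: k_def max_def)
    also have "integral {t..\<tau>} (\<lambda>s. T 0 (N (u s))) =
        integral {0..\<tau>} (\<lambda>s. T 0 (N (u s))) - integral {0..t} (\<lambda>s. T 0 (N (u s)))"
      using t Nu Henstock_Kurzweil_Integration.integral_combine[of 0 t \<tau> "\<lambda>s. T 0 (N (u s))"]
      by (simp add: integrable_continuous_real continuous_on_T_compose eq_diff_eq add.commute)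
    finally show "integral (cbox 0 \<tau>) (k t) -
      (integral {0..\<tau>} (\<lambda>s. T 0 (N (u s))) - integral {0..t} (\<lambda>s. T 0 (N (u s)))) = duhamel u t"
      by simp
  qed
qed

lemma duhamel_diff_bound:
  assumes u: "continuous_on {0..\<tau>} u" and v: "continuous_on {0..\<tau>} v" and t: "t \<in> {0..\<tau>}"
    and b: "continuous_on {0..t} b"
    and bound: "\<And>s. s \<in> {0..t} \<Longrightarrow> norm (T (t - s) (N (u s) - N (v s))) \<le> b s"
  shows "norm (duhamel u t - duhamel v t) \<le> integral {0..t} b"
proof -
  have "duhamel u t - duhamel v t = integral {0..t} (\<lambda>s. T (t - s) (N (u s)) - T (t - s) (N (v s)))"
    unfolding duhamel_def using t
    by (intro integral_diff[symmetric] integrable_duhamel_integrand[OF u] integrable_duhamel_integrand[OF v]) auto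
  also have "norm \<dots> \<le> integral {0..t} b"
    using t bound
    by (intro integral_norm_bound_integral integrable_diff integrable_duhamel_integrand[OF u]
        integrable_duhamel_integrand[OF v] integrable_continuous_real[OF b]) (auto simp flip: T_diff)
  finally show ?thesis .
qed

lemma mild_unique:
  assumes u: "mild \<tau> u f" and v: "mild \<tau> v f" and t: "t \<in> {0..\<tau>}"
  shows "u t = v t"
proof -
  have cu: "continuous_on {0..\<tau>} u" and cv: "continuous_on {0..\<tau>} v"
    using u v by (auto simp: mild_def)
  obtain M where M: "M \<ge> 0" "\<And>s x. s \<in> {0..\<tau>} \<Longrightarrow> norm (T s x) \<le> M * norm x"
    using locally_bounded[of \<tau>] by blast
  have "compact (u ` {0..\<tau>} \<union> v ` {0..\<tau>})"
    using cu cv by (intro compact_Un compact_continuous_image) auto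
  then obtain R where R: "R > 0" "\<And>x. x \<in> u ` {0..\<tau>} \<union> v ` {0..\<tau>} \<Longrightarrow> norm x \<le> R"
    using compact_imp_bounded[of "u ` {0..\<tau>} \<union> v ` {0..\<tau>}"] unfolding bounded_pos by blast
  define L where "L = M * (K * (R + R))"
  have L: "L \<ge> 0" using M R K_nonneg by (simp add: L_def)
  define c where "c = 2 * L + 1"
  have c: "c > 0" "2 * L \<le> c" using L by (auto simp: c_def)
  define D where "D s = exp (- c * s) * norm (u s - v s)" for s
  have "continuous_on {0..\<tau>} D"
    unfolding D_def by (intro continuous_intros cu cv)
  then obtain m where m: "m \<in> {0..\<tau>}" "\<And>s. s \<in> {0..\<tau>} \<Longrightarrow> D s \<le> D m"
    using continuous_attains_sup[of "{0..\<tau>}" D] t by auto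
  have "norm (duhamel u m - duhamel v m) \<le> integral {0..m} (\<lambda>s. L * D m * exp (c * s))"
  proof (rule duhamel_diff_bound[OF cu cv m(1)])
    show "continuous_on {0..m} (\<lambda>s. L * D m * exp (c * s))" by (intro continuous_intros)
    fix s assume s: "s \<in> {0..m}"
    have "norm (T (m - s) (N (u s) - N (v s))) \<le> M * norm (N (u s) - N (v s))"
      using s m by (intro M) auto
    also have "\<dots> \<le> M * (K * (norm (u s) + norm (v s)) * norm (u s - v s))"
      by (intro mult_left_mono N_lipschitz M)
    also have "\<dots> \<le> M * (K * (R + R) * norm (u s - v s))"
      using s m M K_nonneg by (intro mult_left_mono mult_right_mono add_mono R(2)) auto
    also have "\<dots> = L * (exp (c * s) * D s)"
      by (simp add: L_def D_def exp_minus field_simps)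
    also have "\<dots> \<le> L * (exp (c * s) * D m)"
      using s m L by (intro mult_left_mono m(2)) auto
    finally show "norm (T (m - s) (N (u s) - N (v s))) \<le> L * D m * exp (c * s)"
      by (simp add: mult_ac)
  qed
  also have "\<dots> = L * D m * integral {0..m} (\<lambda>s. exp (c * s))" by simp
  also have "\<dots> \<le> L * D m * (exp (c * m) / c)"
    using m L c by (intro mult_left_mono) (auto simp: D_def integral_exp divide_right_mono)
  also have "\<dots> \<le> D m * exp (c * m) / 2"
  proof -
    have "L / c \<le> 1 / 2" using c by (simp add: field_simps)
    from mult_right_mono[OF this, of "D m * exp (c * m)"] show ?thesis by (simp add: D_def)
  qed
  finally have 1: "norm (duhamel u m - duhamel v m) \<le> D m * exp (c * m) / 2" .
  have "u m - v m = duhamel u m - duhamel v m"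
    using u v m by (simp add: mild_def)
  with 1 have "norm (u m - v m) \<le> norm (u m - v m) / 2"
    by (simp add: D_def exp_minus field_simps)
  then have "D m = 0" by (simp add: D_def)
  with m(2)[OF t] have "D t \<le> 0" by simp
  then show ?thesis by (simp add: D_def mult_le_0_iff)
qed

lemma mild_exists:
  assumes \<tau>: "\<tau> \<ge> 0" and M: "M \<ge> 0"
    and growth: "\<And>t x. t \<ge> 0 \<Longrightarrow> norm (T t x) \<le> M * exp (\<omega> * t) * norm x"
    and A: "\<And>t. t \<in> {0..\<tau>} \<Longrightarrow>
        M * K * integral {0..t} (\<lambda>s. exp (\<omega> * (t - s)) * exp (2 * \<gamma> * s)) \<le> A * exp (\<gamma> * t)"
    and f: "\<And>t. t \<in> {0..\<tau>} \<Longrightarrow> norm (T t f) \<le> a * exp (\<gamma> * t)"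
    and small: "8 * a * A \<le> 1"
  shows "\<exists>u. mild \<tau> u f \<and> (\<forall>t\<in>{0..\<tau>}. norm (u t - T t f) \<le> 8 * a^2 * A * exp (\<gamma> * t))"
proof -
  have a: "a \<ge> 0"
    using order_trans[OF norm_ge_zero f[of 0]] \<tau> by simp
  have core: "norm (duhamel u t - duhamel v t) \<le> 4 * a * d * A * exp (\<gamma> * t)"
    if u: "continuous_on {0..\<tau>} u" "\<And>s. s \<in> {0..\<tau>} \<Longrightarrow> norm (u s) \<le> 2 * a * exp (\<gamma> * s)"
      and v: "continuous_on {0..\<tau>} v" "\<And>s. s \<in> {0..\<tau>} \<Longrightarrow> norm (v s) \<le> 2 * a * exp (\<gamma> * s)"
      and d: "\<And>s. s \<in> {0..\<tau>} \<Longrightarrow> norm (u s - v s) \<le> d * exp (\<gamma> * s)" and t: "t \<in> {0..\<tau>}"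
    for u v d t
  proof -
    have d0: "d \<ge> 0" using order_trans[OF norm_ge_zero d[of 0]] \<tau> by simp
    have "norm (duhamel u t - duhamel v t)
        \<le> integral {0..t} (\<lambda>s. 4 * a * d * (M * K) * (exp (\<omega> * (t - s)) * exp (2 * \<gamma> * s)))"
    proof (rule duhamel_diff_bound[OF u(1) v(1) t])
      show "continuous_on {0..t} (\<lambda>s. 4 * a * d * (M * K) * (exp (\<omega> * (t - s)) * exp (2 * \<gamma> * s)))"
        by (intro continuous_intros)
      fix s assume s: "s \<in> {0..t}"
      then have s': "s \<in> {0..\<tau>}" using t by auto
      have "norm (T (t - s) (N (u s) - N (v s))) \<le> M * exp (\<omega> * (t - s)) * norm (N (u s) - N (v s))"
        using s by (intro growth) auto
      also have "\<dots> \<le> M * exp (\<omega> * (t - s)) * (K * (norm (u s) + norm (v s)) * norm (u s - v s))"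
        using M by (intro mult_left_mono N_lipschitz) auto
      also have "\<dots> \<le> M * exp (\<omega> * (t - s)) * (K * (2 * a * exp (\<gamma> * s) + 2 * a * exp (\<gamma> * s)) * (d * exp (\<gamma> * s)))"
        using M K_nonneg a d0 by (intro mult_left_mono mult_mono add_mono u(2) v(2) d s') auto
      also have "\<dots> = 4 * a * d * (M * K) * (exp (\<omega> * (t - s)) * exp (2 * \<gamma> * s))"
      proof -
        have "exp (2 * \<gamma> * s) = exp (\<gamma> * s) * exp (\<gamma> * s)" by (simp flip: exp_add)
        then show ?thesis by (simp add: algebra_simps)
      qed
      finally show "norm (T (t - s) (N (u s) - N (v s)))
          \<le> 4 * a * d * (M * K) * (exp (\<omega> * (t - s)) * exp (2 * \<gamma> * s))" .
    qed
    also have "\<dots> = 4 * a * d * (M * K * integral {0..t} (\<lambda>s. exp (\<omega> * (t - s)) * exp (2 * \<gamma> * s)))"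
      by (simp add: mult.assoc)
    also have "\<dots> \<le> 4 * a * d * (A * exp (\<gamma> * t))"
      using a d0 by (intro mult_left_mono A t) auto
    finally show ?thesis by (simp add: mult_ac)
  qed
  define cl where "cl t = max 0 (min \<tau> t)" for t
  have cl: "cl t \<in> {0..\<tau>}" for t using \<tau> by (simp add: cl_def)
  have cl_id: "cl t = t" if "t \<in> {0..\<tau>}" for t using that by (simp add: cl_def)
  have cont_cl: "continuous_on UNIV cl" unfolding cl_def by (intro continuous_intros)
  define U where "U z t = exp (\<gamma> * t) *\<^sub>R apply_bcontfun z t" for z :: "real \<Rightarrow>\<^sub>C 'a" and t
  define P where "P z t = exp (- \<gamma> * t) *\<^sub>R (T t f + duhamel (U z) t)" for z t
  have cU: "continuous_on S (U z)" for S z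
    unfolding U_def by (intro continuous_intros continuous_on_apply_bcontfun)
  have cP: "continuous_on {0..\<tau>} (P z)" for z
    unfolding P_def
    by (intro continuous_intros continuous_duhamel cU \<tau> continuous_on_subset[OF continuous_T]) auto
  define \<Phi> where "\<Phi> z = Bcontfun (\<lambda>t. P z (cl t))" for z
  have "(\<lambda>t. P z (cl t)) \<in> bcontfun" for z
  proof -
    have "continuous_on UNIV (\<lambda>t. P z (cl t))"
      by (rule continuous_on_compose2[OF cP cont_cl]) (use cl in auto)
    moreover have "bounded (P z ` {0..\<tau>})"
      by (intro compact_imp_bounded compact_continuous_image cP) simp
    then have "bounded (range (\<lambda>t. P z (cl t)))"
      by (rule bounded_subset) (use cl in auto)
    ultimately show ?thesis by (simp add: bcontfun_def)
  qed
  then have \<Phi>: "apply_bcontfun (\<Phi> z) t = P z (cl t)" for z t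
    by (simp add: \<Phi>_def Bcontfun_inverse)
  define S where "S = cball (0 :: real \<Rightarrow>\<^sub>C 'a) (2 * a)"
  have U_bound: "norm (U z s) \<le> 2 * a * exp (\<gamma> * s)" if "z \<in> S" for z s
  proof -
    have "norm (apply_bcontfun z s) \<le> 2 * a"
      using norm_bounded[of z s] that by (simp add: S_def)
    then show ?thesis by (simp add: U_def mult.commute mult_left_mono)
  qed
  have P_diff: "norm (P z t - P z' t) \<le> 4 * a * A * dist z z'" if "z \<in> S" "z' \<in> S" "t \<in> {0..\<tau>}" for z z' t
  proof -
    have "norm (U z s - U z' s) \<le> dist z z' * exp (\<gamma> * s)" for s
      using dist_bounded[of z s z'] by (simp add: U_def dist_norm flip: scaleR_diff_right)
    then have "norm (duhamel (U z) t - duhamel (U z') t) \<le> 4 * a * dist z z' * A * exp (\<gamma> * t)"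
      using that by (intro core U_bound cU) auto
    moreover have "norm (P z t - P z' t) = exp (- \<gamma> * t) * norm (duhamel (U z) t - duhamel (U z') t)"
      by (simp add: P_def flip: scaleR_diff_right)
    ultimately have "norm (P z t - P z' t) \<le> exp (- \<gamma> * t) * (4 * a * dist z z' * A * exp (\<gamma> * t))"
      by (simp add: mult_left_mono)
    also have "\<dots> = 4 * a * A * dist z z'" by (simp add: exp_minus field_simps)
    finally show ?thesis .
  qed
  have \<Phi>_diff: "dist (\<Phi> z) (\<Phi> z') \<le> 1 / 2 * dist z z'" if "z \<in> S" "z' \<in> S" for z z'
  proof (rule dist_bound)
    fix t
    have "dist (apply_bcontfun (\<Phi> z) t) (apply_bcontfun (\<Phi> z') t) \<le> 4 * a * A * dist z z'"
      using P_diff[OF that cl] by (simp add: \<Phi> dist_norm)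
    also have "\<dots> \<le> 1 / 2 * dist z z'" using small by (intro mult_right_mono) auto
    finally show "dist (apply_bcontfun (\<Phi> z) t) (apply_bcontfun (\<Phi> z') t) \<le> 1 / 2 * dist z z'" .
  qed
  have U0: "U 0 = (\<lambda>_. 0)" by (simp add: U_def fun_eq_iff)
  have duh0: "duhamel (\<lambda>_. 0) t = 0" for t
  proof -
    have "duhamel (\<lambda>_. 0) t = integral {0..t} (\<lambda>s. 0)"
      unfolding duhamel_def
    proof (rule integral_cong)
      fix s assume "s \<in> {0..t}"
      then show "T (t - s) (N 0) = 0" using T_scaleR[of "t - s" 0 0] by (simp add: N_0)
    qed
    then show ?thesis by simp
  qed
  have P0: "P 0 t = exp (- \<gamma> * t) *\<^sub>R T t f" for t
    by (simp add: P_def U0 duh0)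
  have \<Phi>0: "norm (\<Phi> 0) \<le> a"
  proof (rule norm_bound)
    fix t
    have "norm (P 0 (cl t)) \<le> exp (- \<gamma> * cl t) * (a * exp (\<gamma> * cl t))"
      using f[OF cl] by (simp add: P0 mult_left_mono)
    then show "norm (apply_bcontfun (\<Phi> 0) t) \<le> a"
      by (simp add: \<Phi> exp_minus field_simps)
  qed
  have S0: "0 \<in> S" using a by (simp add: S_def)
  have "\<Phi> ` S \<subseteq> S"
  proof
    fix y assume "y \<in> \<Phi> ` S"
    then obtain z where z: "z \<in> S" "y = \<Phi> z" by auto
    have "norm (\<Phi> z) \<le> norm (\<Phi> 0) + dist (\<Phi> z) (\<Phi> 0)"
      using norm_triangle_ineq[of "\<Phi> 0" "\<Phi> z - \<Phi> 0"] by (simp add: dist_norm)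
    also have "\<dots> \<le> a + 1 / 2 * dist z 0"
      using \<Phi>0 \<Phi>_diff[OF z(1) S0] by simp
    also have "\<dots> \<le> 2 * a" using z(1) by (simp add: S_def)
    finally show "y \<in> S" by (simp add: S_def z(2))
  qed
  moreover have "complete S" unfolding S_def by (simp add: complete_eq_closed)
  ultimately obtain z where z: "z \<in> S" "\<Phi> z = z"
    using Banach_fix[of S "1/2" \<Phi>] S0 \<Phi>_diff by auto
  have uz: "U z t = T t f + duhamel (U z) t" if "t \<in> {0..\<tau>}" for t
  proof -
    have "apply_bcontfun z t = P z t" using \<Phi>[of z t] z(2) cl_id[OF that] by simp
    then have "U z t = exp (\<gamma> * t) *\<^sub>R (exp (- \<gamma> * t) *\<^sub>R (T t f + duhamel (U z) t))"
      by (simp add: U_def P_def)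
    then show ?thesis by (simp flip: exp_add)
  qed
  then have "mild \<tau> (U z) f" by (simp add: mild_def cU)
  moreover have "norm (U z t - T t f) \<le> 8 * a^2 * A * exp (\<gamma> * t)" if t: "t \<in> {0..\<tau>}" for t
  proof -
    have "norm (duhamel (U z) t - duhamel (\<lambda>_. 0) t) \<le> 4 * a * (2 * a) * A * exp (\<gamma> * t)"
      using U_bound[OF z(1)] a t by (intro core cU) auto
    then show ?thesis using uz[OF t] by (simp add: duh0 power2_eq_square)
  qed
  ultimately show ?thesis by blast
qed

lemma mild_glue:
  assumes "\<And>n::nat. \<exists>u. mild (real n) u f \<and> (\<forall>t\<in>{0..real n}. P t (u t))"
  shows "\<exists>u. (\<forall>\<tau>. mild \<tau> u f) \<and> (\<forall>t\<ge>0. P t (u t))"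
proof -
  obtain U where U: "\<And>n::nat. mild (real n) (U n) f" "\<And>n t. t \<in> {0..real n} \<Longrightarrow> P t (U n t)"
    using assms by metis
  define u where "u t = U (nat \<lceil>t\<rceil>) t" for t
  have eq: "u t = U n t" if "t \<in> {0..real n}" for t n
  proof -
    have n: "nat \<lceil>t\<rceil> \<le> n" "t \<le> real (nat \<lceil>t\<rceil>)"
      using that by (auto simp: nat_le_iff ceiling_le_iff)
    have "mild (real (nat \<lceil>t\<rceil>)) (U n) f"
      using n by (intro mild_subinterval[OF U(1)[of n]]) simp
    then show ?thesis
      unfolding u_def using that n by (intro mild_unique[OF U(1)]) auto
  qed
  have "mild \<tau> u f" for \<tau>
  proof -
    obtain n :: nat where "\<tau> \<le> real n" using real_arch_simple by blast
    moreover have "mild (real n) u f"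
      by (rule mild_cong[OF _ U(1)[of n]]) (use eq in auto)
    ultimately show ?thesis using mild_subinterval by blast
  qed
  moreover have "P t (u t)" if "t \<ge> 0" for t
    unfolding u_def using that by (intro U) (auto simp: of_nat_ceiling)
  ultimately show ?thesis by blast
qed

end

section \<open>The coagulation operator\<close>

lemma integrable_tensor:
  fixes f h :: "real \<Rightarrow> real"
  assumes f: "integrable lborel f" and h: "integrable lborel h"
  shows "integrable (lborel \<Otimes>\<^sub>M lborel) (\<lambda>z. f (fst z) * h (snd z))"
    and "(\<integral>z. \<bar>f (fst z) * h (snd z)\<bar> \<partial>(lborel \<Otimes>\<^sub>M lborel)) = (\<integral>x. \<bar>f x\<bar> \<partial>lborel) * (\<integral>x. \<bar>h x\<bar> \<partial>lborel)"
proof -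
  have [measurable]: "f \<in> borel_measurable borel" "h \<in> borel_measurable borel"
    using f h by (auto dest: borel_measurable_integrable)
  show int: "integrable (lborel \<Otimes>\<^sub>M lborel) (\<lambda>z. f (fst z) * h (snd z))"
    using f h by (intro lborel_pair.Fubini_integrable) (auto simp: abs_mult)
  have "(\<integral>z. \<bar>f (fst z) * h (snd z)\<bar> \<partial>(lborel \<Otimes>\<^sub>M lborel)) =
      (\<integral>x. (\<integral>y. \<bar>f (fst (x, y)) * h (snd (x, y))\<bar> \<partial>lborel) \<partial>lborel)"
    using int by (intro lborel_pair.integral_fst'[symmetric]) auto
  then show "(\<integral>z. \<bar>f (fst z) * h (snd z)\<bar> \<partial>(lborel \<Otimes>\<^sub>M lborel)) = (\<integral>x. \<bar>f x\<bar> \<partial>lborel) * (\<integral>x. \<bar>h x\<bar> \<partial>lborel)"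
    by (simp add: abs_mult)
qed

lemma integral_fst_L1_bound:
  fixes F :: "real \<times> real \<Rightarrow> real"
  assumes F: "integrable (lborel \<Otimes>\<^sub>M lborel) F"
  shows "(\<integral>x. \<bar>\<integral>y. F (x, y) \<partial>lborel\<bar> \<partial>lborel) \<le> (\<integral>z. \<bar>F z\<bar> \<partial>(lborel \<Otimes>\<^sub>M lborel))"
proof -
  have "(\<integral>x. \<bar>\<integral>y. F (x, y) \<partial>lborel\<bar> \<partial>lborel) \<le> (\<integral>x. (\<integral>y. \<bar>F (x, y)\<bar> \<partial>lborel) \<partial>lborel)"
    using lborel_pair.integrable_fst'[OF F] lborel_pair.integrable_fst'[OF integrable_abs[OF F]]
    by (intro integral_mono) auto
  also have "\<dots> = (\<integral>z. \<bar>F z\<bar> \<partial>(lborel \<Otimes>\<^sub>M lborel))"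
    using lborel_pair.integral_fst'[OF integrable_abs[OF F]] .
  finally show ?thesis .
qed

lemma shear_nn_integral:
  fixes F :: "real \<times> real \<Rightarrow> real"
  assumes [measurable]: "F \<in> borel_measurable (lborel \<Otimes>\<^sub>M lborel)"
  shows "(\<integral>\<^sup>+z. ennreal \<bar>F (fst z - snd z, snd z)\<bar> \<partial>(lborel \<Otimes>\<^sub>M lborel))
    = (\<integral>\<^sup>+z. ennreal \<bar>F z\<bar> \<partial>(lborel \<Otimes>\<^sub>M lborel))"
proof -
  have "(\<integral>\<^sup>+z. ennreal \<bar>F (fst z - snd z, snd z)\<bar> \<partial>(lborel \<Otimes>\<^sub>M lborel)) =
      (\<integral>\<^sup>+y. \<integral>\<^sup>+x. ennreal \<bar>F (x - y, y)\<bar> \<partial>lborel \<partial>lborel)"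
    by (subst lborel_pair.nn_integral_snd[symmetric]) simp_all
  also have "\<dots> = (\<integral>\<^sup>+y. \<integral>\<^sup>+x. ennreal \<bar>F (x, y)\<bar> \<partial>lborel \<partial>lborel)"
  proof (rule nn_integral_cong)
    fix y :: real
    show "(\<integral>\<^sup>+x. ennreal \<bar>F (x - y, y)\<bar> \<partial>lborel) = (\<integral>\<^sup>+x. ennreal \<bar>F (x, y)\<bar> \<partial>lborel)"
      using nn_integral_real_affine[of "\<lambda>x. ennreal \<bar>F (x, y)\<bar>" 1 "- y"] by simp
  qed
  also have "\<dots> = (\<integral>\<^sup>+z. ennreal \<bar>F z\<bar> \<partial>(lborel \<Otimes>\<^sub>M lborel))"
    by (subst lborel_pair.nn_integral_snd[symmetric]) simp_all
  finally show ?thesis .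
qed

lemma shear_integrable:
  fixes F :: "real \<times> real \<Rightarrow> real"
  assumes F: "integrable (lborel \<Otimes>\<^sub>M lborel) F"
  shows "integrable (lborel \<Otimes>\<^sub>M lborel) (\<lambda>z. F (fst z - snd z, snd z))"
    and "(\<integral>z. \<bar>F (fst z - snd z, snd z)\<bar> \<partial>(lborel \<Otimes>\<^sub>M lborel)) = (\<integral>z. \<bar>F z\<bar> \<partial>(lborel \<Otimes>\<^sub>M lborel))"
proof -
  have [measurable]: "F \<in> borel_measurable (lborel \<Otimes>\<^sub>M lborel)" using F by auto
  show 1: "integrable (lborel \<Otimes>\<^sub>M lborel) (\<lambda>z. F (fst z - snd z, snd z))"
    using F by (simp add: integrable_iff_bounded shear_nn_integral)
  show "(\<integral>z. \<bar>F (fst z - snd z, snd z)\<bar> \<partial>(lborel \<Otimes>\<^sub>M lborel)) = (\<integral>z. \<bar>F z\<bar> \<partial>(lborel \<Otimes>\<^sub>M lborel))"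
    by (simp add: integral_eq_nn_integral shear_nn_integral)
qed

text \<open>\<open>Nop p\<close> is obtained from the tensor \<open>\<beta> (p \<otimes> p)\<close> on the square by integrating along the
  antidiagonals (gain) and along the vertical lines (loss); both operations are contractions
  from \<open>L\<^sup>1(\<real>\<^sup>2)\<close> to \<open>L\<^sup>1(\<real>)\<close>.\<close>

definition tensor :: "real \<Rightarrow> real \<Rightarrow> (real \<Rightarrow> real \<Rightarrow> real) \<Rightarrow> (real \<Rightarrow> real) \<Rightarrow> (real \<Rightarrow> real)
    \<Rightarrow> real \<times> real \<Rightarrow> real" where
  "tensor x0 x1 \<beta> p r z = indicator ({x0..x1} \<times> {x0..x1}) z * \<beta> (fst z) (snd z) * (p (fst z) * r (snd z))"

lemma Nop_eq_tensor:
  assumes "0 < x0" and x: "x \<in> {x0..x1}"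
  shows "Nop x0 x1 \<beta> p x = 1 / 2 * (\<integral>y. tensor x0 x1 \<beta> p p (x - y, y) \<partial>lborel)
     - (\<integral>y. tensor x0 x1 \<beta> p p (x, y) \<partial>lborel)"
proof -
  have "(LINT y:{x0..x - x0}|lborel. \<beta> (x - y) y * p (x - y) * p y)
      = (\<integral>y. tensor x0 x1 \<beta> p p (x - y, y) \<partial>lborel)"
    unfolding set_lebesgue_integral_def tensor_def
    by (intro Bochner_Integration.integral_cong) (use assms in \<open>auto simp: indicator_def\<close>)
  moreover have "p x * (LINT y:{x0..x1}|lborel. \<beta> x y * p y) = (\<integral>y. tensor x0 x1 \<beta> p p (x, y) \<partial>lborel)"
    unfolding set_lebesgue_integral_def tensor_def
    by (subst integral_mult_right_zero[symmetric], intro Bochner_Integration.integral_cong)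
      (use x in \<open>auto simp: indicator_def\<close>)
  ultimately show ?thesis by (simp add: Nop_def)
qed

lemma tensor_integrable:
  assumes "set_borel_measurable lborel ({x0..x1} \<times> {x0..x1}) (\<lambda>z. \<beta> (fst z) (snd z))"
    and "AE z in lborel. z \<in> {x0..x1} \<times> {x0..x1} \<longrightarrow> \<bar>\<beta> (fst z) (snd z)\<bar> \<le> B" and "B \<ge> 0"
    and p: "inH x0 x1 p" and r: "inH x0 x1 r"
  shows "integrable (lborel \<Otimes>\<^sub>M lborel) (tensor x0 x1 \<beta> p r)"
    and "(\<integral>z. \<bar>tensor x0 x1 \<beta> p r z\<bar> \<partial>(lborel \<Otimes>\<^sub>M lborel)) \<le> B * (L1norm x0 x1 p * L1norm x0 x1 r)"
proof -
  let ?P = "\<lambda>x. indicator {x0..x1} x * p x" and ?R = "\<lambda>x. indicator {x0..x1} x * r x"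
  have P: "integrable lborel ?P" "integrable lborel ?R"
    using p r by (auto simp: inH_def set_integrable_def)
  then have [measurable]: "?P \<in> borel_measurable borel" "?R \<in> borel_measurable borel"
    by (auto dest: borel_measurable_integrable)
  have [measurable]: "(\<lambda>z. indicator ({x0..x1} \<times> {x0..x1}) z * \<beta> (fst z) (snd z)) \<in> borel_measurable (lborel \<Otimes>\<^sub>M lborel)"
    using assms(1) by (simp add: set_borel_measurable_def lborel_prod)
  have eq: "tensor x0 x1 \<beta> p r = (\<lambda>z. (indicator ({x0..x1} \<times> {x0..x1}) z * \<beta> (fst z) (snd z)) * (?P (fst z) * ?R (snd z)))"
    by (auto simp: tensor_def fun_eq_iff indicator_def)
  have meas: "tensor x0 x1 \<beta> p r \<in> borel_measurable (lborel \<Otimes>\<^sub>M lborel)"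
    unfolding eq by measurable
  have int: "integrable (lborel \<Otimes>\<^sub>M lborel) (\<lambda>z. B * (?P (fst z) * ?R (snd z)))"
    by (intro integrable_mult_right integrable_tensor P)
  have bound: "AE z in lborel \<Otimes>\<^sub>M lborel. norm (tensor x0 x1 \<beta> p r z) \<le> norm (B * (?P (fst z) * ?R (snd z)))"
    using assms(2) unfolding lborel_prod
  proof eventually_elim
    case (elim z)
    then show ?case
      using \<open>B \<ge> 0\<close> by (auto simp: eq abs_mult indicator_def intro!: mult_right_mono)
  qed
  show "integrable (lborel \<Otimes>\<^sub>M lborel) (tensor x0 x1 \<beta> p r)"
    by (rule Bochner_Integration.integrable_bound[OF int meas bound])
  then have "(\<integral>z. \<bar>tensor x0 x1 \<beta> p r z\<bar> \<partial>(lborel \<Otimes>\<^sub>M lborel))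
      \<le> (\<integral>z. \<bar>B * (?P (fst z) * ?R (snd z))\<bar> \<partial>(lborel \<Otimes>\<^sub>M lborel))"
    using int bound by (intro integral_mono_AE integrable_abs) auto
  also have "\<dots> = B * (\<integral>z. \<bar>?P (fst z) * ?R (snd z)\<bar> \<partial>(lborel \<Otimes>\<^sub>M lborel))"
    using \<open>B \<ge> 0\<close> by (subst integral_mult_right_zero[symmetric]) (simp add: abs_mult)
  also have "\<dots> = B * ((\<integral>x. \<bar>?P x\<bar> \<partial>lborel) * (\<integral>x. \<bar>?R x\<bar> \<partial>lborel))"
    by (subst integrable_tensor(2)[OF P]) simp
  finally show "(\<integral>z. \<bar>tensor x0 x1 \<beta> p r z\<bar> \<partial>(lborel \<Otimes>\<^sub>M lborel)) \<le> B * (L1norm x0 x1 p * L1norm x0 x1 r)"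
    by (simp add: L1norm_def set_lebesgue_integral_def abs_mult)
qed

lemma Nop_in_H_and_lipschitz:
  assumes x0: "0 < x0"
    and \<beta>: "set_borel_measurable lborel ({x0..x1} \<times> {x0..x1}) (\<lambda>z. \<beta> (fst z) (snd z))"
      "\<exists>B. AE z in lborel. z \<in> {x0..x1} \<times> {x0..x1} \<longrightarrow> \<bar>\<beta> (fst z) (snd z)\<bar> \<le> B"
  obtains K where "K \<ge> 0" "\<And>p. inH x0 x1 p \<Longrightarrow> inH x0 x1 (Nop x0 x1 \<beta> p)"
    "\<And>p r. inH x0 x1 p \<Longrightarrow> inH x0 x1 r \<Longrightarrow>
      L1norm x0 x1 (\<lambda>x. Nop x0 x1 \<beta> p x - Nop x0 x1 \<beta> r x)
        \<le> K * (L1norm x0 x1 p + L1norm x0 x1 r) * L1norm x0 x1 (\<lambda>x. p x - r x)"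
proof -
  obtain B0 where B0: "AE z in lborel. z \<in> {x0..x1} \<times> {x0..x1} \<longrightarrow> \<bar>\<beta> (fst z) (snd z)\<bar> \<le> B0"
    using \<beta>(2) by blast
  define B where "B = max 0 B0"
  have B: "AE z in lborel. z \<in> {x0..x1} \<times> {x0..x1} \<longrightarrow> \<bar>\<beta> (fst z) (snd z)\<bar> \<le> B" "B \<ge> 0"
    using B0 by (auto simp: B_def elim!: eventually_mono)
  let ?F = "\<lambda>p. tensor x0 x1 \<beta> p p"
  let ?G = "\<lambda>F x. 1 / 2 * (\<integral>y. F (x - y, y) \<partial>lborel) - (\<integral>y. F (x, y) \<partial>lborel)"
  note F = tensor_integrable[OF \<beta>(1) B]
  have G: "integrable lborel (?G F)" if "integrable (lborel \<Otimes>\<^sub>M lborel) F" for F :: "real \<times> real \<Rightarrow> real"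
    using lborel_pair.integrable_fst'[OF that] lborel_pair.integrable_fst'[OF shear_integrable(1)[OF that]]
    by auto
  have G_bound: "(\<integral>x. \<bar>?G F x\<bar> \<partial>lborel) \<le> 3 / 2 * (\<integral>z. \<bar>F z\<bar> \<partial>(lborel \<Otimes>\<^sub>M lborel))"
    if "integrable (lborel \<Otimes>\<^sub>M lborel) F" for F :: "real \<times> real \<Rightarrow> real"
  proof -
    note i = lborel_pair.integrable_fst'[OF that] lborel_pair.integrable_fst'[OF shear_integrable(1)[OF that], simplified]
    have "(\<integral>x. \<bar>?G F x\<bar> \<partial>lborel) \<le> (\<integral>x. 1 / 2 * \<bar>\<integral>y. F (x - y, y) \<partial>lborel\<bar> + \<bar>\<integral>y. F (x, y) \<partial>lborel\<bar> \<partial>lborel)"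
      using G[OF that] i by (intro integral_mono) auto
    also have "\<dots> = 1 / 2 * (\<integral>x. \<bar>\<integral>y. F (x - y, y) \<partial>lborel\<bar> \<partial>lborel) + (\<integral>x. \<bar>\<integral>y. F (x, y) \<partial>lborel\<bar> \<partial>lborel)"
      using i by simp
    finally show ?thesis
      using integral_fst_L1_bound[OF that] integral_fst_L1_bound[OF shear_integrable(1)[OF that]]
        shear_integrable(2)[OF that] by simp
  qed
  have inH_Nop: "inH x0 x1 (Nop x0 x1 \<beta> p)" if "inH x0 x1 p" for p
  proof -
    have "integrable lborel (\<lambda>x. indicator {x0..x1} x *\<^sub>R ?G (?F p) x)"
      by (intro integrable_mult_indicator G F that) auto
    then show ?thesis
      unfolding inH_def set_integrable_def
      by (rule back_subst[of "integrable lborel"])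
         (auto simp: fun_eq_iff Nop_eq_tensor[OF x0] indicator_def)
  qed
  have "L1norm x0 x1 (\<lambda>x. Nop x0 x1 \<beta> p x - Nop x0 x1 \<beta> r x)
        \<le> 3 / 2 * B * (L1norm x0 x1 p + L1norm x0 x1 r) * L1norm x0 x1 (\<lambda>x. p x - r x)"
    if p: "inH x0 x1 p" and r: "inH x0 x1 r" for p r
  proof -
    define d where "d x = p x - r x" for x
    have d: "inH x0 x1 d" using p r unfolding inH_def d_def by (rule set_integral_diff)
    define D where "D z = tensor x0 x1 \<beta> p d z + tensor x0 x1 \<beta> d r z" for z
    have D_eq: "D z = ?F p z - ?F r z" for z
      by (simp add: D_def tensor_def d_def algebra_simps)
    have D: "integrable (lborel \<Otimes>\<^sub>M lborel) D"
      unfolding D_def by (intro Bochner_Integration.integrable_add F p r d)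
    have "AE x in lborel. x \<in> {x0..x1} \<longrightarrow> Nop x0 x1 \<beta> p x - Nop x0 x1 \<beta> r x = ?G D x"
      using lborel_pair.AE_integrable_fst'[OF F(1)[OF p p]] lborel_pair.AE_integrable_fst'[OF F(1)[OF r r]]
        lborel_pair.AE_integrable_fst'[OF shear_integrable(1)[OF F(1)[OF p p]]]
        lborel_pair.AE_integrable_fst'[OF shear_integrable(1)[OF F(1)[OF r r]]]
    proof eventually_elim
      case (elim x)
      then show ?case
        by (auto simp: Nop_eq_tensor[OF x0] D_eq field_simps)
    qed
    moreover have i: "set_integrable lborel {x0..x1} (\<lambda>x. \<bar>Nop x0 x1 \<beta> p x - Nop x0 x1 \<beta> r x\<bar>)"
      using inH_Nop[OF p] inH_Nop[OF r] by (intro set_integrable_abs set_integral_diff) (auto simp: inH_def)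
    ultimately have "L1norm x0 x1 (\<lambda>x. Nop x0 x1 \<beta> p x - Nop x0 x1 \<beta> r x) \<le> (\<integral>x. \<bar>?G D x\<bar> \<partial>lborel)"
      unfolding L1norm_def set_lebesgue_integral_def using integrable_abs[OF G[OF D]]
      by (intro integral_mono_AE) (auto simp: set_integrable_def indicator_def elim!: eventually_mono)
    also have "\<dots> \<le> 3 / 2 * (\<integral>z. \<bar>D z\<bar> \<partial>(lborel \<Otimes>\<^sub>M lborel))"
      by (rule G_bound[OF D])
    also have "(\<integral>z. \<bar>D z\<bar> \<partial>(lborel \<Otimes>\<^sub>M lborel)) \<le>
        (\<integral>z. \<bar>tensor x0 x1 \<beta> p d z\<bar> + \<bar>tensor x0 x1 \<beta> d r z\<bar> \<partial>(lborel \<Otimes>\<^sub>M lborel))"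
      using D F(1)[OF p d] F(1)[OF d r] by (intro integral_mono) (auto simp: D_def)
    also have "\<dots> \<le> B * (L1norm x0 x1 p * L1norm x0 x1 d) + B * (L1norm x0 x1 d * L1norm x0 x1 r)"
      using F[OF p d] F[OF d r] by simp
    finally show ?thesis by (simp add: d_def[abs_def] algebra_simps)
  qed
  then show ?thesis
    using that[of "3 / 2 * B"] inH_Nop B(2) by simp
qed

section \<open>The resolvent of the transport operator\<close>

lemma set_integrable_mult_continuous:
  fixes f c :: "real \<Rightarrow> real"
  assumes f: "set_integrable lborel {a..b} f" and c: "continuous_on {a..b} c"
  shows "set_integrable lborel {a..b} (\<lambda>x. f x * c x)"
proof -
  obtain B where B: "B > 0" "\<And>x. x \<in> {a..b} \<Longrightarrow> \<bar>c x\<bar> \<le> B"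
    using compact_imp_bounded[OF compact_continuous_image[OF c]] unfolding bounded_pos by auto
  have m1: "(\<lambda>x. indicator {a..b} x * f x) \<in> borel_measurable borel"
    using f by (auto simp: set_integrable_def dest: borel_measurable_integrable)
  have m2: "(\<lambda>x. indicator {a..b} x *\<^sub>R c x) \<in> borel_measurable borel"
    using c by (intro borel_measurable_continuous_on_indicator) auto
  have "(\<lambda>x. (indicator {a..b} x * f x) * (indicator {a..b} x *\<^sub>R c x)) \<in> borel_measurable lborel"
    using m1 m2 by measurable
  also have "(\<lambda>x. (indicator {a..b} x * f x) * (indicator {a..b} x *\<^sub>R c x))
      = (\<lambda>x. indicator {a..b} x *\<^sub>R (f x * c x))"
    by (auto simp: fun_eq_iff indicator_def)
  finally have m: "(\<lambda>x. indicator {a..b} x *\<^sub>R (f x * c x)) \<in> borel_measurable lborel" .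
  have "integrable lborel (\<lambda>x. B * (indicator {a..b} x * f x))"
    using f by (simp add: set_integrable_def)
  then show ?thesis
    unfolding set_integrable_def
    by (rule Bochner_Integration.integrable_bound[OF _ m])
      (use B in \<open>auto simp: indicator_def abs_mult mult.commute intro!: mult_right_mono\<close>)
qed

lemma set_integrable_Icc_subset:
  fixes f :: "real \<Rightarrow> real"
  assumes "set_integrable lborel {a..b} f" "a \<le> c" "d \<le> b"
  shows "set_integrable lborel {c..d} f"
  by (rule set_integrable_subset[OF assms(1)]) (use assms in auto)

lemma set_integral_split:
  fixes f :: "real \<Rightarrow> real"
  assumes f: "set_integrable lborel {a..b} f" and c: "a \<le> c" "c \<le> b"
  shows "(LINT x:{a..b}|lborel. f x) = (LINT x:{a..c}|lborel. f x) + (LINT x:{c..b}|lborel. f x)"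
proof -
  have "f integrable_on {a..b}" using set_borel_integral_eq_integral(1)[OF f] .
  then show ?thesis
    using set_borel_integral_eq_integral(2)[OF f]
      set_borel_integral_eq_integral(2)[OF set_integrable_Icc_subset[OF f, of a c]]
      set_borel_integral_eq_integral(2)[OF set_integrable_Icc_subset[OF f, of c b]]
      Henstock_Kurzweil_Integration.integral_combine[OF c, of f] c by simp
qed

lemma continuous_on_indefinite_set_integral:
  fixes f :: "real \<Rightarrow> real"
  assumes f: "set_integrable lborel {a..b} f"
  shows "continuous_on {a..b} (\<lambda>x. LINT y:{a..x}|lborel. f y)"
proof -
  have "continuous_on {a..b} (\<lambda>x. integral {a..x} f)"
    by (intro indefinite_integral_continuous_1 set_borel_integral_eq_integral(1)[OF f])
  then show ?thesis
    by (rule continuous_on_eq)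
      (auto simp: set_borel_integral_eq_integral(2)[OF set_integrable_Icc_subset[OF f]])
qed

lemma continuous_on_indefinite_set_integral_upper:
  fixes f :: "real \<Rightarrow> real"
  assumes f: "set_integrable lborel {a..b} f"
  shows "continuous_on {a..b} (\<lambda>x. LINT y:{x..b}|lborel. f y)"
proof -
  have "continuous_on {a..b} (\<lambda>x. (LINT y:{a..b}|lborel. f y) - (LINT y:{a..x}|lborel. f y))"
    by (intro continuous_intros continuous_on_indefinite_set_integral f)
  then show ?thesis
    by (rule continuous_on_eq) (auto simp: set_integral_split[OF f])
qed

lemma triangle_fubini:
  fixes \<nu> k :: "real \<Rightarrow> real"
  assumes \<nu>: "set_integrable lborel {a..b} \<nu>" and k: "set_integrable lborel {a..b} k"
  shows "(LINT s:{a..b}|lborel. \<nu> s * (LINT t:{a..s}|lborel. k t))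
       = (LINT t:{a..b}|lborel. k t * (LINT s:{t..b}|lborel. \<nu> s))"
proof -
  define F where "F s t = indicator {z. snd z \<le> fst z} (s, t) *\<^sub>R
      ((indicator {a..b} s * \<nu> s) * (indicator {a..b} t * k t))" for s t :: real
  have "{z::real \<times> real. snd z \<le> fst z} \<in> sets (lborel \<Otimes>\<^sub>M lborel)"
    unfolding lborel_prod sets_lborel by (intro borel_closed closed_Collect_le continuous_intros)
  then have "integrable (lborel \<Otimes>\<^sub>M lborel) (\<lambda>z. indicator {z. snd z \<le> fst z} z *\<^sub>R
      ((indicator {a..b} (fst z) * \<nu> (fst z)) * (indicator {a..b} (snd z) * k (snd z))))"
    using \<nu> k by (intro integrable_mult_indicator integrable_tensor) (simp_all add: set_integrable_def)
  then have "integrable (lborel \<Otimes>\<^sub>M lborel) (case_prod F)"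
    by (simp add: F_def case_prod_beta')
  then have "(\<integral>t. \<integral>s. F s t \<partial>lborel \<partial>lborel) = (\<integral>s. \<integral>t. F s t \<partial>lborel \<partial>lborel)"
    by (rule lborel_pair.Fubini_integral)
  moreover have "(\<integral>s. F s t \<partial>lborel) = indicator {a..b} t *\<^sub>R (k t * (LINT s:{t..b}|lborel. \<nu> s))" for t
  proof -
    have "(\<integral>s. F s t \<partial>lborel) = (\<integral>s. (indicator {a..b} t * k t) * (indicator {t..b} s *\<^sub>R \<nu> s) \<partial>lborel)"
      by (intro Bochner_Integration.integral_cong) (auto simp: F_def indicator_def)
    then show ?thesis by (simp add: set_lebesgue_integral_def)
  qed
  moreover have "(\<integral>t. F s t \<partial>lborel) = indicator {a..b} s *\<^sub>R (\<nu> s * (LINT t:{a..s}|lborel. k t))" for s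
  proof -
    have "(\<integral>t. F s t \<partial>lborel) = (\<integral>t. (indicator {a..b} s * \<nu> s) * (indicator {a..s} t *\<^sub>R k t) \<partial>lborel)"
      by (intro Bochner_Integration.integral_cong) (auto simp: F_def indicator_def)
    then show ?thesis by (simp add: set_lebesgue_integral_def)
  qed
  ultimately show ?thesis by (simp add: set_lebesgue_integral_def)
qed

lemma set_integral_FTC:
  fixes F f :: "real \<Rightarrow> real"
  assumes "\<And>x. x \<in> {x0..x1} \<Longrightarrow> (F has_real_derivative f x) (at x within {x0..x1})"
    and "continuous_on {x0..x1} f" and "x0 \<le> a" "a \<le> b" "b \<le> x1"
  shows "(LINT x:{a..b}|lborel. f x) = F b - F a"
proof -
  have "continuous_on {a..b} f" by (rule continuous_on_subset[OF assms(2)]) (use assms in auto)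
  moreover have "(F has_vector_derivative f x) (at x within {a..b})" if "a \<le> x" "x \<le> b" for x
    unfolding has_real_derivative_iff_has_vector_derivative[symmetric]
    by (rule DERIV_subset[OF assms(1)]) (use assms that in auto)
  ultimately show ?thesis
    unfolding set_lebesgue_integral_def using assms by (intro integral_FTC_Icc) auto
qed

lemma set_integral_abs_le:
  fixes h k :: "'a \<Rightarrow> real"
  assumes h: "set_borel_measurable M A h" and k: "set_integrable M A k"
    and hk: "AE x in M. x \<in> A \<longrightarrow> \<bar>h x\<bar> \<le> k x"
  shows "\<bar>LINT x:A|M. h x\<bar> \<le> (LINT x:A|M. k x)"
proof -
  have le: "AE x in M. norm (indicator A x *\<^sub>R h x) \<le> indicator A x *\<^sub>R k x"
    using hk by eventually_elim (auto simp: indicator_def)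
  then have "integrable M (\<lambda>x. indicator A x *\<^sub>R h x)"
    using h k unfolding set_integrable_def set_borel_measurable_def
    by (elim Bochner_Integration.integrable_bound) (auto elim!: eventually_mono)
  then have "(\<integral>x. norm (indicator A x *\<^sub>R h x) \<partial>M) \<le> (\<integral>x. indicator A x *\<^sub>R k x \<partial>M)"
    using k le by (intro integral_mono_AE integrable_norm) (auto simp: set_integrable_def)
  with integral_norm_bound[of M "\<lambda>x. indicator A x *\<^sub>R h x"]
  have "norm (\<integral>x. indicator A x *\<^sub>R h x \<partial>M) \<le> (\<integral>x. indicator A x *\<^sub>R k x \<partial>M)"
    by (rule order_trans)
  then show ?thesis by (simp add: set_lebesgue_integral_def)
qed

locale transport =
  fixes x0 x1 :: real and g w q :: "real \<Rightarrow> real"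
  assumes x01: "x0 < x1"
    and g_cont: "continuous_on {x0..x1} g" and g_pos: "\<And>x. x \<in> {x0..x1} \<Longrightarrow> g x > 0"
    and w_cont: "continuous_on {x0..x1} w"
    and q_meas: "set_borel_measurable lborel {x0..x1} q"
    and q_bdd: "\<exists>B. AE x in lborel. x \<in> {x0..x1} \<longrightarrow> \<bar>q x\<bar> \<le> B"
    and q_nonneg: "AE x in lborel. x \<in> {x0..x1} \<longrightarrow> q x \<ge> 0"
begin

text \<open>A solution of \<open>(g \<phi>)' + (w + m) \<phi> = 0\<close> is a multiple of \<open>E m / g\<close>, so \<open>chi m = 1\<close> is the
  characteristic equation for \<open>m\<close> to be an eigenvalue of the generator.\<close>

definition E :: "real \<Rightarrow> real \<Rightarrow> real" where
  "E m x = exp (- (LINT s:{x0..x}|lborel. (w s + m) / g s))"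

definition chi :: "real \<Rightarrow> real" where
  "chi m = (LINT x:{x0..x1}|lborel. q x / g x * E m x)"

lemma g_nz: "x \<in> {x0..x1} \<Longrightarrow> g x \<noteq> 0"
  using g_pos[of x] by auto

lemma E_pos: "E m x > 0" by (simp add: E_def)

lemma E_nz: "E m x \<noteq> 0" by (simp add: E_def)

lemma rate_cont: "continuous_on {x0..x1} (\<lambda>s. (w s + m) / g s)"
  using g_nz by (intro continuous_intros w_cont g_cont) auto

lemma rate_integrable: "set_integrable lborel {x0..x1} (\<lambda>s. (w s + m) / g s)"
  by (rule borel_integrable_atLeastAtMost'[OF rate_cont])

lemma E_x0: "E m x0 = 1"
proof -
  have "(LINT s:{x0..x0}|lborel. (w s + m) / g s) = 0"
    using set_borel_integral_eq_integral(2)[OF set_integrable_Icc_subset[OF rate_integrable, of x0 x0 m]] x01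
    by simp
  then show ?thesis by (simp add: E_def)
qed

lemma E_deriv:
  assumes x: "x \<in> {x0..x1}"
  shows "(E m has_real_derivative - ((w x + m) / g x) * E m x) (at x within {x0..x1})"
proof -
  have "((\<lambda>x. integral {x0..x} (\<lambda>s. (w s + m) / g s)) has_real_derivative (w x + m) / g x) (at x within {x0..x1})"
    by (rule integral_has_real_derivative[OF rate_cont x])
  then have "((\<lambda>x. exp (- integral {x0..x} (\<lambda>s. (w s + m) / g s))) has_real_derivative
      exp (- integral {x0..x} (\<lambda>s. (w s + m) / g s)) * - ((w x + m) / g x)) (at x within {x0..x1})"
    by (auto intro!: derivative_eq_intros)
  moreover have "E m y = exp (- integral {x0..y} (\<lambda>s. (w s + m) / g s))" if "y \<in> {x0..x1}" for y
    using that set_borel_integral_eq_integral(2)[OF set_integrable_Icc_subset[OF rate_integrable, of x0 y m]]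
    by (simp add: E_def)
  ultimately show ?thesis
    unfolding has_field_derivative_def using x
    by (rule_tac has_derivative_transform[OF x, where f="\<lambda>y. exp (- integral {x0..y} (\<lambda>s. (w s + m) / g s))"])
      (simp_all add: mult.commute)
qed

lemma E_cont: "continuous_on {x0..x1} (E m)"
  by (rule DERIV_continuous_on[OF E_deriv])

lemma q_integrable: "set_integrable lborel {x0..x1} q"
proof -
  obtain B where B: "AE x in lborel. x \<in> {x0..x1} \<longrightarrow> \<bar>q x\<bar> \<le> B" using q_bdd by blast
  have "integrable lborel (\<lambda>x. indicator {x0..x1} x *\<^sub>R B)"
    unfolding set_integrable_def[symmetric] by (rule borel_integrable_atLeastAtMost') simp
  then show ?thesis
    unfolding set_integrable_def
  proof (rule Bochner_Integration.integrable_bound)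
    show "(\<lambda>x. indicator {x0..x1} x *\<^sub>R q x) \<in> borel_measurable lborel"
      using q_meas by (simp add: set_borel_measurable_def)
    show "AE x in lborel. norm (indicator {x0..x1} x *\<^sub>R q x) \<le> norm (indicator {x0..x1} x *\<^sub>R B)"
      using B by eventually_elim (auto simp: indicator_def)
  qed
qed

definition nu :: "real \<Rightarrow> real \<Rightarrow> real" where
  "nu m x = q x / g x * E m x"

lemma nu_integrable: "set_integrable lborel {x0..x1} (nu m)"
proof -
  have "set_integrable lborel {x0..x1} (\<lambda>x. q x * (E m x / g x))"
    using g_nz by (intro set_integrable_mult_continuous q_integrable continuous_intros E_cont g_cont) auto
  then show ?thesis unfolding nu_def[abs_def] by simp
qed

lemma nu_nonneg: "AE x in lborel. x \<in> {x0..x1} \<longrightarrow> nu m x \<ge> 0"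
  using q_nonneg by eventually_elim (auto simp: nu_def less_imp_le[OF E_pos] less_imp_le[OF g_pos])

lemma chi_nu: "chi m = (LINT x:{x0..x1}|lborel. nu m x)"
  by (simp add: chi_def nu_def)

text \<open>If \<open>chi m < 1\<close>, the weight \<open>V m = Q m / E m\<close> (below) is a strictly positive subsolution of
  the adjoint problem: it satisfies \<open>g V' - w V + q V(x0) = m V\<close> with \<open>V(x0) = 1\<close>, but
  \<open>V(x1) > 0\<close> instead of \<open>V(x1) = 0\<close>.\<close>

definition Q :: "real \<Rightarrow> real \<Rightarrow> real" where
  "Q m x = 1 - chi m + (LINT s:{x..x1}|lborel. nu m s)"

lemma Q_cont: "continuous_on {x0..x1} (Q m)"
  unfolding Q_def[abs_def]
  by (intro continuous_intros continuous_on_indefinite_set_integral_upper nu_integrable)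

lemma Q_x0: "Q m x0 = 1"
  by (simp add: Q_def chi_nu)

lemma Q_lower: "Q m x \<ge> 1 - chi m" if "x \<in> {x0..x1}"
proof -
  have "(LINT s:{x..x1}|lborel. nu m s) \<ge> (LINT s:{x..x1}|lborel. 0)"
    using that nu_nonneg[of m]
    by (intro set_integral_mono_AE set_integrable_Icc_subset[OF nu_integrable])
       (auto simp: set_integrable_def elim!: eventually_mono)
  then show ?thesis by (simp add: Q_def set_lebesgue_integral_def)
qed

lemma Q_ratio_bound:
  assumes y: "y \<in> {x0..x1}" and chi: "chi \<omega> < 1"
  shows "(\<mu> - \<omega>) * (LINT x:{y..x1}|lborel. Q \<omega> x * (E \<mu> x / E \<omega> x) / g x) + (LINT s:{y..x1}|lborel. nu \<mu> s)
    \<le> Q \<omega> y * (E \<mu> y / E \<omega> y)"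
proof -
  define K where "K x = E \<mu> x / E \<omega> x" for x
  define \<kappa> where "\<kappa> x = (\<mu> - \<omega>) / g x * K x" for x
  have K_pos: "K x > 0" for x by (simp add: K_def E_pos)
  have K_cont: "continuous_on {x0..x1} K"
    unfolding K_def by (intro continuous_intros E_cont ballI E_nz)
  have \<kappa>_cont: "continuous_on {x0..x1} \<kappa>"
    unfolding \<kappa>_def using g_nz by (intro continuous_intros g_cont K_cont) auto
  have dK: "(K has_real_derivative - \<kappa> x) (at x within {x0..x1})" if "x \<in> {x0..x1}" for x
    unfolding K_def
    by (rule derivative_eq_intros E_deriv that)+
      (use E_pos[of \<omega> x] g_nz[OF that] in \<open>auto simp: \<kappa>_def K_def field_simps power2_eq_square\<close>)
  have int_\<kappa>: "(LINT t:{a..b}|lborel. \<kappa> t) = K a - K b" if "x0 \<le> a" "a \<le> b" "b \<le> x1" for a b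
  proof -
    have "((\<lambda>x. - K x) has_real_derivative \<kappa> x) (at x within {x0..x1})" if "x \<in> {x0..x1}" for x
      using DERIV_minus[OF dK[OF that]] by simp
    from set_integral_FTC[OF this \<kappa>_cont that] show ?thesis by simp
  qed
  have sub: "{y..x1} \<subseteq> {x0..x1}" using y by auto
  have \<nu>i: "set_integrable lborel {y..x1} (nu \<omega>)"
    using y by (intro set_integrable_Icc_subset[OF nu_integrable]) auto
  have \<kappa>i: "set_integrable lborel {y..x1} \<kappa>"
    by (rule borel_integrable_atLeastAtMost'[OF continuous_on_subset[OF \<kappa>_cont sub]])
  have \<nu>K: "nu \<omega> x * K x = nu \<mu> x" for x
    using E_pos[of \<omega> x] by (simp add: nu_def K_def)
  have "(\<mu> - \<omega>) * (LINT x:{y..x1}|lborel. Q \<omega> x * K x / g x) = (LINT x:{y..x1}|lborel. (\<mu> - \<omega>) * (Q \<omega> x * K x / g x))"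
    by (rule set_integral_mult_right[symmetric])
  also have "\<dots> = (LINT x:{y..x1}|lborel. (1 - chi \<omega>) * \<kappa> x + \<kappa> x * (LINT s:{x..x1}|lborel. nu \<omega> s))"
    by (rule arg_cong[where f="set_lebesgue_integral lborel {y..x1}"])
       (simp add: fun_eq_iff Q_def \<kappa>_def field_simps add_divide_distrib diff_divide_distrib)
  also have "\<dots> = (1 - chi \<omega>) * (LINT x:{y..x1}|lborel. \<kappa> x)
      + (LINT x:{y..x1}|lborel. \<kappa> x * (LINT s:{x..x1}|lborel. nu \<omega> s))"
    using \<kappa>i set_integrable_mult_continuous[OF \<kappa>i continuous_on_indefinite_set_integral_upper[OF \<nu>i]]
    by (subst set_integral_add) auto
  also have "(LINT x:{y..x1}|lborel. \<kappa> x * (LINT s:{x..x1}|lborel. nu \<omega> s))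
      = (LINT s:{y..x1}|lborel. nu \<omega> s * (LINT t:{y..s}|lborel. \<kappa> t))"
    by (rule triangle_fubini[OF \<nu>i \<kappa>i, symmetric])
  also have "\<dots> = (LINT s:{y..x1}|lborel. K y * nu \<omega> s - nu \<mu> s)"
    using y by (intro set_lebesgue_integral_cong) (auto simp: int_\<kappa> algebra_simps simp flip: \<nu>K)
  also have "\<dots> = K y * (LINT s:{y..x1}|lborel. nu \<omega> s) - (LINT s:{y..x1}|lborel. nu \<mu> s)"
    using \<nu>i set_integrable_Icc_subset[OF nu_integrable, of y x1 \<mu>] y
    by (subst set_integral_diff) auto
  also have "(LINT x:{y..x1}|lborel. \<kappa> x) = K y - K x1"
    using y by (intro int_\<kappa>) auto
  finally have "(\<mu> - \<omega>) * (LINT x:{y..x1}|lborel. Q \<omega> x * K x / g x) + (LINT s:{y..x1}|lborel. nu \<mu> s)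
      = Q \<omega> y * K y - (1 - chi \<omega>) * K x1"
    by (simp add: Q_def algebra_simps)
  moreover have "(1 - chi \<omega>) * K x1 \<ge> 0" using chi K_pos[of x1] by simp
  ultimately show ?thesis by (simp add: K_def)
qed

lemma resolvent_formula:
  assumes \<rho>: "set_integrable lborel {x0..x1} \<rho>" and f: "set_integrable lborel {x0..x1} f"
    and G: "\<And>x. G x = c + (LINT y:{x0..x}|lborel. \<rho> y)"
    and eq: "AE x in lborel. x \<in> {x0..x1} \<longrightarrow> f x = \<rho> x + (w x + \<mu>) / g x * G x"
    and x: "x \<in> {x0..x1}"
  shows "G x / E \<mu> x = c + (LINT y:{x0..x}|lborel. f y / E \<mu> y)"
proof -
  define k where "k x = 1 / E \<mu> x" for x
  define k' where "k' x = (w x + \<mu>) / g x * k x" for x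
  have k_cont: "continuous_on {x0..x1} k"
    unfolding k_def by (intro continuous_intros E_cont ballI E_nz)
  have k'_cont: "continuous_on {x0..x1} k'"
    unfolding k'_def by (intro continuous_intros rate_cont k_cont)
  have dk: "(k has_real_derivative k' y) (at y within {x0..x1})" if "y \<in> {x0..x1}" for y
    unfolding k_def using E_pos[of \<mu> y] g_nz[OF that]
    by (intro DERIV_divide[OF DERIV_const E_deriv[OF that], THEN DERIV_cong])
      (auto simp: k'_def k_def field_simps)
  have int_k': "(LINT t:{a..b}|lborel. k' t) = k b - k a" if "x0 \<le> a" "a \<le> b" "b \<le> x1" for a b
    by (rule set_integral_FTC[OF dk k'_cont that])
  have sub: "{x0..x} \<subseteq> {x0..x1}" using x by auto
  have \<rho>i: "set_integrable lborel {x0..x} \<rho>" and fi: "set_integrable lborel {x0..x} f"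
    using x by (auto intro: set_integrable_Icc_subset[OF \<rho>] set_integrable_Icc_subset[OF f])
  have k'i: "set_integrable lborel {x0..x} k'"
    by (rule borel_integrable_atLeastAtMost'[OF continuous_on_subset[OF k'_cont sub]])
  have \<rho>k: "set_integrable lborel {x0..x} (\<lambda>y. \<rho> y * k y)" and fk: "set_integrable lborel {x0..x} (\<lambda>y. f y * k y)"
    using k_cont sub by (auto intro!: set_integrable_mult_continuous \<rho>i fi intro: continuous_on_subset)
  have G_cont: "continuous_on {x0..x} G"
    unfolding G[abs_def] by (intro continuous_intros continuous_on_indefinite_set_integral \<rho>i)
  have k'G: "set_integrable lborel {x0..x} (\<lambda>y. k' y * G y)"
    by (rule set_integrable_mult_continuous[OF k'i G_cont])
  have "(LINT y:{x0..x}|lborel. f y * k y) = (LINT y:{x0..x}|lborel. \<rho> y * k y + k' y * G y)"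
    unfolding set_lebesgue_integral_def
  proof (rule integral_cong_AE)
    show "(\<lambda>y. indicator {x0..x} y *\<^sub>R (f y * k y)) \<in> borel_measurable lborel"
      using fk by (auto simp: set_integrable_def)
    show "(\<lambda>y. indicator {x0..x} y *\<^sub>R (\<rho> y * k y + k' y * G y)) \<in> borel_measurable lborel"
      using set_integral_add(1)[OF \<rho>k k'G] by (auto simp: set_integrable_def)
    show "AE y in lborel. indicator {x0..x} y *\<^sub>R (f y * k y) = indicator {x0..x} y *\<^sub>R (\<rho> y * k y + k' y * G y)"
      using eq by eventually_elim (use x in \<open>auto simp: indicator_def k'_def algebra_simps\<close>)
  qed
  also have "\<dots> = (LINT y:{x0..x}|lborel. \<rho> y * k y) + (LINT y:{x0..x}|lborel. k' y * G y)"
    by (rule set_integral_add(2)[OF \<rho>k k'G])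
  also have "(LINT y:{x0..x}|lborel. k' y * G y)
      = (LINT y:{x0..x}|lborel. c * k' y + k' y * (LINT z:{x0..y}|lborel. \<rho> z))"
    by (simp add: G algebra_simps)
  also have "\<dots> = c * (LINT y:{x0..x}|lborel. k' y) + (LINT y:{x0..x}|lborel. k' y * (LINT z:{x0..y}|lborel. \<rho> z))"
    using k'i set_integrable_mult_continuous[OF k'i continuous_on_indefinite_set_integral[OF \<rho>i]]
    by (subst set_integral_add) auto
  also have "(LINT y:{x0..x}|lborel. k' y * (LINT z:{x0..y}|lborel. \<rho> z))
      = (LINT z:{x0..x}|lborel. \<rho> z * (LINT y:{z..x}|lborel. k' y))"
    by (rule triangle_fubini[OF k'i \<rho>i])
  also have "\<dots> = (LINT z:{x0..x}|lborel. k x * \<rho> z - \<rho> z * k z)"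
    using x by (intro set_lebesgue_integral_cong) (auto simp: int_k' algebra_simps)
  also have "\<dots> = k x * (LINT z:{x0..x}|lborel. \<rho> z) - (LINT z:{x0..x}|lborel. \<rho> z * k z)"
    using \<rho>i \<rho>k by (subst set_integral_diff) auto
  also have "(LINT y:{x0..x}|lborel. k' y) = k x - k x0"
    using x by (intro int_k') auto
  finally have "(LINT y:{x0..x}|lborel. f y * k y) = c * (k x - k x0) + k x * (LINT z:{x0..x}|lborel. \<rho> z)"
    by simp
  then show ?thesis
    by (simp add: G k_def E_x0 diff_divide_distrib add_divide_distrib right_diff_distrib)
qed

definition V :: "real \<Rightarrow> real \<Rightarrow> real" where
  "V m x = Q m x / E m x"

lemma V_cont: "continuous_on {x0..x1} (V m)"
  unfolding V_def[abs_def] by (intro continuous_intros Q_cont E_cont ballI E_nz)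

lemma V_pos: "chi m < 1 \<Longrightarrow> x \<in> {x0..x1} \<Longrightarrow> V m x > 0"
  using Q_lower[of x m] E_pos[of m x] by (simp add: V_def)

lemma resolvent_estimate:
  assumes chi: "chi \<omega> < 1" and L: "gen_L x0 x1 g q w \<phi> \<psi>" and \<mu>: "\<mu> > \<omega>"
  shows "(\<mu> - \<omega>) * (LINT x:{x0..x1}|lborel. V \<omega> x * \<bar>\<phi> x\<bar>)
    \<le> (LINT x:{x0..x1}|lborel. V \<omega> x * \<bar>\<mu> * \<phi> x - \<psi> x\<bar>)"
proof -
  obtain c \<rho> where \<rho>: "set_integrable lborel {x0..x1} \<rho>"
    and g\<phi>: "AE x in lborel. x \<in> {x0..x1} \<longrightarrow> g x * \<phi> x = c + (LINT y:{x0..x}|lborel. \<rho> y)"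
    and c: "c = (LINT x:{x0..x1}|lborel. q x * \<phi> x)"
    and \<psi>: "AE x in lborel. x \<in> {x0..x1} \<longrightarrow> \<psi> x = - \<rho> x - w x * \<phi> x"
    and \<phi>i: "set_integrable lborel {x0..x1} \<phi>" and \<psi>i: "set_integrable lborel {x0..x1} \<psi>"
    using L unfolding gen_L_def inH_def by blast
  define G where "G x = c + (LINT y:{x0..x}|lborel. \<rho> y)" for x
  define f where "f x = \<mu> * \<phi> x - \<psi> x" for x
  have fi: "set_integrable lborel {x0..x1} f"
    unfolding f_def using \<phi>i \<psi>i by (intro set_integral_diff) auto
  have f_eq: "AE x in lborel. x \<in> {x0..x1} \<longrightarrow> f x = \<rho> x + (w x + \<mu>) / g x * G x"
    using g\<phi> \<psi>
  proof eventually_elim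
    case (elim x)
    show ?case
    proof
      assume x: "x \<in> {x0..x1}"
      then have "\<phi> x = G x / g x" using elim g_nz[OF x] by (simp add: G_def field_simps)
      then show "f x = \<rho> x + (w x + \<mu>) / g x * G x"
        using elim x by (simp add: f_def algebra_simps add_divide_distrib)
    qed
  qed
  define a where "a y = \<bar>f y\<bar> / E \<mu> y" for y
  have ai: "set_integrable lborel {x0..x1} a"
  proof -
    have "set_integrable lborel {x0..x1} (\<lambda>y. \<bar>f y\<bar> * (1 / E \<mu> y))"
      by (intro set_integrable_mult_continuous set_integrable_abs fi continuous_intros E_cont ballI E_nz)
    then show ?thesis by (simp add: a_def[abs_def])
  qed
  define H where "H x = \<bar>c\<bar> + (LINT y:{x0..x}|lborel. a y)" for x
  have H_cont: "continuous_on {x0..x1} H"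
    unfolding H_def by (intro continuous_intros continuous_on_indefinite_set_integral ai)
  have G_le: "\<bar>G x\<bar> \<le> E \<mu> x * H x" if x: "x \<in> {x0..x1}" for x
  proof -
    have "\<bar>LINT y:{x0..x}|lborel. f y / E \<mu> y\<bar> \<le> (LINT y:{x0..x}|lborel. a y)"
    proof (rule set_integral_abs_le)
      have "set_integrable lborel {x0..x1} (\<lambda>y. f y * (1 / E \<mu> y))"
        by (intro set_integrable_mult_continuous fi continuous_intros E_cont ballI E_nz)
      then have "set_integrable lborel {x0..x} (\<lambda>y. f y / E \<mu> y)"
        using x by (auto intro: set_integrable_Icc_subset)
      then show "set_borel_measurable lborel {x0..x} (\<lambda>y. f y / E \<mu> y)"
        unfolding set_integrable_def set_borel_measurable_def by (rule borel_measurable_integrable)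
      show "set_integrable lborel {x0..x} a"
        using x by (auto intro: set_integrable_Icc_subset[OF ai])
      show "AE y in lborel. y \<in> {x0..x} \<longrightarrow> \<bar>f y / E \<mu> y\<bar> \<le> a y"
        by (simp add: a_def abs_of_pos[OF E_pos])
    qed
    then have "\<bar>G x / E \<mu> x\<bar> \<le> H x"
      using resolvent_formula[OF \<rho> fi G_def f_eq x] unfolding H_def by linarith
    then show ?thesis using E_pos[of \<mu> x] by (simp add: field_simps)
  qed
  have \<phi>_le: "AE x in lborel. x \<in> {x0..x1} \<longrightarrow> \<bar>\<phi> x\<bar> \<le> E \<mu> x / g x * H x"
    using g\<phi>
  proof eventually_elim
    case (elim x)
    show ?case
    proof
      assume x: "x \<in> {x0..x1}"
      have "\<bar>G x\<bar> = \<bar>g x * \<phi> x\<bar>" using elim x by (simp add: G_def)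
      then have "g x * \<bar>\<phi> x\<bar> = \<bar>G x\<bar>"
        using g_pos[OF x] by (simp add: abs_mult)
      then show "\<bar>\<phi> x\<bar> \<le> E \<mu> x / g x * H x"
        using G_le[OF x] g_pos[OF x] by (simp add: field_simps)
    qed
  qed
  have swap: "(LINT x:{x0..x1}|lborel. m x * H x)
      = \<bar>c\<bar> * (LINT x:{x0..x1}|lborel. m x) + (LINT y:{x0..x1}|lborel. a y * (LINT x:{y..x1}|lborel. m x))"
    if m: "set_integrable lborel {x0..x1} m" for m
  proof -
    have "(LINT x:{x0..x1}|lborel. m x * H x)
        = (LINT x:{x0..x1}|lborel. \<bar>c\<bar> * m x + m x * (LINT y:{x0..x}|lborel. a y))"
      by (simp add: H_def algebra_simps)
    also have "\<dots> = \<bar>c\<bar> * (LINT x:{x0..x1}|lborel. m x) + (LINT x:{x0..x1}|lborel. m x * (LINT y:{x0..x}|lborel. a y))"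
      using m set_integrable_mult_continuous[OF m continuous_on_indefinite_set_integral[OF ai]]
      by (subst set_integral_add) auto
    finally show ?thesis by (simp add: triangle_fubini[OF m ai])
  qed
  define M where "M x = Q \<omega> x * (E \<mu> x / E \<omega> x) / g x" for x
  have M_cont: "continuous_on {x0..x1} M"
    unfolding M_def using g_nz by (intro continuous_intros Q_cont E_cont g_cont ballI E_nz) auto
  have Mi: "set_integrable lborel {x0..x1} M"
    by (rule borel_integrable_atLeastAtMost'[OF M_cont])
  define A where "A y = (LINT x:{y..x1}|lborel. M x)" for y
  define B where "B y = (LINT x:{y..x1}|lborel. nu \<mu> x)" for y
  have AB_cont: "continuous_on {x0..x1} A" "continuous_on {x0..x1} B"
    unfolding A_def B_def by (intro continuous_on_indefinite_set_integral_upper Mi nu_integrable)+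
  have aA: "set_integrable lborel {x0..x1} (\<lambda>y. a y * A y)" and aB: "set_integrable lborel {x0..x1} (\<lambda>y. a y * B y)"
    by (intro set_integrable_mult_continuous ai AB_cont)+
  have V\<phi>: "(LINT x:{x0..x1}|lborel. V \<omega> x * \<bar>\<phi> x\<bar>) \<le> \<bar>c\<bar> * A x0 + (LINT y:{x0..x1}|lborel. a y * A y)"
  proof -
    have "(LINT x:{x0..x1}|lborel. V \<omega> x * \<bar>\<phi> x\<bar>) \<le> (LINT x:{x0..x1}|lborel. M x * H x)"
    proof (rule set_integral_mono_AE)
      show "set_integrable lborel {x0..x1} (\<lambda>x. V \<omega> x * \<bar>\<phi> x\<bar>)"
        using set_integrable_mult_continuous[OF set_integrable_abs[OF \<phi>i] V_cont] by (simp add: mult.commute)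
      show "set_integrable lborel {x0..x1} (\<lambda>x. M x * H x)"
        by (rule set_integrable_mult_continuous[OF Mi H_cont])
      show "AE x\<in>{x0..x1} in lborel. V \<omega> x * \<bar>\<phi> x\<bar> \<le> M x * H x"
        using \<phi>_le
      proof eventually_elim
        case (elim x)
        show ?case
        proof
          assume x: "x \<in> {x0..x1}"
          have "V \<omega> x * \<bar>\<phi> x\<bar> \<le> V \<omega> x * (E \<mu> x / g x * H x)"
            using elim x V_pos[OF chi x] by (intro mult_left_mono) auto
          then show "V \<omega> x * \<bar>\<phi> x\<bar> \<le> M x * H x" by (simp add: V_def M_def mult_ac)
        qed
      qed
    qed
    then show ?thesis by (simp add: swap[OF Mi] A_def)
  qed
  have c_le: "\<bar>c\<bar> \<le> \<bar>c\<bar> * B x0 + (LINT y:{x0..x1}|lborel. a y * B y)"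
  proof -
    have "\<bar>LINT x:{x0..x1}|lborel. q x * \<phi> x\<bar> \<le> (LINT x:{x0..x1}|lborel. nu \<mu> x * H x)"
    proof (rule set_integral_abs_le)
      have "(\<lambda>x. (indicator {x0..x1} x *\<^sub>R q x) * (indicator {x0..x1} x *\<^sub>R \<phi> x)) \<in> borel_measurable lborel"
        using q_meas \<phi>i unfolding set_borel_measurable_def set_integrable_def
        by (intro borel_measurable_times) auto
      also have "(\<lambda>x. (indicator {x0..x1} x *\<^sub>R q x) * (indicator {x0..x1} x *\<^sub>R \<phi> x))
          = (\<lambda>x. indicator {x0..x1} x *\<^sub>R (q x * \<phi> x))"
        by (auto simp: fun_eq_iff indicator_def)
      finally show "set_borel_measurable lborel {x0..x1} (\<lambda>x. q x * \<phi> x)"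
        by (simp add: set_borel_measurable_def)
      show "set_integrable lborel {x0..x1} (\<lambda>x. nu \<mu> x * H x)"
        by (rule set_integrable_mult_continuous[OF nu_integrable H_cont])
      show "AE x in lborel. x \<in> {x0..x1} \<longrightarrow> \<bar>q x * \<phi> x\<bar> \<le> nu \<mu> x * H x"
        using \<phi>_le q_nonneg
      proof eventually_elim
        case (elim x)
        show ?case
        proof
          assume x: "x \<in> {x0..x1}"
          have "q x * \<bar>\<phi> x\<bar> \<le> q x * (E \<mu> x / g x * H x)"
            using elim x by (intro mult_left_mono) auto
          then show "\<bar>q x * \<phi> x\<bar> \<le> nu \<mu> x * H x"
            using elim x by (simp add: nu_def mult_ac abs_mult)
        qed
      qed
    qed
    then show ?thesis by (simp add: swap[OF nu_integrable] B_def c)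
  qed
  have key: "(\<mu> - \<omega>) * A y \<le> Q \<omega> y * (E \<mu> y / E \<omega> y) - B y" if "y \<in> {x0..x1}" for y
    using Q_ratio_bound[OF that chi, of \<mu>] by (simp add: A_def B_def M_def)
  have key0: "(\<mu> - \<omega>) * A x0 \<le> 1 - B x0"
    using key[of x0] x01 by (simp add: Q_x0 E_x0)
  have Vf: "set_integrable lborel {x0..x1} (\<lambda>y. V \<omega> y * \<bar>f y\<bar>)"
    using set_integrable_mult_continuous[OF set_integrable_abs[OF fi] V_cont] by (simp add: mult.commute)
  have "(\<mu> - \<omega>) * (LINT x:{x0..x1}|lborel. V \<omega> x * \<bar>\<phi> x\<bar>)
      \<le> (\<mu> - \<omega>) * (\<bar>c\<bar> * A x0 + (LINT y:{x0..x1}|lborel. a y * A y))"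
    using \<mu> V\<phi> by (intro mult_left_mono) auto
  also have "\<dots> = \<bar>c\<bar> * ((\<mu> - \<omega>) * A x0) + (LINT y:{x0..x1}|lborel. (\<mu> - \<omega>) * (a y * A y))"
    by (simp add: distrib_left mult.left_commute[of "\<bar>c\<bar>"])
  also have "\<dots> \<le> \<bar>c\<bar> * (1 - B x0) + (LINT y:{x0..x1}|lborel. V \<omega> y * \<bar>f y\<bar> - a y * B y)"
  proof (intro add_mono mult_left_mono key0 set_integral_mono)
    show "set_integrable lborel {x0..x1} (\<lambda>y. (\<mu> - \<omega>) * (a y * A y))" using aA by simp
    show "set_integrable lborel {x0..x1} (\<lambda>y. V \<omega> y * \<bar>f y\<bar> - a y * B y)"
      by (rule set_integral_diff(1)[OF Vf aB])
    fix y assume y: "y \<in> {x0..x1}"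
    have "a y * ((\<mu> - \<omega>) * A y) \<le> a y * (Q \<omega> y * (E \<mu> y / E \<omega> y) - B y)"
      using key[OF y] E_pos[of \<mu> y] by (intro mult_left_mono) (auto simp: a_def)
    also have "\<dots> = V \<omega> y * \<bar>f y\<bar> - a y * B y"
      using E_pos[of \<mu> y] E_pos[of \<omega> y] by (simp add: V_def a_def algebra_simps)
    finally show "(\<mu> - \<omega>) * (a y * A y) \<le> V \<omega> y * \<bar>f y\<bar> - a y * B y"
      by (simp add: mult_ac)
  qed simp
  also have "(LINT y:{x0..x1}|lborel. V \<omega> y * \<bar>f y\<bar> - a y * B y)
      = (LINT y:{x0..x1}|lborel. V \<omega> y * \<bar>f y\<bar>) - (LINT y:{x0..x1}|lborel. a y * B y)"
    by (rule set_integral_diff(2)[OF Vf aB])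
  finally show ?thesis
    using c_le by (simp add: f_def right_diff_distrib)
qed

lemma E_eigenfunction:
  assumes "chi l = 1"
  shows "gen_L x0 x1 g q w (\<lambda>x. E l x / g x) (\<lambda>x. l * (E l x / g x))"
proof -
  define \<rho> where "\<rho> x = - ((w x + l) / g x) * E l x" for x
  have \<rho>_cont: "continuous_on {x0..x1} \<rho>"
    unfolding \<rho>_def by (intro continuous_intros rate_cont E_cont)
  have c1: "continuous_on {x0..x1} (\<lambda>x. E l x / g x)"
    using g_nz by (intro continuous_intros E_cont g_cont) auto
  have int_\<rho>: "(LINT y:{x0..x}|lborel. \<rho> y) = E l x - 1" if "x \<in> {x0..x1}" for x
    using set_integral_FTC[OF E_deriv[of _ l, folded \<rho>_def] \<rho>_cont order_refl] that by (simp add: E_x0)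
  show ?thesis
    unfolding gen_L_def
  proof (intro conjI exI[of _ 1] exI[of _ \<rho>])
    show "inH x0 x1 (\<lambda>x. E l x / g x)" "inH x0 x1 (\<lambda>x. l * (E l x / g x))"
      unfolding inH_def by (intro borel_integrable_atLeastAtMost' continuous_intros c1)+
    show "set_integrable lborel {x0..x1} \<rho>"
      by (rule borel_integrable_atLeastAtMost'[OF \<rho>_cont])
    show "AE x in lborel. x \<in> {x0..x1} \<longrightarrow> g x * (E l x / g x) = 1 + (LINT y:{x0..x}|lborel. \<rho> y)"
      using g_nz by (intro AE_I2) (simp add: int_\<rho>)
    show "1 = (LINT x:{x0..x1}|lborel. q x * (E l x / g x))"
      using assms by (simp add: chi_def)
    show "AE x in lborel. x \<in> {x0..x1} \<longrightarrow> l * (E l x / g x) = - \<rho> x - w x * (E l x / g x)"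
      by (intro AE_I2) (simp add: \<rho>_def algebra_simps add_divide_distrib)
  qed
qed

lemma E_shift:
  assumes "x \<in> {x0..x1}"
  shows "E m x = E 0 x * exp (- m * (LINT s:{x0..x}|lborel. 1 / g s))"
proof -
  have "set_integrable lborel {x0..x1} (\<lambda>s. 1 / g s)"
    using g_nz by (intro borel_integrable_atLeastAtMost' continuous_intros g_cont) auto
  then have i: "set_integrable lborel {x0..x} (\<lambda>s. 1 / g s)" and
    j: "set_integrable lborel {x0..x} (\<lambda>s. (w s + 0) / g s)"
    using assms set_integrable_Icc_subset[OF rate_integrable[of 0], of x0 x]
    by (auto intro: set_integrable_Icc_subset)
  have "(LINT s:{x0..x}|lborel. (w s + m) / g s) = (LINT s:{x0..x}|lborel. (w s + 0) / g s + m * (1 / g s))"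
    by (simp add: add_divide_distrib)
  also have "\<dots> = (LINT s:{x0..x}|lborel. (w s + 0) / g s) + m * (LINT s:{x0..x}|lborel. 1 / g s)"
    using j set_integrable_mult_right[of m lborel "{x0..x}" "\<lambda>s. 1 / g s"] i
    by (subst set_integral_add) (auto simp del: set_integral_mult_right simp flip: set_integral_mult_right)
  finally show ?thesis by (simp add: E_def flip: exp_add)
qed

lemma time_pos:
  assumes x: "x0 < x" "x \<le> x1"
  shows "(LINT s:{x0..x}|lborel. 1 / g s) > 0"
proof -
  have "compact (g ` {x0..x1})" by (intro compact_continuous_image g_cont) simp
  then obtain b where b: "b > 0" "\<And>s. s \<in> {x0..x1} \<Longrightarrow> \<bar>g s\<bar> \<le> b"
    using compact_imp_bounded[of "g ` {x0..x1}"] unfolding bounded_pos by auto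
  have "set_integrable lborel {x0..x1} (\<lambda>s. 1 / g s)"
    using g_nz by (intro borel_integrable_atLeastAtMost' continuous_intros g_cont) auto
  then have i: "set_integrable lborel {x0..x} (\<lambda>s. 1 / g s)"
    using x by (auto intro: set_integrable_Icc_subset)
  have "0 < (x - x0) * (1 / b)" using x b by simp
  also have "\<dots> = (LINT s:{x0..x}|lborel. 1 / b)"
    using x by (simp add: set_integral_const)
  also have "\<dots> \<le> (LINT s:{x0..x}|lborel. 1 / g s)"
  proof (rule set_integral_mono[OF _ i])
    show "set_integrable lborel {x0..x} (\<lambda>s. 1 / b)"
      by (intro borel_integrable_atLeastAtMost' continuous_intros)
    fix s assume "s \<in> {x0..x}"
    then have "s \<in> {x0..x1}" using x by auto
    then show "1 / b \<le> 1 / g s"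
      using b(1) b(2)[of s] g_pos[of s] by (intro divide_left_mono) auto
  qed
  finally show ?thesis .
qed

lemma time_nonneg:
  assumes "x \<in> {x0..x1}"
  shows "(LINT s:{x0..x}|lborel. 1 / g s) \<ge> 0"
proof (cases "x = x0")
  case True
  have "set_integrable lborel {x0..x0} (\<lambda>s. 1 / g s)"
    using g_nz x01 by (intro borel_integrable_atLeastAtMost' continuous_intros
        continuous_on_subset[OF g_cont]) auto
  from set_borel_integral_eq_integral(2)[OF this] True show ?thesis by simp
next
  case False
  then show ?thesis using time_pos[of x] assms by auto
qed

lemma E_antimono:
  assumes "x \<in> {x0..x1}" "k \<le> m"
  shows "E m x \<le> E k x"
  using mult_right_mono[OF assms(2) time_nonneg[OF assms(1)]]
  by (subst (1 2) E_shift[OF assms(1)]) (intro mult_left_mono, auto simp: less_imp_le[OF E_pos])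

lemma chi_antimono:
  assumes "k \<le> m"
  shows "chi m \<le> chi k"
  unfolding chi_nu
proof (rule set_integral_mono_AE[OF nu_integrable nu_integrable])
  show "AE x\<in>{x0..x1} in lborel. nu m x \<le> nu k x"
    using q_nonneg
    by eventually_elim
      (auto simp: nu_def assms E_antimono intro!: mult_left_mono divide_right_mono less_imp_le[OF g_pos])
qed

lemma chi_tendsto_aux:
  assumes m: "\<And>n. m n \<ge> - R"
    and lim: "\<And>x. x0 < x \<Longrightarrow> x \<le> x1 \<Longrightarrow>
      (\<lambda>n. exp (- m n * (LINT s:{x0..x}|lborel. 1 / g s))) \<longlonglongrightarrow> l x"
    and l: "set_borel_measurable lborel {x0..x1} (\<lambda>x. nu 0 x * l x)"
  shows "(\<lambda>n. chi (m n)) \<longlonglongrightarrow> (LINT x:{x0..x1}|lborel. nu 0 x * l x)"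
proof -
  have nu_eq: "nu k x = nu 0 x * exp (- k * (LINT s:{x0..x}|lborel. 1 / g s))" if "x \<in> {x0..x1}" for k x
    using E_shift[OF that, of k] by (simp add: nu_def)
  show ?thesis
    unfolding chi_nu set_lebesgue_integral_def
  proof (rule integral_dominated_convergence)
    show "(\<lambda>x. indicator {x0..x1} x *\<^sub>R (nu 0 x * l x)) \<in> borel_measurable lborel"
      using l by (simp add: set_borel_measurable_def)
    show "(\<lambda>x. indicator {x0..x1} x *\<^sub>R nu (m n) x) \<in> borel_measurable lborel" for n
      using nu_integrable[of "m n"] by (auto simp: set_integrable_def)
    show "integrable lborel (\<lambda>x. indicator {x0..x1} x *\<^sub>R nu (- R) x)"
      using nu_integrable by (simp add: set_integrable_def)
    have "AE x in lborel. x \<noteq> x0" by (rule AE_lborel_singleton)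
    then show "AE x in lborel. (\<lambda>n. indicator {x0..x1} x *\<^sub>R nu (m n) x) \<longlonglongrightarrow> indicator {x0..x1} x *\<^sub>R (nu 0 x * l x)"
    proof eventually_elim
      case (elim x)
      show ?case
      proof (cases "x \<in> {x0..x1}")
        case True
        then have "(\<lambda>n. nu 0 x * exp (- m n * (LINT s:{x0..x}|lborel. 1 / g s))) \<longlonglongrightarrow> nu 0 x * l x"
          using elim by (intro tendsto_mult tendsto_const lim) auto
        then show ?thesis using True by (simp add: nu_eq[OF True, of "m _"])
      qed simp
    qed
    show "AE x in lborel. norm (indicator {x0..x1} x *\<^sub>R nu (m n) x) \<le> indicator {x0..x1} x *\<^sub>R nu (- R) x" for n
      using q_nonneg
    proof eventually_elim
      case (elim x)
      show ?case
      proof (cases "x \<in> {x0..x1}")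
        case True
        have "q x / g x * E (m n) x \<le> q x / g x * E (- R) x"
          using elim True g_pos[OF True] by (intro mult_left_mono E_antimono m) auto
        then show ?thesis
          using elim True g_pos[OF True] E_pos[of "m n" x] by (simp add: nu_def abs_mult)
      qed simp
    qed
  qed
qed

lemma chi_cont: "continuous_on UNIV chi"
proof (rule continuous_at_imp_continuous_on, rule ballI)
  fix k :: real
  show "isCont chi k"
    unfolding continuous_at_sequentially
  proof (intro allI impI)
    fix m :: "nat \<Rightarrow> real" assume m: "m \<longlonglongrightarrow> k"
    then obtain R where R: "\<And>n. \<bar>m n\<bar> \<le> R"
      using convergent_imp_bounded[OF m] by (auto simp: bounded_iff)
    have "(\<lambda>n. chi (m n)) \<longlonglongrightarrow>
        (LINT x:{x0..x1}|lborel. nu 0 x * exp (- k * (LINT s:{x0..x}|lborel. 1 / g s)))"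
    proof (rule chi_tendsto_aux)
      show "m n \<ge> - R" for n using R[of n] by linarith
      show "(\<lambda>n. exp (- m n * (LINT s:{x0..x}|lborel. 1 / g s))) \<longlonglongrightarrow> exp (- k * (LINT s:{x0..x}|lborel. 1 / g s))" for x
        by (intro tendsto_intros m)
      have "set_integrable lborel {x0..x1} (\<lambda>s. 1 / g s)"
        using g_nz by (intro borel_integrable_atLeastAtMost' continuous_intros g_cont) auto
      then have "set_integrable lborel {x0..x1} (\<lambda>x. nu 0 x * exp (- k * (LINT s:{x0..x}|lborel. 1 / g s)))"
        by (intro set_integrable_mult_continuous nu_integrable continuous_intros continuous_on_indefinite_set_integral)
      then show "set_borel_measurable lborel {x0..x1} (\<lambda>x. nu 0 x * exp (- k * (LINT s:{x0..x}|lborel. 1 / g s)))"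
        unfolding set_integrable_def set_borel_measurable_def by (rule borel_measurable_integrable)
    qed
    also have "(LINT x:{x0..x1}|lborel. nu 0 x * exp (- k * (LINT s:{x0..x}|lborel. 1 / g s))) = chi k"
      unfolding chi_nu by (intro set_lebesgue_integral_cong) (auto simp: nu_def E_shift[of _ k])
    finally show "(chi \<circ> m) \<longlonglongrightarrow> chi k" by (simp add: o_def)
  qed
qed

lemma chi_tendsto_0: "(\<lambda>n. chi (real n)) \<longlonglongrightarrow> 0"
proof -
  have "(\<lambda>n. chi (real n)) \<longlonglongrightarrow> (LINT x:{x0..x1}|lborel. nu 0 x * 0)"
  proof (rule chi_tendsto_aux[where R=0])
    fix x assume x: "x0 < x" "x \<le> x1"
    define \<theta> where "\<theta> = (LINT s:{x0..x}|lborel. 1 / g s)"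
    have "(\<lambda>n. exp (- \<theta>) ^ n) \<longlonglongrightarrow> 0"
      using time_pos[OF x] by (intro LIMSEQ_realpow_zero) (auto simp: \<theta>_def)
    then show "(\<lambda>n. exp (- real n * \<theta>)) \<longlonglongrightarrow> 0"
      by (simp flip: exp_of_nat_mult)
  qed (auto simp: set_borel_measurable_def)
  then show ?thesis by (simp add: set_lebesgue_integral_def)
qed

lemma largest_characteristic_root:
  assumes "chi 0 > 1"
  shows "\<exists>l>0. chi l = 1 \<and> (\<forall>m>l. chi m < 1)"
proof -
  have "\<forall>\<^sub>F n in sequentially. chi (real n) < 1"
    using chi_tendsto_0 by (rule order_tendstoD(2)) simp
  then obtain n where n: "chi (real n) < 1"
    by (auto simp: eventually_sequentially)
  have cc: "continuous_on S chi" for S by (rule continuous_on_subset[OF chi_cont]) simp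
  define S where "S = {0..real n} \<inter> chi -` {1..}"
  have "closed S"
    unfolding S_def by (intro continuous_closed_preimage cc) auto
  then have "compact S"
    by (auto simp: compact_eq_bounded_closed S_def intro: bounded_subset[of "{0..real n}"])
  moreover have "0 \<in> S" using assms by (simp add: S_def)
  ultimately obtain l where l: "l \<in> S" "\<And>m. m \<in> S \<Longrightarrow> m \<le> l"
    using compact_attains_sup[of S] by blast
  obtain c where c: "l \<le> c" "c \<le> real n" "chi c = 1"
    using IVT2'[of chi "real n" 1 l] l(1) n cc by (auto simp: S_def)
  then have "c = l" using l(2)[of c] l(1) by (simp add: S_def)
  then have chi_l: "chi l = 1" using c by simp
  then have "l > 0" using l(1) assms by (cases "l = 0") (auto simp: S_def)
  moreover have "chi m < 1" if "m > l" for m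
  proof (cases "m \<le> real n")
    case True
    then have "m \<notin> S" using l(2)[of m] that by auto
    then show ?thesis using True that \<open>l > 0\<close> by (simp add: S_def)
  next
    case False
    then show ?thesis using chi_antimono[of "real n" m] n by simp
  qed
  ultimately show ?thesis using chi_l by blast
qed

end

section \<open>Transfer to the space of integrable functions\<close>

lemma rep_l1_integrable: "integrable lborel (rep_l1 F)"
  using Quotient3_rel_rep[OF Quotient3_l1, of F F] by (auto simp: l1_rel_def)

lemma abs_rep_l1: "abs_l1 (rep_l1 F) = F"
  by (rule Quotient3_abs_rep[OF Quotient3_l1])

lemma rep_abs_l1:
  assumes "integrable lborel f"
  shows "AE x in lborel. rep_l1 (abs_l1 f) x = f x"
proof -
  have "l1_rel f f" using assms by (simp add: l1_rel_def)
  then have "l1_rel (rep_l1 (abs_l1 f)) f" by (rule rep_abs_rsp_left[OF Quotient3_l1])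
  then show ?thesis by (simp add: l1_rel_def)
qed

lemma norm_l1_rep: "norm F = (\<integral>x. \<bar>rep_l1 F x\<bar> \<partial>lborel)"
  using norm_l1.abs_eq[of "rep_l1 F"] rep_l1_integrable by (simp add: abs_rep_l1 l1_rel_def)

lemma abs_l1_eqI:
  assumes "integrable lborel f" "integrable lborel h" "AE x in lborel. f x = h x"
  shows "abs_l1 f = abs_l1 h"
  using assms by (intro Quotient3_rel_abs[OF Quotient3_l1]) (simp add: l1_rel_def)

lemma abs_l1_linear:
  assumes "integrable lborel f" "integrable lborel h"
  shows "abs_l1 (\<lambda>x. a * f x + b * h x) = a *\<^sub>R abs_l1 f + b *\<^sub>R abs_l1 h"
  using assms by (simp add: scaleR_l1.abs_eq plus_l1.abs_eq l1_rel_def)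

lemma rep_l1_linear: "AE x in lborel. rep_l1 (a *\<^sub>R F + b *\<^sub>R G) x = a * rep_l1 F x + b * rep_l1 G x"
proof -
  have "a *\<^sub>R F + b *\<^sub>R G = abs_l1 (\<lambda>x. a * rep_l1 F x + b * rep_l1 G x)"
    by (simp add: abs_l1_linear rep_l1_integrable abs_rep_l1)
  then show ?thesis
    using rep_abs_l1[of "\<lambda>x. a * rep_l1 F x + b * rep_l1 G x"] rep_l1_integrable by simp
qed

definition emb :: "real \<Rightarrow> real \<Rightarrow> (real \<Rightarrow> real) \<Rightarrow> l1" where
  "emb x0 x1 f = abs_l1 (\<lambda>x. indicator {x0..x1} x * f x)"

lemma inH_rep: "inH x0 x1 (rep_l1 F)"
  unfolding inH_def set_integrable_def
  by (intro integrable_mult_indicator rep_l1_integrable) simp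

lemma inH_linear:
  assumes "inH x0 x1 f" "inH x0 x1 h"
  shows "inH x0 x1 (\<lambda>x. a * f x + b * h x)"
  using assms unfolding inH_def by (intro set_integral_add) auto

lemma inH_diff: "inH x0 x1 f \<Longrightarrow> inH x0 x1 h \<Longrightarrow> inH x0 x1 (\<lambda>x. f x - h x)"
  unfolding inH_def by (rule set_integral_diff)

lemma emb_linear:
  assumes "inH x0 x1 f" "inH x0 x1 h"
  shows "emb x0 x1 (\<lambda>x. a * f x + b * h x) = a *\<^sub>R emb x0 x1 f + b *\<^sub>R emb x0 x1 h"
proof -
  have "(\<lambda>x. indicator {x0..x1} x * (a * f x + b * h x)) =
      (\<lambda>x. a * (indicator {x0..x1} x * f x) + b * (indicator {x0..x1} x * h x))"
    by (simp add: fun_eq_iff algebra_simps)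
  then show ?thesis
    using assms unfolding emb_def inH_def set_integrable_def by (simp add: abs_l1_linear)
qed

lemma emb_diff:
  assumes "inH x0 x1 f" "inH x0 x1 h"
  shows "emb x0 x1 (\<lambda>x. f x - h x) = emb x0 x1 f - emb x0 x1 h"
  using emb_linear[OF assms, of 1 "-1"] by simp

lemma rep_emb:
  assumes "inH x0 x1 f"
  shows "AE x in lborel. x \<in> {x0..x1} \<longrightarrow> rep_l1 (emb x0 x1 f) x = f x"
proof -
  have "AE x in lborel. rep_l1 (emb x0 x1 f) x = indicator {x0..x1} x * f x"
    unfolding emb_def using assms by (intro rep_abs_l1) (simp add: inH_def set_integrable_def)
  then show ?thesis by eventually_elim simp
qed

lemma norm_emb:
  assumes "inH x0 x1 f"
  shows "norm (emb x0 x1 f) = L1norm x0 x1 f"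
proof -
  have i: "integrable lborel (\<lambda>x. indicator {x0..x1} x * f x)"
    using assms by (simp add: inH_def set_integrable_def)
  then have "norm (emb x0 x1 f) = (\<integral>x. \<bar>indicator {x0..x1} x * f x\<bar> \<partial>lborel)"
    unfolding emb_def by (simp add: norm_l1.abs_eq l1_rel_def)
  then show ?thesis by (simp add: L1norm_def set_lebesgue_integral_def abs_mult)
qed

lemma dist_emb:
  assumes "inH x0 x1 f" "inH x0 x1 h"
  shows "norm (emb x0 x1 f - emb x0 x1 h) = L1norm x0 x1 (\<lambda>x. f x - h x)"
  using norm_emb[OF inH_diff[OF assms]] emb_diff[OF assms] by simp

lemma emb_eq_iff:
  assumes "inH x0 x1 f" "inH x0 x1 h"
  shows "emb x0 x1 f = emb x0 x1 h \<longleftrightarrow> L1norm x0 x1 (\<lambda>x. f x - h x) = 0"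
  using dist_emb[OF assms] by auto

lemma emb_cong_AE:
  assumes "inH x0 x1 f" "inH x0 x1 h" "AE x in lborel. x \<in> {x0..x1} \<longrightarrow> f x = h x"
  shows "emb x0 x1 f = emb x0 x1 h"
  using assms unfolding emb_def inH_def set_integrable_def
  by (intro abs_l1_eqI) (auto simp: indicator_def elim!: eventually_mono)

lemma emb_rep_emb: "inH x0 x1 f \<Longrightarrow> emb x0 x1 (rep_l1 (emb x0 x1 f)) = emb x0 x1 f"
  by (intro emb_cong_AE inH_rep rep_emb)

lemma emb_rep_linear:
  "emb x0 x1 (rep_l1 (a *\<^sub>R F + b *\<^sub>R G)) = emb x0 x1 (\<lambda>x. a * rep_l1 F x + b * rep_l1 G x)"
  by (intro emb_cong_AE inH_rep inH_linear) (use rep_l1_linear[of a F b G] in \<open>auto elim!: eventually_mono\<close>)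

lemma norm_emb_rep: "norm (emb x0 x1 (rep_l1 F)) \<le> norm F"
proof -
  have i: "integrable lborel (\<lambda>x. \<bar>rep_l1 F x\<bar>)" by (intro integrable_abs rep_l1_integrable)
  have "norm (emb x0 x1 (rep_l1 F)) = (\<integral>x. indicator {x0..x1} x *\<^sub>R \<bar>rep_l1 F x\<bar> \<partial>lborel)"
    by (simp add: norm_emb inH_rep L1norm_def set_lebesgue_integral_def)
  also have "\<dots> \<le> (\<integral>x. \<bar>rep_l1 F x\<bar> \<partial>lborel)"
    by (intro integral_mono i integrable_mult_indicator) (auto simp: indicator_def)
  finally show ?thesis by (simp add: norm_l1_rep)
qed

lemma emb_sum:
  fixes n :: nat
  assumes "\<And>i. i < n \<Longrightarrow> inH x0 x1 (v i)"
  shows "inH x0 x1 (\<lambda>x. \<Sum>i<n. c i * v i x) \<and> emb x0 x1 (\<lambda>x. \<Sum>i<n. c i * v i x) = (\<Sum>i<n. c i *\<^sub>R emb x0 x1 (v i))"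
  using assms
proof (induction n)
  case 0
  then show ?case by (simp add: inH_def set_integrable_def emb_def zero_l1_def)
next
  case (Suc n)
  have IH: "inH x0 x1 (\<lambda>x. \<Sum>i<n. c i * v i x)"
    "emb x0 x1 (\<lambda>x. \<Sum>i<n. c i * v i x) = (\<Sum>i<n. c i *\<^sub>R emb x0 x1 (v i))"
    using Suc by auto
  have n: "inH x0 x1 (v n)" using Suc.prems by simp
  show ?case
    using inH_linear[OF IH(1) n, of 1 "c n"] emb_linear[OF IH(1) n, of 1 "c n"] by (simp add: IH(2))
qed

lemma H_integral_iff:
  assumes t: "t \<ge> 0" and v: "\<And>s. s \<in> {0..t} \<Longrightarrow> inH x0 x1 (v s)"
    and cont: "continuous_on {0..t} (\<lambda>s. emb x0 x1 (v s))"
  shows "H_integral x0 x1 v 0 t I \<longleftrightarrow>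
    inH x0 x1 I \<and> emb x0 x1 I = integral {0..t} (\<lambda>s. emb x0 x1 (v s))"
proof (cases "inH x0 x1 I")
  case True
  let ?J = "integral {0..t} (\<lambda>s. emb x0 x1 (v s))"
  let ?part = "\<lambda>\<delta> n s \<tau>. s 0 = 0 \<and> s n = t \<and>
      (\<forall>i<n. s i \<le> s (Suc i) \<and> s (Suc i) - s i < \<delta> \<and> s i \<le> \<tau> i \<and> \<tau> i \<le> s (Suc i))"
  let ?S = "\<lambda>n s \<tau>. \<Sum>i<n. (s (Suc i) - s i) *\<^sub>R emb x0 x1 (v (\<tau> i))"
  have sum: "L1norm x0 x1 (\<lambda>x. (\<Sum>i<n. (s (Suc i) - s i) * v (\<tau> i) x) - I x) = norm (?S n s \<tau> - emb x0 x1 I)"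
    if p: "?part \<delta> n s \<tau>" for \<delta> n s \<tau>
  proof -
    have mono: "s i \<le> s j" if "i \<le> j" "j \<le> n" for i j
      using that
    proof (induction j)
      case (Suc j)
      have "s j \<le> s (Suc j)" using p Suc.prems by auto
      then show ?case using Suc by (cases "i = Suc j") auto
    qed simp
    have "inH x0 x1 (v (\<tau> i))" if "i < n" for i
    proof (rule v)
      have "0 \<le> s i" "s (Suc i) \<le> t" "s i \<le> \<tau> i" "\<tau> i \<le> s (Suc i)"
        using p mono[of 0 i] mono[of "Suc i" n] that by auto
      then show "\<tau> i \<in> {0..t}" by simp
    qed
    note es = emb_sum[of n x0 x1 "\<lambda>i. v (\<tau> i)" "\<lambda>i. s (Suc i) - s i", OF this]
    show ?thesis
      using dist_emb[OF conjunct1[OF es] True] conjunct2[OF es] by simp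
  qed
  have riem: "\<exists>\<delta>>0. \<forall>n s \<tau>. ?part \<delta> n s \<tau> \<longrightarrow> norm (?S n s \<tau> - ?J) < e" if "e > 0" for e
    by (rule riemann_sums_tend_to_integral[OF cont that])
  show ?thesis
  proof
    assume H: "H_integral x0 x1 v 0 t I"
    have "norm (emb x0 x1 I - ?J) \<le> 0 + e" if e: "e > 0" for e
    proof -
      have "\<exists>\<delta>>0. \<forall>n s \<tau>. ?part \<delta> n s \<tau> \<longrightarrow>
          L1norm x0 x1 (\<lambda>x. (\<Sum>i<n. (s (Suc i) - s i) * v (\<tau> i) x) - I x) < e / 2"
        using H[unfolded H_integral_def, THEN conjunct2, rule_format, OF half_gt_zero[OF e]] .
      then obtain d1 where d1: "d1 > 0" "\<forall>n s \<tau>. ?part d1 n s \<tau> \<longrightarrow>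
          L1norm x0 x1 (\<lambda>x. (\<Sum>i<n. (s (Suc i) - s i) * v (\<tau> i) x) - I x) < e / 2"
        by (elim exE conjE)
      obtain d2 where d2: "d2 > 0" "\<forall>n s \<tau>. ?part d2 n s \<tau> \<longrightarrow> norm (?S n s \<tau> - ?J) < e / 2"
        using riem[OF half_gt_zero[OF e]] by (elim exE conjE)
      have d: "min d1 d2 > 0" using d1(1) d2(1) by simp
      obtain n :: nat and s where s: "s 0 = 0" "s n = t"
        "\<And>i. i < n \<Longrightarrow> s i \<le> s (Suc i) \<and> s (Suc i) - s i < min d1 d2"
        by (rule fine_partition_exists[OF t d]) blast
      have p1: "?part d1 n s s" and p2: "?part d2 n s s" using s by auto
      have "norm (emb x0 x1 I - ?J) \<le> norm (?S n s s - ?J) + norm (?S n s s - emb x0 x1 I)"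
        using norm_triangle_ineq4[of "?S n s s - ?J" "?S n s s - emb x0 x1 I"] by simp
      then show ?thesis
        using d1(2)[rule_format, OF p1] d2(2)[rule_format, OF p2] sum[OF p1] by simp
    qed
    then have "norm (emb x0 x1 I - ?J) \<le> 0" by (rule field_le_epsilon)
    then show "inH x0 x1 I \<and> emb x0 x1 I = ?J" using True by simp
  next
    assume "inH x0 x1 I \<and> emb x0 x1 I = ?J"
    then have J: "emb x0 x1 I = ?J" ..
    show "H_integral x0 x1 v 0 t I"
      unfolding H_integral_def
    proof (intro conjI True allI impI)
      fix e :: real assume "e > 0"
      from riem[OF this] obtain d where d: "d > 0"
        "\<forall>n s \<tau>. ?part d n s \<tau> \<longrightarrow> norm (?S n s \<tau> - ?J) < e"
        by (elim exE conjE)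
      show "\<exists>\<delta>>0. \<forall>n s \<tau>. ?part \<delta> n s \<tau> \<longrightarrow>
          L1norm x0 x1 (\<lambda>x. (\<Sum>i<n. (s (Suc i) - s i) * v (\<tau> i) x) - I x) < e"
      proof (intro exI[of _ d] conjI d(1) allI impI)
        fix n s \<tau> assume p: "?part d n s \<tau>"
        show "L1norm x0 x1 (\<lambda>x. (\<Sum>i<n. (s (Suc i) - s i) * v (\<tau> i) x) - I x) < e"
          using d(2)[rule_format, OF p] sum[OF p] J by simp
      qed
    qed
  qed
next
  case False
  then show ?thesis by (simp add: H_integral_def)
qed

locale coagulation = transport x0 x1 g w q for x0 x1 g w q +
  fixes \<beta> :: "real \<Rightarrow> real \<Rightarrow> real" and T :: "real \<Rightarrow> (real \<Rightarrow> real) \<Rightarrow> (real \<Rightarrow> real)"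
  assumes x0_pos: "0 < x0"
    and \<beta>_meas: "set_borel_measurable lborel ({x0..x1} \<times> {x0..x1}) (\<lambda>z. \<beta> (fst z) (snd z))"
    and \<beta>_bdd: "\<exists>B. AE z in lborel. z \<in> {x0..x1} \<times> {x0..x1} \<longrightarrow> \<bar>\<beta> (fst z) (snd z)\<bar> \<le> B"
    and generated: "generated_by_L x0 x1 g q w T"
begin

abbreviation em :: "(real \<Rightarrow> real) \<Rightarrow> l1" where "em \<equiv> emb x0 x1"

lemma C0: "C0_semigroup x0 x1 T"
  using generated by (simp add: generated_by_L_def)

lemma inH_T: "t \<ge> 0 \<Longrightarrow> inH x0 x1 f \<Longrightarrow> inH x0 x1 (T t f)"
  using C0 by (simp add: C0_semigroup_def)

lemma em_T_linear:
  assumes "t \<ge> 0" "inH x0 x1 f" "inH x0 x1 h"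
  shows "em (T t (\<lambda>y. a * f y + b * h y)) = a *\<^sub>R em (T t f) + b *\<^sub>R em (T t h)"
proof -
  have "L1norm x0 x1 (\<lambda>x. T t (\<lambda>y. a * f y + b * h y) x - (a * T t f x + b * T t h x)) = 0"
    using C0 assms by (simp add: C0_semigroup_def)
  then have "em (T t (\<lambda>y. a * f y + b * h y)) = em (\<lambda>x. a * T t f x + b * T t h x)"
    using assms by (subst emb_eq_iff) (auto intro!: inH_T inH_linear)
  then show ?thesis using assms by (simp add: emb_linear inH_T)
qed

lemma T_bound:
  assumes "t \<ge> 0"
  shows "\<exists>M\<ge>0. \<forall>f. inH x0 x1 f \<longrightarrow> norm (em (T t f)) \<le> M * norm (em f)"
proof -
  have "\<exists>M. \<forall>f. inH x0 x1 f \<longrightarrow> L1norm x0 x1 (T t f) \<le> M * L1norm x0 x1 f"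
    using C0 assms by (simp add: C0_semigroup_def)
  then obtain M where M: "\<And>f. inH x0 x1 f \<Longrightarrow> L1norm x0 x1 (T t f) \<le> M * L1norm x0 x1 f"
    by blast
  have "norm (em (T t f)) \<le> \<bar>M\<bar> * norm (em f)" if "inH x0 x1 f" for f
    using M[OF that] mult_right_mono[OF abs_ge_self[of M] norm_ge_zero[of "em f"]] assms that
    by (simp add: norm_emb inH_T)
  then show ?thesis by (intro exI[of _ "\<bar>M\<bar>"]) auto
qed

lemma em_T_cong:
  assumes t: "t \<ge> 0" and f: "inH x0 x1 f" and h: "inH x0 x1 h" and eq: "em f = em h"
  shows "em (T t f) = em (T t h)"
proof -
  obtain M where M: "\<And>f. inH x0 x1 f \<Longrightarrow> norm (em (T t f)) \<le> M * norm (em f)"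
    using T_bound[OF t] by blast
  have "norm (em (T t (\<lambda>y. 1 * f y + - 1 * h y))) \<le> M * norm (em (\<lambda>y. 1 * f y + - 1 * h y))"
    by (intro M inH_linear f h)
  then show ?thesis
    by (simp only: em_T_linear[OF t f h] emb_linear[OF f h] eq) simp
qed

definition S :: "real \<Rightarrow> l1 \<Rightarrow> l1" where
  "S t F = em (T t (rep_l1 F))"

lemma S_em: "t \<ge> 0 \<Longrightarrow> inH x0 x1 f \<Longrightarrow> S t (em f) = em (T t f)"
  unfolding S_def by (intro em_T_cong inH_rep emb_rep_emb)

lemma S_0: "S 0 F = em (rep_l1 F)"
  unfolding S_def using C0 inH_rep[of x0 x1 F]
  by (subst emb_eq_iff) (auto simp: C0_semigroup_def)

lemma S_linear:
  assumes "t \<ge> 0"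
  shows "S t (a *\<^sub>R F + b *\<^sub>R G) = a *\<^sub>R S t F + b *\<^sub>R S t G"
proof -
  have "S t (a *\<^sub>R F + b *\<^sub>R G) = em (T t (\<lambda>x. a * rep_l1 F x + b * rep_l1 G x))"
    unfolding S_def using assms by (intro em_T_cong inH_rep inH_linear emb_rep_linear)
  then show ?thesis
    using assms by (simp add: S_def em_T_linear inH_rep)
qed

lemma semigroup_S: "semigroup_c0 S"
proof (rule semigroup_c0.intro)
  fix t :: real assume t: "t \<ge> 0"
  obtain M where M: "M \<ge> 0" "\<And>f. inH x0 x1 f \<Longrightarrow> norm (em (T t f)) \<le> M * norm (em f)"
    using T_bound[OF t] by blast
  show "bounded_linear (S t)"
  proof (rule bounded_linear_intro)
    show "S t (F + G) = S t F + S t G" for F G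
      using S_linear[OF t, of 1 F 1 G] by simp
    show "S t (a *\<^sub>R F) = a *\<^sub>R S t F" for a F
      using S_linear[OF t, of a F 0 0] by simp
    show "norm (S t F) \<le> norm F * M" for F
      using M(2)[OF inH_rep[of x0 x1 F]] mult_left_mono[OF norm_emb_rep[of x0 x1 F] M(1)]
      by (simp add: S_def mult.commute)
  qed
next
  fix t s :: real and F :: l1 assume ts: "t \<ge> 0" "s \<ge> 0"
  have "S (t + s) F = em (T t (T s (rep_l1 F)))"
    unfolding S_def using ts C0 inH_rep[of x0 x1 F]
    by (subst emb_eq_iff) (auto simp: inH_T C0_semigroup_def)
  also have "\<dots> = S t (S s F)"
    using ts S_em[of t "T s (rep_l1 F)"] by (simp add: S_def[of s] inH_T inH_rep)
  finally show "S (t + s) F = S t (S s F)" .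
next
  fix F :: l1
  have "((\<lambda>h. L1norm x0 x1 (\<lambda>x. T h (rep_l1 F) x - rep_l1 F x)) \<longlongrightarrow> 0) (at_right 0)"
    using C0 inH_rep[of x0 x1 F] by (simp add: C0_semigroup_def)
  then have "((\<lambda>h. norm (S h F - S 0 F)) \<longlongrightarrow> 0) (at_right 0)"
    unfolding S_0
    by (rule Lim_transform_eventually)
      (auto simp: eventually_at_filter S_def dist_emb inH_T inH_rep)
  then show "((\<lambda>h. S h F) \<longlongrightarrow> S 0 F) (at_right 0)"
    by (simp add: tendsto_norm_zero_iff flip: Lim_null)
qed

sublocale semigroup_c0 S
  by (rule semigroup_S)

lemma L1norm_difference_quotient:
  assumes f: "inH x0 x1 f" and h: "inH x0 x1 h" and k: "k > 0"
  shows "L1norm x0 x1 (\<lambda>x. (T k f x - f x) / k - h x) = norm ((1 / k) *\<^sub>R (S k (em f) - em f) - em h)"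
proof -
  have Tf: "inH x0 x1 (T k f)" using k f by (simp add: inH_T)
  have 1: "inH x0 x1 (\<lambda>x. 1 / k * T k f x + - 1 / k * f x)" by (rule inH_linear[OF Tf f])
  have "L1norm x0 x1 (\<lambda>x. (1 / k * T k f x + - 1 / k * f x) - h x)
     = norm (em (\<lambda>x. 1 / k * T k f x + - 1 / k * f x) - em h)"
    by (rule dist_emb[OF 1 h, symmetric])
  also have "em (\<lambda>x. 1 / k * T k f x + - 1 / k * f x) = (1 / k) *\<^sub>R em (T k f) + (- 1 / k) *\<^sub>R em f"
    by (rule emb_linear[OF Tf f])
  also have "\<dots> = (1 / k) *\<^sub>R (S k (em f) - em f)"
    using k f by (simp add: S_em scaleR_diff_right)
  finally show ?thesis by (simp add: diff_divide_distrib)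
qed

lemma gen_iff:
  assumes f: "inH x0 x1 f" and h: "inH x0 x1 h"
  shows "gen (em f) (em h) \<longleftrightarrow> gen_L x0 x1 g q w f h"
proof -
  have "gen (em f) (em h) \<longleftrightarrow>
      ((\<lambda>k. norm ((1 / k) *\<^sub>R (S k (em f) - em f) - em h)) \<longlongrightarrow> 0) (at_right 0)"
    unfolding gen_def by (simp add: tendsto_norm_zero_iff flip: Lim_null)
  also have "\<dots> \<longleftrightarrow> ((\<lambda>k. L1norm x0 x1 (\<lambda>x. (T k f x - f x) / k - h x)) \<longlongrightarrow> 0) (at_right 0)"
    by (rule filterlim_cong) (auto simp: eventually_at_filter L1norm_difference_quotient f h)
  also have "\<dots> \<longleftrightarrow> gen_L x0 x1 g q w f h"
    using generated f h by (simp add: generated_by_L_def)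
  finally show ?thesis .
qed

lemma gen_range:
  assumes "gen X Y"
  shows "em (rep_l1 X) = X" "em (rep_l1 Y) = Y"
proof -
  show X: "em (rep_l1 X) = X" using gen_T0[OF assms] by (simp add: S_0)
  have "S 0 Y = Y"
  proof (rule tendsto_unique)
    show "((\<lambda>h. (1 / h) *\<^sub>R (S h X - X)) \<longlongrightarrow> Y) (at_right 0)" using assms by (simp add: gen_def)
    then have "((\<lambda>h. S 0 ((1 / h) *\<^sub>R (S h X - X))) \<longlongrightarrow> S 0 Y) (at_right 0)"
      by (rule bounded_linear.tendsto[OF bounded_linear_T, rotated]) simp
    then show "((\<lambda>h. (1 / h) *\<^sub>R (S h X - X)) \<longlongrightarrow> S 0 Y) (at_right 0)"
      by (rule Lim_transform_eventually)
        (auto simp: eventually_at_filter T_scaleR T_diff T0_T gen_T0[OF assms])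
  qed simp
  then show "em (rep_l1 Y) = Y" by (simp add: S_0)
qed

lemma growth:
  assumes chi: "chi \<omega> < 1"
  shows "\<exists>M\<ge>1. \<forall>t\<ge>0. \<forall>F. norm (S t F) \<le> M * exp (\<omega> * t) * norm F"
proof -
  define p where "p F = (LINT x:{x0..x1}|lborel. V \<omega> x * \<bar>rep_l1 F x\<bar>)" for F
  have i: "set_integrable lborel {x0..x1} (\<lambda>x. V \<omega> x * \<bar>f x\<bar>)" if "inH x0 x1 f" for f
    using set_integrable_mult_continuous[OF set_integrable_abs V_cont, of f \<omega>] that
    by (simp add: inH_def mult.commute)
  have p_cong: "p F = (LINT x:{x0..x1}|lborel. V \<omega> x * \<bar>f x\<bar>)"
    if f: "inH x0 x1 f" and ae: "AE x in lborel. x \<in> {x0..x1} \<longrightarrow> rep_l1 F x = f x" for F f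
    unfolding p_def set_lebesgue_integral_def
    using i[OF f] i[OF inH_rep] ae unfolding set_integrable_def
    by (intro integral_cong_AE) (auto simp: indicator_def elim!: eventually_mono)
  obtain y where y: "y \<in> {x0..x1}" "\<And>x. x \<in> {x0..x1} \<Longrightarrow> V \<omega> y \<le> V \<omega> x"
    using continuous_attains_inf[OF compact_Icc _ V_cont] x01 by fastforce
  obtain z where z: "z \<in> {x0..x1}" "\<And>x. x \<in> {x0..x1} \<Longrightarrow> V \<omega> x \<le> V \<omega> z"
    using continuous_attains_sup[OF compact_Icc _ V_cont] x01 by fastforce
  define c where "c = V \<omega> y"
  define C where "C = V \<omega> z"
  have c: "c > 0" using V_pos[OF chi y(1)] by (simp add: c_def)
  have cC: "c \<le> C" using y(2)[OF z(1)] by (simp add: c_def C_def)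
  have ai: "set_integrable lborel {x0..x1} (\<lambda>x. \<bar>rep_l1 F x\<bar>)" for F
    using inH_rep[of x0 x1 F] unfolding inH_def by (rule set_integrable_abs)
  have p_le: "p F \<le> C * norm (S 0 F)" and p_ge: "c * norm (S 0 F) \<le> p F" for F
  proof -
    have n: "norm (S 0 F) = (LINT x:{x0..x1}|lborel. \<bar>rep_l1 F x\<bar>)"
      by (simp add: S_0 norm_emb inH_rep L1norm_def)
    have "p F \<le> (LINT x:{x0..x1}|lborel. C * \<bar>rep_l1 F x\<bar>)"
      unfolding p_def using z ai by (intro set_integral_mono i inH_rep) (auto simp: C_def intro!: mult_right_mono)
    then show "p F \<le> C * norm (S 0 F)" by (simp add: n)
    have "(LINT x:{x0..x1}|lborel. c * \<bar>rep_l1 F x\<bar>) \<le> p F"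
      unfolding p_def using y ai by (intro set_integral_mono i inH_rep) (auto simp: c_def intro!: mult_right_mono)
    then show "c * norm (S 0 F) \<le> p F" by (simp add: n)
  qed
  have n0: "norm (S 0 F) \<le> norm F" for F by (simp add: S_0 norm_emb_rep)
  have bound: "norm (S t F) \<le> C / c * exp (\<omega> * t) * norm (S 0 F)" if "t \<ge> 0" for t F
  proof (rule growth_bound[where p=p])
    fix X Y :: l1
    have "p (X + Y) = (LINT x:{x0..x1}|lborel. V \<omega> x * \<bar>1 * rep_l1 X x + 1 * rep_l1 Y x\<bar>)"
      using rep_l1_linear[of 1 X 1 Y]
      by (intro p_cong inH_linear inH_rep) (auto elim!: eventually_mono)
    also have "\<dots> \<le> (LINT x:{x0..x1}|lborel. V \<omega> x * \<bar>rep_l1 X x\<bar> + V \<omega> x * \<bar>rep_l1 Y x\<bar>)"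
      by (intro set_integral_mono set_integral_add i inH_linear inH_rep)
        (auto simp flip: distrib_left intro!: mult_left_mono less_imp_le[OF V_pos[OF chi]])
    also have "\<dots> = p X + p Y"
      unfolding p_def by (intro set_integral_add i inH_rep)
    finally show "p (X + Y) \<le> p X + p Y" .
  next
    fix X :: l1
    have "0 \<le> c * norm (S 0 X)" using c by simp
    moreover have "C * norm (S 0 X) \<le> C * norm X" using c cC n0 by (intro mult_left_mono) auto
    ultimately show "0 \<le> p X \<and> p X \<le> C * norm X" using p_le[of X] p_ge[of X] by linarith
  next
    fix X Y :: l1 and h :: real assume XY: "gen X Y" and h: "h > 0"
    have L: "gen_L x0 x1 g q w (rep_l1 X) (rep_l1 Y)"
      using gen_iff[OF inH_rep inH_rep, of X Y] XY gen_range[OF XY] by simp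
    show "(1 - h * \<omega>) * p X \<le> p (X - h *\<^sub>R Y)"
    proof (cases "1 / h > \<omega>")
      case True
      have "(1 / h - \<omega>) * p X \<le> (LINT x:{x0..x1}|lborel. V \<omega> x * \<bar>1 / h * rep_l1 X x - rep_l1 Y x\<bar>)"
        unfolding p_def by (rule resolvent_estimate[OF chi L True])
      then have "h * ((1 / h - \<omega>) * p X) \<le> h * (LINT x:{x0..x1}|lborel. V \<omega> x * \<bar>1 / h * rep_l1 X x - rep_l1 Y x\<bar>)"
        using h by (intro mult_left_mono) auto
      also have "\<dots> = (LINT x:{x0..x1}|lborel. h * (V \<omega> x * \<bar>1 / h * rep_l1 X x - rep_l1 Y x\<bar>))"
        by (rule set_integral_mult_right[symmetric])
      also have "\<dots> = (LINT x:{x0..x1}|lborel. V \<omega> x * \<bar>1 * rep_l1 X x + - h * rep_l1 Y x\<bar>)"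
      proof -
        have "h * \<bar>1 / h * a - b\<bar> = \<bar>1 * a + - h * b\<bar>" for a b :: real
        proof -
          have "h * \<bar>1 / h * a - b\<bar> = \<bar>h * (1 / h * a - b)\<bar>" using h by (simp add: abs_mult)
          also have "h * (1 / h * a - b) = 1 * a + - h * b" using h by (simp add: field_simps)
          finally show ?thesis .
        qed
        then show ?thesis by (simp add: mult.left_commute[of h])
      qed
      also have "\<dots> = p (X - h *\<^sub>R Y)"
        using rep_l1_linear[of 1 X "- h" Y]
        by (intro p_cong[symmetric] inH_linear inH_rep) (auto elim!: eventually_mono)
      finally have "h * ((1 / h - \<omega>) * p X) \<le> p (X - h *\<^sub>R Y)" .
      moreover have "h * ((1 / h - \<omega>) * p X) = (1 - h * \<omega>) * p X" using h by (simp add: field_simps)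
      ultimately show ?thesis by simp
    next
      case False
      then have "1 - h * \<omega> \<le> 0" using h by (simp add: field_simps)
      moreover have "p X \<ge> 0" "p (X - h *\<^sub>R Y) \<ge> 0"
        using p_ge order_trans[OF mult_nonneg_nonneg[OF less_imp_le[OF c] norm_ge_zero]] by blast+
      ultimately show ?thesis by (meson mult_nonpos_nonneg order_trans)
    qed
  next
    show "c * norm (S 0 X) \<le> p (S 0 X)" for X using p_ge[of "S 0 X"] by (simp add: T0_T)
  qed (use c that in auto)
  have "1 \<le> C / c" using c cC by simp
  moreover have "norm (S t F) \<le> C / c * exp (\<omega> * t) * norm F" if "t \<ge> 0" for t F
  proof -
    have "C / c * exp (\<omega> * t) * norm (S 0 F) \<le> C / c * exp (\<omega> * t) * norm F"
      using c cC n0 by (intro mult_left_mono) auto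
    with bound[OF that] show ?thesis by (rule order_trans)
  qed
  ultimately show ?thesis by blast
qed

definition Nlift :: "l1 \<Rightarrow> l1" where
  "Nlift F = em (Nop x0 x1 \<beta> (rep_l1 F))"

lemma inH_Nop: "inH x0 x1 p \<Longrightarrow> inH x0 x1 (Nop x0 x1 \<beta> p)"
  by (rule Nop_in_H_and_lipschitz[OF x0_pos \<beta>_meas \<beta>_bdd]) blast

lemma em_Nop_lipschitz:
  "\<exists>K\<ge>0. \<forall>p r. inH x0 x1 p \<longrightarrow> inH x0 x1 r \<longrightarrow>
     norm (em (Nop x0 x1 \<beta> p) - em (Nop x0 x1 \<beta> r)) \<le> K * (norm (em p) + norm (em r)) * norm (em p - em r)"
proof -
  obtain K where K: "K \<ge> 0" "\<And>p r. inH x0 x1 p \<Longrightarrow> inH x0 x1 r \<Longrightarrow>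
      L1norm x0 x1 (\<lambda>x. Nop x0 x1 \<beta> p x - Nop x0 x1 \<beta> r x)
        \<le> K * (L1norm x0 x1 p + L1norm x0 x1 r) * L1norm x0 x1 (\<lambda>x. p x - r x)"
    by (rule Nop_in_H_and_lipschitz[OF x0_pos \<beta>_meas \<beta>_bdd]) blast
  show ?thesis
    using K by (intro exI[of _ K]) (simp add: dist_emb norm_emb inH_Nop)
qed

lemma Nlift_em: "inH x0 x1 f \<Longrightarrow> Nlift (em f) = em (Nop x0 x1 \<beta> f)"
proof -
  assume f: "inH x0 x1 f"
  obtain K where "\<And>p r. inH x0 x1 p \<Longrightarrow> inH x0 x1 r \<Longrightarrow>
     norm (em (Nop x0 x1 \<beta> p) - em (Nop x0 x1 \<beta> r)) \<le> K * (norm (em p) + norm (em r)) * norm (em p - em r)"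
    using em_Nop_lipschitz by blast
  from this[OF inH_rep f, of "em f"] show "Nlift (em f) = em (Nop x0 x1 \<beta> f)"
    by (simp add: Nlift_def emb_rep_emb[OF f])
qed

definition Nlip :: real where
  "Nlip = (SOME K. K \<ge> 0 \<and> (\<forall>p r. inH x0 x1 p \<longrightarrow> inH x0 x1 r \<longrightarrow>
     norm (em (Nop x0 x1 \<beta> p) - em (Nop x0 x1 \<beta> r)) \<le> K * (norm (em p) + norm (em r)) * norm (em p - em r)))"

lemma Nlip: "Nlip \<ge> 0" "inH x0 x1 p \<Longrightarrow> inH x0 x1 r \<Longrightarrow>
     norm (em (Nop x0 x1 \<beta> p) - em (Nop x0 x1 \<beta> r)) \<le> Nlip * (norm (em p) + norm (em r)) * norm (em p - em r)"
  using someI_ex[OF em_Nop_lipschitz[unfolded Bex_def], folded Nlip_def] by blast+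

lemma semilinear_S: "semilinear_c0 S Nlift Nlip"
proof (intro semilinear_c0.intro semilinear_c0_axioms.intro semigroup_S Nlip(1))
  have z: "em (\<lambda>_. 0) = 0" by (simp add: emb_def zero_l1_def)
  have "Nlift (em (\<lambda>_. 0)) = em (Nop x0 x1 \<beta> (\<lambda>_. 0))"
    by (rule Nlift_em) (simp add: inH_def set_integrable_def)
  also have "Nop x0 x1 \<beta> (\<lambda>_. 0) = (\<lambda>_. 0)"
    by (simp add: Nop_def fun_eq_iff set_lebesgue_integral_def)
  finally show "Nlift 0 = 0" by (simp add: z)
next
  fix F G :: l1
  have "em (rep_l1 F) - em (rep_l1 G) = S 0 (F - G)"
    by (simp add: T_diff flip: S_0)
  then have "norm (em (rep_l1 F) - em (rep_l1 G)) \<le> norm (F - G)"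
    by (simp add: S_0 norm_emb_rep)
  then have "Nlip * (norm (em (rep_l1 F)) + norm (em (rep_l1 G))) * norm (em (rep_l1 F) - em (rep_l1 G))
      \<le> Nlip * (norm F + norm G) * norm (F - G)"
    using Nlip(1) by (intro mult_mono mult_left_mono add_mono norm_emb_rep) auto
  then show "norm (Nlift F - Nlift G) \<le> Nlip * (norm F + norm G) * norm (F - G)"
    using Nlip(2)[OF inH_rep inH_rep, of F G] by (simp add: Nlift_def)
qed

sublocale semilinear_c0 S Nlift Nlip
  by (rule semilinear_S)

lemma H_integral_duhamel:
  assumes t: "0 \<le> t" and u: "\<And>s. s \<in> {0..t} \<Longrightarrow> inH x0 x1 (u s)"
    and cont: "continuous_on {0..t} (\<lambda>s. em (u s))"
  shows "H_integral x0 x1 (\<lambda>s. T (t - s) (Nop x0 x1 \<beta> (u s))) 0 t I \<longleftrightarrow>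
    inH x0 x1 I \<and> em I = duhamel (\<lambda>s. em (u s)) t"
proof -
  have eq: "em (T (t - s) (Nop x0 x1 \<beta> (u s))) = S (t - s) (Nlift (em (u s)))" if "s \<in> {0..t}" for s
    using that u by (simp add: Nlift_em S_em inH_Nop)
  have "continuous_on {0..t} (\<lambda>s. em (T (t - s) (Nop x0 x1 \<beta> (u s))))"
    using continuous_duhamel_integrand[OF cont order_refl] by (rule continuous_on_eq) (simp add: eq)
  then have "H_integral x0 x1 (\<lambda>s. T (t - s) (Nop x0 x1 \<beta> (u s))) 0 t I \<longleftrightarrow>
    inH x0 x1 I \<and> em I = integral {0..t} (\<lambda>s. em (T (t - s) (Nop x0 x1 \<beta> (u s))))"
    using t u by (intro H_integral_iff inH_T inH_Nop) auto
  also have "integral {0..t} (\<lambda>s. em (T (t - s) (Nop x0 x1 \<beta> (u s)))) = duhamel (\<lambda>s. em (u s)) t"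
    unfolding duhamel_def by (intro integral_cong eq)
  finally show ?thesis .
qed

lemma continuous_em_iff:
  assumes "\<And>t. t \<in> J \<Longrightarrow> inH x0 x1 (u t)"
  shows "continuous_on J (\<lambda>t. em (u t)) \<longleftrightarrow>
    (\<forall>t\<in>J. ((\<lambda>s. L1norm x0 x1 (\<lambda>x. u s x - u t x)) \<longlongrightarrow> 0) (at t within J))"
  unfolding continuous_on
proof (intro ball_cong refl)
  fix t assume t: "t \<in> J"
  have "((\<lambda>s. em (u s)) \<longlongrightarrow> em (u t)) (at t within J) \<longleftrightarrow>
      ((\<lambda>s. norm (em (u s) - em (u t))) \<longlongrightarrow> 0) (at t within J)"
    by (simp add: tendsto_norm_zero_iff flip: Lim_null)
  also have "\<dots> \<longleftrightarrow> ((\<lambda>s. L1norm x0 x1 (\<lambda>x. u s x - u t x)) \<longlongrightarrow> 0) (at t within J)"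
    by (rule filterlim_cong) (auto simp: eventually_at_filter dist_emb assms t)
  finally show "((\<lambda>s. em (u s)) \<longlongrightarrow> em (u t)) (at t within J) \<longleftrightarrow>
    ((\<lambda>s. L1norm x0 x1 (\<lambda>x. u s x - u t x)) \<longlongrightarrow> 0) (at t within J)" .
qed

lemma mild_on_iff:
  assumes f: "inH x0 x1 f"
  shows "mild_on x0 x1 \<beta> T \<tau> u f \<longleftrightarrow>
    (\<forall>t\<in>{0..\<tau>}. inH x0 x1 (u t)) \<and> mild \<tau> (\<lambda>t. em (u t)) (em f)"
proof (cases "\<forall>t\<in>{0..\<tau>}. inH x0 x1 (u t)")
  case True
  have "(\<exists>I. H_integral x0 x1 (\<lambda>s. T (t - s) (Nop x0 x1 \<beta> (u s))) 0 t I \<and>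
        L1norm x0 x1 (\<lambda>x. u t x - (T t f x + I x)) = 0) \<longleftrightarrow>
      em (u t) = S t (em f) + duhamel (\<lambda>s. em (u s)) t"
    if t: "t \<in> {0..\<tau>}" and cont: "continuous_on {0..\<tau>} (\<lambda>t. em (u t))" for t
  proof -
    have ct: "continuous_on {0..t} (\<lambda>t. em (u t))"
      by (rule continuous_on_subset[OF cont]) (use t in auto)
    have Hi: "H_integral x0 x1 (\<lambda>s. T (t - s) (Nop x0 x1 \<beta> (u s))) 0 t I \<longleftrightarrow>
        inH x0 x1 I \<and> em I = duhamel (\<lambda>s. em (u s)) t" for I
      using t True ct by (intro H_integral_duhamel) auto
    have nrm: "L1norm x0 x1 (\<lambda>x. u t x - (T t f x + I x)) = 0 \<longleftrightarrow> em (u t) = S t (em f) + em I"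
      if I: "inH x0 x1 I" for I
    proof -
      have TI: "inH x0 x1 (\<lambda>x. T t f x + I x)" "em (\<lambda>x. T t f x + I x) = S t (em f) + em I"
        using inH_linear[of x0 x1 "T t f" I 1 1] emb_linear[of x0 x1 "T t f" I 1 1] t f I
        by (auto simp: inH_T S_em)
      have ut: "inH x0 x1 (u t)" using True t by simp
      show ?thesis
        using emb_eq_iff[OF ut TI(1)] TI(2) by simp
    qed
    have d: "em (rep_l1 (duhamel (\<lambda>s. em (u s)) t)) = duhamel (\<lambda>s. em (u s)) t"
      using T0_duhamel[OF ct order_refl] by (simp add: S_0)
    show ?thesis
    proof
      assume "\<exists>I. H_integral x0 x1 (\<lambda>s. T (t - s) (Nop x0 x1 \<beta> (u s))) 0 t I \<and>
        L1norm x0 x1 (\<lambda>x. u t x - (T t f x + I x)) = 0"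
      then obtain I where "inH x0 x1 I" "em I = duhamel (\<lambda>s. em (u s)) t"
        "L1norm x0 x1 (\<lambda>x. u t x - (T t f x + I x)) = 0"
        unfolding Hi by (elim exE conjE)
      then show "em (u t) = S t (em f) + duhamel (\<lambda>s. em (u s)) t" using nrm by simp
    next
      assume "em (u t) = S t (em f) + duhamel (\<lambda>s. em (u s)) t"
      then show "\<exists>I. H_integral x0 x1 (\<lambda>s. T (t - s) (Nop x0 x1 \<beta> (u s))) 0 t I \<and>
        L1norm x0 x1 (\<lambda>x. u t x - (T t f x + I x)) = 0"
        unfolding Hi using d nrm[OF inH_rep, of "duhamel (\<lambda>s. em (u s)) t"]
        by (intro exI[of _ "rep_l1 (duhamel (\<lambda>s. em (u s)) t)"]) (simp add: inH_rep)
    qed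
  qed
  then show ?thesis
    using True continuous_em_iff[of "{0..\<tau>}" u] unfolding mild_on_def mild_def by auto
next
  case False
  then show ?thesis unfolding mild_on_def by blast
qed

lemma mild_on_rep:
  assumes f: "inH x0 x1 f" and U: "mild \<tau> U (em f)"
  shows "mild_on x0 x1 \<beta> T \<tau> (\<lambda>t. rep_l1 (U t)) f"
    and "t \<in> {0..\<tau>} \<Longrightarrow> em (rep_l1 (U t)) = U t"
proof -
  have eq: "em (rep_l1 (U t)) = U t" if t: "t \<in> {0..\<tau>}" for t
  proof -
    have "continuous_on {0..\<tau>} U" "U t = S t (em f) + duhamel U t"
      using U t by (auto simp: mild_def)
    moreover have "S 0 (S t (em f) + duhamel U t) = S 0 (S t (em f)) + S 0 (duhamel U t)"
      using S_linear[of 0 1 "S t (em f)" 1 "duhamel U t"] by simp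
    ultimately have "S 0 (U t) = U t"
      using t T0_duhamel[of \<tau> U t] by (simp add: T0_T)
    then show ?thesis by (simp add: S_0)
  qed
  then show "t \<in> {0..\<tau>} \<Longrightarrow> em (rep_l1 (U t)) = U t" .
  show "mild_on x0 x1 \<beta> T \<tau> (\<lambda>t. rep_l1 (U t)) f"
    unfolding mild_on_iff[OF f]
    by (intro conjI ballI inH_rep mild_cong[OF _ U]) (simp add: eq)
qed

lemma stable_of_chi_less_1:
  assumes "chi 0 < 1"
  shows "loc_asym_stable x0 x1 \<beta> T"
proof -
  have "(chi \<longlongrightarrow> chi 0) (at 0)"
    using chi_cont by (simp add: continuous_on_eq_continuous_at isCont_def)
  then have "\<forall>\<^sub>F m in at 0. chi m < 1" using assms by (rule order_tendstoD(2))
  then obtain d where d: "d > 0" "\<And>m. m \<noteq> 0 \<Longrightarrow> \<bar>m\<bar> < d \<Longrightarrow> chi m < 1"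
    by (auto simp: eventually_at dist_norm)
  define \<alpha> where "\<alpha> = d / 2"
  have \<alpha>: "\<alpha> > 0" "chi (- \<alpha>) < 1" using d by (auto simp: \<alpha>_def)
  obtain M where M: "M \<ge> 1" "\<And>t F. t \<ge> 0 \<Longrightarrow> norm (S t F) \<le> M * exp (- \<alpha> * t) * norm F"
    using growth[OF \<alpha>(2)] by blast
  define A where "A = M * Nlip / \<alpha>"
  have A0: "A \<ge> 0" using M Nlip(1) \<alpha> by (simp add: A_def)
  have A: "M * Nlip * integral {0..t} (\<lambda>s. exp (- \<alpha> * (t - s)) * exp (2 * - \<alpha> * s)) \<le> A * exp (- \<alpha> * t)"
    if t: "t \<ge> 0" for t
  proof -
    have "integral {0..t} (\<lambda>s. exp (- \<alpha> * (t - s)) * exp (2 * - \<alpha> * s))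
        = integral {0..t} (\<lambda>s. exp (- \<alpha> * t) * exp (- \<alpha> * s))"
      by (intro integral_cong) (simp add: algebra_simps flip: exp_add)
    also have "\<dots> = exp (- \<alpha> * t) * ((exp (- \<alpha> * t) - 1) / - \<alpha>)"
      using \<alpha> t integral_exp[of "- \<alpha>" t] by simp
    also have "\<dots> \<le> exp (- \<alpha> * t) * (1 / \<alpha>)"
      using \<alpha> t by (intro mult_left_mono) (auto simp: field_simps)
    finally have "M * Nlip * integral {0..t} (\<lambda>s. exp (- \<alpha> * (t - s)) * exp (2 * - \<alpha> * s))
        \<le> M * Nlip * (exp (- \<alpha> * t) * (1 / \<alpha>))"
      using M Nlip(1) by (intro mult_left_mono) auto
    then show ?thesis by (simp add: A_def mult_ac)
  qed
  define \<eta> where "\<eta> = 1 / (8 * M * A + 1)"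
  have \<eta>: "\<eta> > 0" using M A0 by (auto simp: \<eta>_def intro!: add_nonneg_pos)
  have M2: "2 * M \<ge> 1" using M by simp
  show ?thesis
    unfolding loc_asym_stable_def
  proof (rule exI[of _ \<eta>], rule conjI[OF \<eta>], rule exI[of _ "2 * M"], rule conjI[OF M2],
      rule exI[of _ \<alpha>], rule conjI[OF \<alpha>(1)], intro allI impI)
    fix f assume "inH x0 x1 f \<and> L1norm x0 x1 f < \<eta>"
    then have f: "inH x0 x1 f" and small: "L1norm x0 x1 f < \<eta>" by auto
    define n where "n = L1norm x0 x1 f"
    have n: "norm (em f) = n" "n \<ge> 0" "n < \<eta>"
      using norm_emb[OF f] norm_ge_zero[of "em f"] small by (auto simp: n_def)
    define a where "a = M * n"
    have aA: "8 * a * A \<le> 1"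
    proof -
      have "8 * a * A = (8 * M * A) * n" by (simp add: a_def)
      also have "\<dots> \<le> (8 * M * A + 1) * \<eta>" using n M A0 by (intro mult_mono) auto
      also have "\<dots> = 1" using \<eta> by (auto simp: \<eta>_def)
      finally show ?thesis .
    qed
    have Tf: "norm (S t (em f)) \<le> a * exp (- \<alpha> * t)" if "t \<ge> 0" for t
      using M(2)[OF that, of "em f"] by (simp add: a_def n mult_ac)
    have "\<exists>U. (\<forall>\<tau>. mild \<tau> U (em f)) \<and> (\<forall>t\<ge>0. norm (U t - S t (em f)) \<le> 8 * a^2 * A * exp (- \<alpha> * t))"
    proof (rule mild_glue)
      fix k :: nat
      show "\<exists>u. mild (real k) u (em f) \<and>
          (\<forall>t\<in>{0..real k}. norm (u t - S t (em f)) \<le> 8 * a^2 * A * exp (- \<alpha> * t))"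
        using M Tf A by (intro mild_exists[where M=M and \<omega>="- \<alpha>" and \<gamma>="- \<alpha>"] aA) auto
    qed
    then obtain U where U: "\<And>\<tau>. mild \<tau> U (em f)"
      "\<And>t. t \<ge> 0 \<Longrightarrow> norm (U t - S t (em f)) \<le> 8 * a^2 * A * exp (- \<alpha> * t)" by blast
    define u where "u t = rep_l1 (U t)" for t
    have u: "mild_global x0 x1 \<beta> T u f"
      using mild_on_rep(1)[OF f U(1)] by (simp add: mild_global_def u_def[abs_def])
    have em_u: "em (u t) = U t" if "t \<ge> 0" for t
      using mild_on_rep(2)[OF f U(1)[of t], of t] that by (simp add: u_def)
    show "\<exists>u. mild_global x0 x1 \<beta> T u f \<and>
             (\<forall>v. mild_global x0 x1 \<beta> T v f \<longrightarrow> (\<forall>t\<ge>0. L1norm x0 x1 (\<lambda>x. u t x - v t x) = 0)) \<and>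
             (\<forall>t\<ge>0. L1norm x0 x1 (u t) \<le> 2 * M * exp (- \<alpha> * t) * L1norm x0 x1 f)"
    proof (intro exI[of _ u] conjI allI impI u)
      fix v and t :: real assume v: "mild_global x0 x1 \<beta> T v f" and t: "t \<ge> 0"
      have "mild_on x0 x1 \<beta> T t v f" using v t by (simp add: mild_global_def)
      then have v': "inH x0 x1 (v t)" "mild t (\<lambda>t. em (v t)) (em f)"
        using t by (auto simp: mild_on_iff[OF f])
      have "U t = em (v t)" using mild_unique[OF U(1) v'(2), of t] t by simp
      then show "L1norm x0 x1 (\<lambda>x. u t x - v t x) = 0"
        using emb_eq_iff[of x0 x1 "u t" "v t"] em_u[OF t] v'(1) inH_rep by (simp add: u_def)
    next
      fix t :: real assume t: "t \<ge> 0"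
      have "norm (U t) \<le> norm (S t (em f)) + norm (U t - S t (em f))"
        using norm_triangle_ineq[of "S t (em f)" "U t - S t (em f)"] by simp
      also have "\<dots> \<le> a * exp (- \<alpha> * t) + 8 * a^2 * A * exp (- \<alpha> * t)"
        by (intro add_mono Tf U t)
      also have "\<dots> = a * exp (- \<alpha> * t) + (8 * a * A) * (a * exp (- \<alpha> * t))"
        by (simp add: power2_eq_square)
      also have "\<dots> \<le> a * exp (- \<alpha> * t) + 1 * (a * exp (- \<alpha> * t))"
        using M n by (intro add_left_mono mult_right_mono aA) (auto simp: a_def)
      finally show "L1norm x0 x1 (u t) \<le> 2 * M * exp (- \<alpha> * t) * L1norm x0 x1 f"
        using norm_emb[of x0 x1 "u t"] em_u[OF t] inH_rep by (simp add: u_def a_def n_def mult_ac)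
    qed
  qed
qed

lemma unstable_of_chi_greater_1:
  assumes "chi 0 > 1"
  shows "unstable x0 x1 \<beta> T"
proof -
  obtain l where l: "l > 0" "chi l = 1" "\<And>m. m > l \<Longrightarrow> chi m < 1"
    using largest_characteristic_root[OF assms] by blast
  define \<omega> where "\<omega> = 3 / 2 * l"
  have "chi \<omega> < 1" using l by (intro l(3)) (simp add: \<omega>_def)
  then obtain M where M: "M \<ge> 1" "\<And>t F. t \<ge> 0 \<Longrightarrow> norm (S t F) \<le> M * exp (\<omega> * t) * norm F"
    using growth by blast
  define \<phi> where "\<phi> x = E l x / g x" for x
  have L: "gen_L x0 x1 g q w \<phi> (\<lambda>x. l * \<phi> x)"
    using E_eigenfunction[OF l(2)] by (simp add: \<phi>_def[abs_def])
  have \<phi>: "inH x0 x1 \<phi>" "inH x0 x1 (\<lambda>x. l * \<phi> x)" using L by (auto simp: gen_L_def)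
  have "em (\<lambda>x. l * \<phi> x) = l *\<^sub>R em \<phi>"
    using emb_linear[OF \<phi>(1) \<phi>(1), of l 0] by simp
  then have gen_\<phi>: "gen (em \<phi>) (l *\<^sub>R em \<phi>)" using gen_iff[OF \<phi>] L by simp
  define N0 where "N0 = norm (em \<phi>)"
  have N0: "N0 > 0"
  proof -
    have "em \<phi> \<noteq> 0"
    proof
      assume z: "em \<phi> = 0"
      have "AE x in lborel. rep_l1 (em \<phi>) x = 0"
        unfolding z using rep_l1_linear[of 0 0 0 0] by simp
      then have "AE x in lborel. x \<in> {x0..x1} \<longrightarrow> \<phi> x = 0"
        using rep_emb[OF \<phi>(1)] by eventually_elim auto
      then have "AE x in lborel. indicator {x0..x1} x *\<^sub>R (q x / g x * E l x) = 0"
        by eventually_elim (auto simp: \<phi>_def indicator_def)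
      then have "chi l = 0"
        unfolding chi_def set_lebesgue_integral_def by (rule integral_eq_zero_AE)
      with l(2) show False by simp
    qed
    then show ?thesis by (simp add: N0_def)
  qed
  define B where "B = 2 * M * Nlip / l"
  have B0: "B \<ge> 0" using M Nlip(1) l by (simp add: B_def)
  define \<delta> where "\<delta> = 1 / (16 * B * N0 + 1)"
  have "16 * B * N0 + 1 > 0" using B0 N0 by (intro add_nonneg_pos mult_nonneg_nonneg) auto
  then have \<delta>: "\<delta> > 0" "16 * B * N0 * \<delta> \<le> 1"
    by (auto simp: \<delta>_def divide_le_eq)
  define r where "r n = \<delta> * exp (- l * real n)" for n :: nat
  have r: "r n > 0" for n using \<delta> by (simp add: r_def)
  define fs where "fs n x = r n * \<phi> x" for n x
  have fsH: "inH x0 x1 (fs n)" and em_fs: "em (fs n) = r n *\<^sub>R em \<phi>" for n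
    using inH_linear[OF \<phi>(1) \<phi>(1), of "r n" 0] emb_linear[OF \<phi>(1) \<phi>(1), of "r n" 0]
    by (simp_all add: fs_def[abs_def])
  have norm_fs: "L1norm x0 x1 (fs n) = r n * N0" for n
    using norm_emb[OF fsH[of n]] r[of n] by (simp add: em_fs N0_def)
  have S_fs: "S t (em (fs n)) = (r n * exp (l * t)) *\<^sub>R em \<phi>" if "t \<ge> 0" for t n
    using T_eigenvector[OF gen_\<phi> that] that by (simp add: em_fs T_scaleR)
  have r0: "r \<longlonglongrightarrow> 0"
  proof -
    have "(\<lambda>n. \<delta> * exp (- l) ^ n) \<longlonglongrightarrow> \<delta> * 0"
      using l by (intro tendsto_mult tendsto_const LIMSEQ_realpow_zero) auto
    then show ?thesis by (simp add: r_def[abs_def] mult.commute flip: exp_of_nat_mult)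
  qed
  have sol: "\<exists>U. mild (real n) U (em (fs n)) \<and> norm (U (real n)) \<ge> \<delta> * N0 / 2" for n :: nat
  proof -
    define a where "a = r n * N0"
    define A where "A = B * exp (l * real n)"
    have a_exp: "a * exp (l * real n) = \<delta> * N0"
      by (simp add: a_def r_def exp_minus field_simps)
    have aA: "8 * a * A \<le> 1 / 2"
    proof -
      have "8 * a * A = 8 * B * (a * exp (l * real n))" by (simp add: A_def)
      also have "\<dots> = 8 * B * (\<delta> * N0)" by (simp add: a_exp)
      finally show ?thesis using \<delta>(2) by (simp add: mult_ac)
    qed
    have "\<exists>U. mild (real n) U (em (fs n)) \<and>
        (\<forall>t\<in>{0..real n}. norm (U t - S t (em (fs n))) \<le> 8 * a^2 * A * exp (l * t))"
    proof (rule mild_exists[where M=M and \<omega>=\<omega>])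
      show "real n \<ge> 0" "M \<ge> 0" using M by auto
      show "norm (S t F) \<le> M * exp (\<omega> * t) * norm F" if "t \<ge> 0" for t F by (rule M(2)[OF that])
      show "8 * a * A \<le> 1" using aA by simp
      show "norm (S t (em (fs n))) \<le> a * exp (l * t)" if "t \<in> {0..real n}" for t
        using S_fs[of t n] that r[of n] by (simp add: a_def N0_def)
      fix t assume t: "t \<in> {0..real n}"
      have "integral {0..t} (\<lambda>s. exp (\<omega> * (t - s)) * exp (2 * l * s))
          = integral {0..t} (\<lambda>s. exp (\<omega> * t) * exp (l / 2 * s))"
        by (intro integral_cong) (simp add: \<omega>_def field_simps flip: exp_add)
      also have "\<dots> = exp (\<omega> * t) * ((exp (l / 2 * t) - 1) / (l / 2))"
        using l t integral_exp[of "l / 2" t] by simp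
      also have "\<dots> \<le> exp (\<omega> * t) * (exp (l / 2 * t) / (l / 2))"
        using l by (intro mult_left_mono divide_right_mono) auto
      also have "\<dots> = 2 / l * (exp (\<omega> * t) * exp (l / 2 * t))"
        using l by (simp add: field_simps)
      also have "exp (\<omega> * t) * exp (l / 2 * t) = exp (l * t) * exp (l * t)"
        by (simp add: \<omega>_def field_simps flip: exp_add)
      also have "2 / l * (exp (l * t) * exp (l * t)) \<le> 2 / l * (exp (l * real n) * exp (l * t))"
        using l t by (intro mult_left_mono mult_right_mono) auto
      finally have "M * Nlip * integral {0..t} (\<lambda>s. exp (\<omega> * (t - s)) * exp (2 * l * s))
          \<le> M * Nlip * (2 / l * (exp (l * real n) * exp (l * t)))"
        using M Nlip(1) by (intro mult_left_mono) auto
      then show "M * Nlip * integral {0..t} (\<lambda>s. exp (\<omega> * (t - s)) * exp (2 * l * s)) \<le> A * exp (l * t)"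
        by (simp add: A_def B_def mult_ac)
    qed
    then obtain U where U: "mild (real n) U (em (fs n))"
      "norm (U (real n) - S (real n) (em (fs n))) \<le> 8 * a^2 * A * exp (l * real n)" by force
    have "8 * a^2 * A * exp (l * real n) = (8 * a * A) * (\<delta> * N0)"
      by (simp add: power2_eq_square flip: a_exp)
    also have "\<dots> \<le> 1 / 2 * (\<delta> * N0)"
      using \<delta>(1) N0 by (intro mult_right_mono aA) auto
    finally have "norm (U (real n) - S (real n) (em (fs n))) \<le> \<delta> * N0 / 2" using U(2) by simp
    moreover have "norm (S (real n) (em (fs n))) = \<delta> * N0"
      using S_fs[of "real n" n] r[of n] a_exp by (simp add: a_def N0_def mult_ac)
    moreover have "norm (S (real n) (em (fs n))) - norm (U (real n) - S (real n) (em (fs n))) \<le> norm (U (real n))"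
      using norm_triangle_ineq2[of "S (real n) (em (fs n))" "S (real n) (em (fs n)) - U (real n)"]
      by (simp add: norm_minus_commute)
    ultimately have "norm (U (real n)) \<ge> \<delta> * N0 / 2" by simp
    with U(1) show ?thesis by blast
  qed
  show ?thesis
    unfolding unstable_def
  proof (intro exI[of _ "\<delta> * N0 / 2"] exI[of _ fs] conjI allI impI fsH)
    show "\<delta> * N0 / 2 > 0" using \<delta> N0 by simp
    show "(\<lambda>n. L1norm x0 x1 (fs n)) \<longlonglongrightarrow> 0"
      unfolding norm_fs using tendsto_mult[OF r0 tendsto_const[of N0]] by simp
  next
    fix n :: nat
    obtain U where U: "mild (real n) U (em (fs n))" "norm (U (real n)) \<ge> \<delta> * N0 / 2"
      using sol by blast
    show "\<exists>u. mild_on x0 x1 \<beta> T (real n) u (fs n)"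
      using mild_on_rep(1)[OF fsH U(1)] by blast
    fix u assume "mild_on x0 x1 \<beta> T (real n) u (fs n)"
    then have u: "inH x0 x1 (u (real n))" "mild (real n) (\<lambda>t. em (u t)) (em (fs n))"
      by (auto simp: mild_on_iff[OF fsH])
    have "em (u (real n)) = U (real n)" using mild_unique[OF u(2) U(1), of "real n"] by simp
    then show "\<delta> * N0 / 2 \<le> L1norm x0 x1 (u (real n))"
      using U(2) norm_emb[OF u(1)] by simp
  qed
qed

end

theorem theorem1:
  fixes x0 x1 :: real
    and g w q :: "real \<Rightarrow> real"
    and \<beta> :: "real \<Rightarrow> real \<Rightarrow> real"
    and T :: "real \<Rightarrow> (real \<Rightarrow> real) \<Rightarrow> (real \<Rightarrow> real)"
  assumes "0 < x0" and "x0 < x1"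
    and "\<exists>g'. continuous_on {x0..x1} g' \<and>
               (\<forall>x\<in>{x0..x1}. (g has_real_derivative g' x) (at x within {x0..x1}))"
    and "\<forall>x\<in>{x0..x1}. g x > 0"
    and "set_borel_measurable lborel ({x0..x1} \<times> {x0..x1}) (\<lambda>z. \<beta> (fst z) (snd z))"
    and "\<exists>B. AE z in lborel. z \<in> {x0..x1} \<times> {x0..x1} \<longrightarrow> \<bar>\<beta> (fst z) (snd z)\<bar> \<le> B"
    and "\<forall>x\<in>{x0..x1}. \<forall>y\<in>{x0..x1}. \<beta> x y = \<beta> y x"
    and "\<forall>x\<in>{x0..x1}. \<forall>y\<in>{x0..x1}. x + y > x1 \<longrightarrow> \<beta> x y = 0"
    and "continuous_on {x0..x1} w"
    and "AE x in lborel. x \<in> {x0..x1} \<longrightarrow> w x \<ge> 0"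
    and "set_borel_measurable lborel {x0..x1} q"
    and "\<exists>B. AE x in lborel. x \<in> {x0..x1} \<longrightarrow> \<bar>q x\<bar> \<le> B"
    and "AE x in lborel. x \<in> {x0..x1} \<longrightarrow> q x \<ge> 0"
    and "generated_by_L x0 x1 g q w T"
  shows "((LINT x:{x0..x1}|lborel. q x / g x * exp (- (LINT s:{x0..x}|lborel. w s / g s))) < 1
            \<longrightarrow> loc_asym_stable x0 x1 \<beta> T)
       \<and> ((LINT x:{x0..x1}|lborel. q x / g x * exp (- (LINT s:{x0..x}|lborel. w s / g s))) > 1
            \<longrightarrow> unstable x0 x1 \<beta> T)"
proof -
  have "continuous_on {x0..x1} g" using assms(3) by (blast intro: DERIV_continuous_on)
  then interpret coagulation x0 x1 g w q \<beta> T
    using assms by unfold_locales auto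
  have "chi 0 = (LINT x:{x0..x1}|lborel. q x / g x * exp (- (LINT s:{x0..x}|lborel. w s / g s)))"
    by (simp add: chi_def E_def)
  then show ?thesis using stable_of_chi_less_1 unstable_of_chi_greater_1 by simp
qed

end
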